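(* Let $\psi\in\mathcal S(\Gamma)$. Suppose that $\langle\psi,\psi\rangle_{\mathcal B}=1_{\mathcal B}$ and $(\overline\partial p_\psi)p_\psi=0$. Then $\langle\widehat\psi,\widehat\psi\rangle_{\mathcal B^\circ}=1_{\mathcal B^\circ}$ and $(\partial p_{\widehat\psi})p_{\widehat\psi}=0$. In other words, if $\psi$ is a tight Gabor frame and satisfies the self-duality equation, then $\widehat\psi\in\mathcal S(\widehat\Gamma)$ is also a tight Gabor frame and satisfies the anti-self duality equation.
   Context: All abelian groups are written additively. $\Gamma$ is a second countable locally compact abelian group, elementary in the sense of Bruhat, so that Schwartz(–Bruhat) spaces are defined; $\widehat\Gamma$ is its Pontryagin dual with Haar measure chosen so that Plancherel's theorem holds for $\mathcal F(f)(\gamma)=\widehat f(\gamma)=\int_\Gamma f(s)\overline{\gamma(s)}\,ds$; $G=\widehat\Gamma\times\Gamma$ with product Haar measure. Scalar products on $L^2$ spaces are linear in the first variable. On $L^2(\Gamma)$: $\pi(\gamma,t)\xi(s)=\gamma(s)\xi(s-t)$. On $L^2(\widehat\Gamma)$: $\pi^\circ\iota(\gamma,t)\xi(\delta)=\overline{(\delta-\gamma)(t)}\,\xi(\delta-\gamma)$. For $\rho=\pi$ or $\pi^\circ\iota$, $\rho^*(g):=\rho(g)^*$. $\sigma((\gamma_1,t_1),(\gamma_2,t_2))=\overline{\gamma_2(t_1)}$. $\Lambda\subset G$ is a lattice with covolume $s(\Lambda)$, and $\Lambda^\circ=\{\lambda^\circ\in G:\sigma(\lambda^\circ,\lambda)\overline{\sigma(\lambda,\lambda^\circ)}=1\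 \forall\lambda\in\Lambda\}$. $\mathcal A_\infty=\{\sum_{\lambda\in\Lambda}a(\lambda)\pi(\lambda):a\in\mathcal S(\Lambda)\}$ and $\mathcal B_\infty=\{\sum_{\lambda^\circ\in\Lambda^\circ}b(\lambda^\circ)\pi^*(\lambda^\circ):b\in\mathcal S(\Lambda^\circ)\}$, with $\mathcal S(\Lambda)$ the rapidly decreasing functions; $\mathcal A^\circ_\infty,\mathcal B^\circ_\infty$ are defined likewise with $\pi^\circ\iota$ in place of $\pi$. Elements of $\mathcal B_\infty,\mathcal B^\circ_\infty$ act on the right (the product is opposite to composition): $\xi\cdot b=\sum b(\lambda^\circ)\rho^*(\lambda^\circ)\xi$. The subscripts $\mathcal A,\mathcal B,\mathcal A^\circ,\mathcal B^\circ$ on products refer to these algebras. The hermitian products on $\mathcal S(\Gamma)$ ($\rho=\pi$) and $\mathcal S(\widehat\Gamma)$ ($\rho=\pi^\circ\iota$) are $${}_\bullet\langle\xi,\eta\rangle=\sum_{\lambda\in\Lambda}\langle\xi,\rho(\lambda)\eta\rangle\rho(\lambda),\qquad \langle\xi,\eta\rangle_\bullet=\frac1{s(\Lambda)}\sum_{\lambda^\circ\in\Lambda^\circ}\langle\rho(\lambda^\circ)\eta,\xi\rangle\rho^*(\lambda^\circ),$$ making them equivalence bimodules between $\mathcal A_\infty,\mathcal B_\infty$ and between $\mathcal A_\infty^\circ,\mathcal B_\infty^\circ$; in particular ${}_\bullet\langle\xi,\eta\rangle\cdot\zeta=\xi\cdot\langle\eta,\zeta\rangle_\bullet$. Write $p_\psi={}_{\mathcal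 A}\langle\psi,\psi\rangle$ and $p_{\widehat\psi}={}_{\mathcal A^\circ}\langle\widehat\psi,\widehat\psi\rangle$. In this statement "$\psi$ is a tight Gabor frame" means $\langle\psi,\psi\rangle_{\mathcal B}=1_{\mathcal B}$ (resp. for $\widehat\psi$ with $\mathcal B^\circ$). Standing assumptions: there are $*$-derivations $\partial_1,\partial_2$ on the left algebras $\mathcal A_\infty,\mathcal A^\circ_\infty$ and $\partial_1',\partial_2'$ on the right algebras $\mathcal B_\infty,\mathcal B^\circ_\infty$, the traces (value of the coefficient at $0$) on the left algebras vanish on $\partial_jK$, and there are linear maps (covariant derivatives) $\nabla_1,\nabla_2$ on each bimodule with $\nabla_j(K\cdot\xi)=(\partial_jK)\cdot\xi+K\cdot\nabla_j\xi$, $\partial_j({}_\bullet\langle\xi,\eta\rangle)={}_\bullet\langle\nabla_j\xi,\eta\rangle+{}_\bullet\langle\xi,\nabla_j\eta\rangle$, $\nabla_j(\xi\cdot b)=(\nabla_j\xi)\cdot b+\xi\cdot\partial_j'b$, $\partial_j'(\langle\xi,\eta\rangle_\bullet)=\langle\nabla_j\xi,\eta\rangle_\bullet+\langle\xi,\nabla_j\eta\rangle_\bullet$, and $\langle\nabla_j\xi,\eta\rangle_{L^2}=-\langle\xi,\nabla_j\eta\rangle_{L^2}$. Moreover $\mathcal F\nabla_1=\nabla_2\mathcal F$ and $\mathcal F\nabla_2=\nabla_1\mathcal F$ on $\mathcal S(\Gamma)$. Put $\overline\partial=\partial_1+i\partial_2$, $\partial=\partial_1-i\partial_2$. The self-duality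 equation for a projection $p$ is $(\overline\partial p)p=0$, and the anti-self duality equation is $(\partial p)p=0$. *)

theory Defs
  imports "HOL-Analysis.Analysis"
begin

section \<open>The Pontryagin dual as a topological group, written additively\<close>

typedef (overloaded) 'a dual_group =
  "{u :: 'a::{topological_space,ab_group_add} \<Rightarrow> complex.
      continuous_on UNIV u \<and> (\<forall>s. cmod (u s) = 1) \<and> (\<forall>s t. u (s + t) = u s * u t)}"
  morphisms character Abs_dual_group
  by (rule exI[of _ "\<lambda>_. 1"]) auto

setup_lifting type_definition_dual_group

lemma character_add: "character \<gamma> (s + t) = character \<gamma> s * character \<gamma> t"
  and norm_character [simp]: "cmod (character \<gamma> s) = 1"
  and continuous_character: "continuous_on UNIV (character \<gamma>)"
  using character[of \<gamma>] by auto

instantiation dual_group :: ("{topological_space,ab_group_add}") ab_group_add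
begin

lift_definition zero_dual_group :: "'a dual_group" is "\<lambda>_. 1"
  by auto

lift_definition plus_dual_group :: "'a dual_group \<Rightarrow> 'a dual_group \<Rightarrow> 'a dual_group"
  is "\<lambda>u u' s. u s * u' s"
  by (auto intro!: continuous_intros simp: norm_mult)

lift_definition uminus_dual_group :: "'a dual_group \<Rightarrow> 'a dual_group"
  is "\<lambda>u s. cnj (u s)"
  by (auto intro!: continuous_intros)

definition minus_dual_group :: "'a dual_group \<Rightarrow> 'a dual_group \<Rightarrow> 'a dual_group"
  where "\<gamma> - \<delta> = \<gamma> + - (\<delta> :: 'a dual_group)"

instance
proof
  fix a b c :: "'a dual_group"
  show "a + b + c = a + (b + c)" by transfer (auto simp: mult.assoc)
  show "a + b = b + a" by transfer (auto simp: mult.commute)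
  show "0 + a = a" by transfer auto
  show "- a + a = 0"
    by transfer (auto simp: fun_eq_iff mult.commute complex_norm_square[symmetric])
  show "a - b = a + - b" by (rule minus_dual_group_def)
qed

end

text \<open>The compact-open topology, expressed as uniform convergence on compact sets.\<close>

instantiation dual_group :: ("{topological_space,ab_group_add}") topological_space
begin

definition open_dual_group :: "'a dual_group set \<Rightarrow> bool" where
  "open U \<longleftrightarrow> (\<forall>\<gamma>\<in>U. \<exists>K \<epsilon>. compact K \<and> \<epsilon> > 0 \<and>
     {\<delta>. \<forall>s\<in>K. cmod (character \<delta> s - character \<gamma> s) < \<epsilon>} \<subseteq> (U :: 'a dual_group set))"

instance
proof
  show "open (UNIV :: 'a dual_group set)"
    unfolding open_dual_group_def
    by (intro ballI exI[of _ "{}"] exI[of _ "1::real"] conjI compact_empty zero_less_one subset_UNIV)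
next
  fix S T :: "'a dual_group set"
  assume S: "open S" and T: "open T"
  show "open (S \<inter> T)"
    unfolding open_dual_group_def
  proof
    fix \<gamma> assume g: "\<gamma> \<in> S \<inter> T"
    obtain K e where K: "compact K" "e > 0"
      "{\<delta>. \<forall>s\<in>K. cmod (character \<delta> s - character \<gamma> s) < e} \<subseteq> S"
      using bspec[OF S[unfolded open_dual_group_def] IntD1[OF g]] by (elim exE conjE)
    obtain K' e' where K': "compact K'" "e' > 0"
      "{\<delta>. \<forall>s\<in>K'. cmod (character \<delta> s - character \<gamma> s) < e'} \<subseteq> T"
      using bspec[OF T[unfolded open_dual_group_def] IntD2[OF g]] by (elim exE conjE)
    show "\<exists>K \<epsilon>. compact K \<and> \<epsilon> > 0 \<and>
        {\<delta>. \<forall>s\<in>K. cmod (character \<delta> s - character \<gamma> s) < \<epsilon>} \<subseteq> S \<inter> T"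
    proof (intro exI conjI)
      show "compact (K \<union> K')" "min e e' > 0" using K K' by (simp_all add: compact_Un)
      show "{\<delta>. \<forall>s\<in>K \<union> K'. cmod (character \<delta> s - character \<gamma> s) < min e e'} \<subseteq> S \<inter> T"
        using K(3) K'(3) by (simp add: subset_iff)
    qed
  qed
next
  fix \<K> :: "'a dual_group set set"
  assume *: "\<forall>S\<in>\<K>. open S"
  show "open (\<Union>\<K>)"
    unfolding open_dual_group_def
  proof
    fix \<gamma> assume "\<gamma> \<in> \<Union>\<K>"
    then obtain S where S: "S \<in> \<K>" "\<gamma> \<in> S" by blast
    obtain K e where K: "compact K" "e > 0"
      "{\<delta>. \<forall>s\<in>K. cmod (character \<delta> s - character \<gamma> s) < e} \<subseteq> S"
      using bspec[OF bspec[OF * S(1), unfolded open_dual_group_def] S(2)] by (elim exE conjE)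
    from K(3) S(1) have "{\<delta>. \<forall>s\<in>K. cmod (character \<delta> s - character \<gamma> s) < e} \<subseteq> \<Union>\<K>"
      by (rule order_trans[OF _ Union_upper])
    with K show "\<exists>K \<epsilon>. compact K \<and> \<epsilon> > 0 \<and>
        {\<delta>. \<forall>s\<in>K. cmod (character \<delta> s - character \<gamma> s) < \<epsilon>} \<subseteq> \<Union>\<K>"
      by (intro exI conjI)
  qed
qed

end

lemma eventually_nhds_dual_group:
  assumes "compact K" "e > 0"
  shows "eventually (\<lambda>\<delta>. \<forall>s\<in>K. cmod (character \<delta> s - character \<gamma> s) < e) (nhds \<gamma>)"
  unfolding eventually_nhds
proof (intro exI conjI ballI)
  let ?U = "{\<eta>. \<exists>r<e. \<forall>s\<in>K. cmod (character \<eta> s - character \<gamma> s) \<le> r}"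
  show "open ?U"
    unfolding open_dual_group_def
  proof
    fix \<eta> assume "\<eta> \<in> ?U"
    then obtain r where r: "r < e" "\<forall>s\<in>K. cmod (character \<eta> s - character \<gamma> s) \<le> r" by blast
    have "{\<delta>. \<forall>s\<in>K. cmod (character \<delta> s - character \<eta> s) < (e - r) / 2} \<subseteq> ?U"
    proof clarify
      fix \<delta> assume d: "\<forall>s\<in>K. cmod (character \<delta> s - character \<eta> s) < (e - r) / 2"
      have "cmod (character \<delta> s - character \<gamma> s) \<le> (e + r) / 2" if "s \<in> K" for s
      proof -
        have "cmod (character \<delta> s - character \<gamma> s)
            \<le> cmod (character \<delta> s - character \<eta> s) + cmod (character \<eta> s - character \<gamma> s)"
          using norm_triangle_ineq[of "character \<delta> s - character \<eta> s"
              "character \<eta> s - character \<gamma> s"] by simp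
        also have "\<dots> \<le> (e - r) / 2 + r"
          using d r that by (intro add_mono) (auto simp: less_imp_le)
        finally show ?thesis by (simp add: field_simps)
      qed
      then show "\<exists>r<e. \<forall>s\<in>K. cmod (character \<delta> s - character \<gamma> s) \<le> r"
        using r by (intro exI[of _ "(e + r) / 2"]) auto
    qed
    then show "\<exists>K \<epsilon>. compact K \<and> \<epsilon> > 0 \<and>
        {\<delta>. \<forall>s\<in>K. cmod (character \<delta> s - character \<eta> s) < \<epsilon>} \<subseteq> ?U"
      using assms r by (intro exI[of _ K] exI[of _ "(e - r) / 2"]) auto
  qed
  show "\<gamma> \<in> ?U" using assms by (auto intro!: exI[of _ 0])
  show "cmod (character \<delta> s - character \<gamma> s) < e" if "\<delta> \<in> ?U" "s \<in> K" for \<delta> s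
    using that by fastforce
qed

lemma tendsto_nhds_dual_groupI:
  assumes "\<And>K e. compact K \<Longrightarrow> e > 0 \<Longrightarrow>
     eventually (\<lambda>x. \<forall>s\<in>K. cmod (character (f x) s - character \<gamma> s) < e) F"
  shows "(f \<longlongrightarrow> \<gamma>) F"
proof (rule topological_tendstoI)
  fix S assume "open S" "\<gamma> \<in> S"
  then obtain K e where K: "compact K" "e > 0"
    "{\<delta>. \<forall>s\<in>K. cmod (character \<delta> s - character \<gamma> s) < e} \<subseteq> S"
    unfolding open_dual_group_def by (elim ballE exE conjE) auto
  from assms[OF K(1,2)] show "eventually (\<lambda>x. f x \<in> S) F"
    by eventually_elim (use K(3) in auto)
qed

instance dual_group :: ("{topological_space,ab_group_add}") topological_ab_group_add
proof
  fix a b :: "'a dual_group"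
  show "((\<lambda>x. fst x + snd x) \<longlongrightarrow> a + b) (nhds a \<times>\<^sub>F nhds b)"
  proof (rule tendsto_nhds_dual_groupI)
    fix K :: "'a set" and e :: real
    assume K: "compact K" and e: "e > 0"
    have 1: "eventually (\<lambda>x. \<forall>s\<in>K. cmod (character (fst x) s - character a s) < e / 2)
        (nhds a \<times>\<^sub>F nhds b)"
      using filterlim_fst[THEN filterlim_iff[THEN iffD1], rule_format,
          OF eventually_nhds_dual_group[OF K, of "e / 2"]] e by auto
    have 2: "eventually (\<lambda>x. \<forall>s\<in>K. cmod (character (snd x) s - character b s) < e / 2)
        (nhds a \<times>\<^sub>F nhds b)"
      using filterlim_snd[THEN filterlim_iff[THEN iffD1], rule_format,
          OF eventually_nhds_dual_group[OF K, of "e / 2"]] e by auto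
    show "eventually (\<lambda>x. \<forall>s\<in>K. cmod (character (fst x + snd x) s - character (a + b) s) < e)
        (nhds a \<times>\<^sub>F nhds b)"
      using 1 2
    proof eventually_elim
      case (elim x)
      show ?case
      proof
        fix s assume s: "s \<in> K"
        let ?f = "character (fst x) s" and ?g = "character (snd x) s"
        let ?a = "character a s" and ?b = "character b s"
        have "character (fst x + snd x) s - character (a + b) s
            = (?f - ?a) * ?g + ?a * (?g - ?b)"
          by (simp add: plus_dual_group.rep_eq algebra_simps)
        also have "cmod \<dots> \<le> cmod ((?f - ?a) * ?g) + cmod (?a * (?g - ?b))"
          by (rule norm_triangle_ineq)
        also have "\<dots> = cmod (?f - ?a) + cmod (?g - ?b)"
          by (simp add: norm_mult)
        also have "\<dots> < e" using elim s by fastforce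
        finally show "cmod (character (fst x + snd x) s - character (a + b) s) < e" .
      qed
    qed
  qed
  show "(uminus \<longlongrightarrow> - a) (nhds a)"
  proof (rule tendsto_nhds_dual_groupI)
    fix K :: "'a set" and e :: real
    assume K: "compact K" and e: "e > 0"
    have *: "cmod (character (- x) s - character (- a) s) = cmod (character x s - character a s)"
      for x s
      by (simp add: uminus_dual_group.rep_eq flip: complex_cnj_diff)
    show "eventually (\<lambda>x. \<forall>s\<in>K. cmod (character (- x) s - character (- a) s) < e) (nhds a)"
      unfolding * by (rule eventually_nhds_dual_group[OF K e])
  qed
qed

section \<open>Elementary groups and their Schwartz--Bruhat functions\<close>

text \<open>
  The group is topologically isomorphic to \<open>\<real>\<^sup>n \<times> \<int>\<^sup>m \<times> \<bbbT>\<^sup>k \<times> F\<close> with \<open>F\<close> finite.  Points of the first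
  three factors are sequences which are trivial beyond the given length.  Since \<open>F\<close> is carried by
  the isomorphism to a finite subgroup, \<open>F\<close> can be taken to be a finite subgroup of the group.
\<close>

definition elementary_group :: "'g::topological_ab_group_add itself \<Rightarrow> bool" where
  "elementary_group _ \<longleftrightarrow>
     (\<exists>(n::nat) (m::nat) (k::nat) (F::'g set)
        (h :: (nat \<Rightarrow> real) \<times> (nat \<Rightarrow> real) \<times> (nat \<Rightarrow> complex) \<times> 'g \<Rightarrow> 'g) h'.
        let E = {x. \<forall>i\<ge>n. x i = 0} \<times> {y. (\<forall>i. y i \<in> \<int>) \<and> (\<forall>i\<ge>m. y i = 0)} \<times>
                {z. (\<forall>i. cmod (z i) = 1) \<and> (\<forall>i\<ge>k. z i = 1)} \<times> F
        in finite F \<and> 0 \<in> F \<and> (\<forall>u\<in>F. \<forall>v\<in>F. u - v \<in> F) \<and>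
           homeomorphism E UNIV h h' \<and>
           (\<forall>(x, y, z, u)\<in>E. \<forall>(x', y', z', u')\<in>E.
              h (\<lambda>i. x i + x' i, \<lambda>i. y i + y' i, \<lambda>i. z i * z' i, u + u')
                = h (x, y, z, u) + h (x', y', z', u')))"

definition one_parameter_subgroups :: "(real \<Rightarrow> 'g::{topological_space,ab_group_add}) set" where
  "one_parameter_subgroups = {X. continuous_on UNIV X \<and> (\<forall>a b. X (a + b) = X a + X b)}"

definition real_characters :: "('g::{topological_space,ab_group_add} \<Rightarrow> real) set" where
  "real_characters = {\<phi>. continuous_on UNIV \<phi> \<and> (\<forall>s t. \<phi> (s + t) = \<phi> s + \<phi> t)}"

primrec iterated_derivative ::
    "(real \<Rightarrow> 'g::{topological_space,ab_group_add}) list \<Rightarrow> ('g \<Rightarrow> complex) \<Rightarrow> 'g \<Rightarrow> complex" where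
  "iterated_derivative [] f = f"
| "iterated_derivative (X # Xs) f =
     (\<lambda>s. vector_derivative (\<lambda>t. iterated_derivative Xs f (s + X t)) (at 0))"

text \<open>
  Bruhat's definition on an elementary group: smooth functions \<open>f\<close> such that \<open>P \<cdot> D f\<close> is bounded for
  every polynomial \<open>P\<close> and every translation invariant differential operator \<open>D\<close>.  On
  \<open>\<real>\<^sup>n \<times> \<int>\<^sup>m \<times> \<bbbT>\<^sup>k \<times> F\<close> the real characters are the real linear forms in the \<open>n + m\<close> coordinates of
  \<open>\<real>\<^sup>n \<times> \<int>\<^sup>m\<close>, so their products span the polynomials (the empty product being 1), and the
  derivatives along one-parameter subgroups are the constant-coefficient vector fields on
  \<open>\<real>\<^sup>n \<times> \<bbbT>\<^sup>k\<close>, so their compositions span the operators \<open>D\<close>.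
\<close>

definition schwartz :: "('g::{topological_space,ab_group_add} \<Rightarrow> complex) set" where
  "schwartz = {f. \<forall>Xs \<phi>s. set Xs \<subseteq> one_parameter_subgroups \<and> set \<phi>s \<subseteq> real_characters \<longrightarrow>
     continuous_on UNIV (iterated_derivative Xs f) \<and>
     (\<forall>X\<in>one_parameter_subgroups. \<forall>s.
        (\<lambda>t. iterated_derivative Xs f (s + X t)) differentiable (at 0)) \<and>
     bounded (range (\<lambda>s. complex_of_real (\<Prod>\<phi>\<leftarrow>\<phi>s. \<phi> s) * iterated_derivative Xs f s))}"

section \<open>Haar measures and the Fourier transform\<close>

text \<open>
  Regularity need not be demanded: on a second countable locally compact Hausdorff space every
  Borel measure that is finite on compact sets is regular.
\<close>

definition haar_measure :: "'g::topological_ab_group_add measure \<Rightarrow> bool" where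
  "haar_measure \<mu> \<longleftrightarrow> sets \<mu> = sets borel \<and> emeasure \<mu> UNIV \<noteq> 0 \<and>
     (\<forall>K. compact K \<longrightarrow> emeasure \<mu> K < \<infinity>) \<and>
     (\<forall>t. distr \<mu> borel (\<lambda>s. t + s) = \<mu>)"

definition L1_space :: "'x measure \<Rightarrow> ('x \<Rightarrow> complex) set" where
  "L1_space \<mu> = {f. integrable \<mu> f}"

definition L2_space :: "'x measure \<Rightarrow> ('x \<Rightarrow> complex) set" where
  "L2_space \<mu> = {f \<in> borel_measurable \<mu>. integrable \<mu> (\<lambda>s. (cmod (f s))\<^sup>2)}"

definition L2_inner :: "'x measure \<Rightarrow> ('x \<Rightarrow> complex) \<Rightarrow> ('x \<Rightarrow> complex) \<Rightarrow> complex" where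
  "L2_inner \<mu> \<xi> \<eta> = integral\<^sup>L \<mu> (\<lambda>s. \<xi> s * cnj (\<eta> s))"

definition fourier ::
    "'g::topological_ab_group_add measure \<Rightarrow> ('g \<Rightarrow> complex) \<Rightarrow> 'g dual_group \<Rightarrow> complex" where
  "fourier \<mu> f \<gamma> = integral\<^sup>L \<mu> (\<lambda>s. f s * cnj (character \<gamma> s))"

text \<open>
  Plancherel's theorem: the Fourier transform on \<open>L\<^sup>1 \<inter> L\<^sup>2\<close> extends to a unitary operator of
  \<open>L\<^sup>2(\<mu>)\<close> onto \<open>L\<^sup>2(\<nu>)\<close>, i.e. it is isometric with dense range.
\<close>

definition plancherel ::
    "'g::topological_ab_group_add measure \<Rightarrow> 'g dual_group measure \<Rightarrow> bool" where
  "plancherel \<mu> \<nu> \<longleftrightarrow>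
     (\<forall>f \<in> L1_space \<mu> \<inter> L2_space \<mu>. fourier \<mu> f \<in> L2_space \<nu> \<and>
        integral\<^sup>L \<nu> (\<lambda>\<gamma>. (cmod (fourier \<mu> f \<gamma>))\<^sup>2) = integral\<^sup>L \<mu> (\<lambda>s. (cmod (f s))\<^sup>2)) \<and>
     (\<forall>h \<in> L2_space \<nu>. \<forall>\<epsilon>>0. \<exists>f \<in> L1_space \<mu> \<inter> L2_space \<mu>.
        integral\<^sup>L \<nu> (\<lambda>\<gamma>. (cmod (h \<gamma> - fourier \<mu> f \<gamma>))\<^sup>2) < \<epsilon>)"

section \<open>Lattices in the time-frequency plane\<close>

definition is_lattice :: "'x::{topological_space,ab_group_add} set \<Rightarrow> bool" where
  "is_lattice \<Lambda> \<longleftrightarrow> 0 \<in> \<Lambda> \<and> (\<forall>x\<in>\<Lambda>. \<forall>y\<in>\<Lambda>. x - y \<in> \<Lambda>) \<and> discrete \<Lambda> \<and>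
     (\<exists>K. compact K \<and> (\<forall>g. \<exists>x\<in>\<Lambda>. g - x \<in> K))"

text \<open>
  The measure of a Borel fundamental domain, which does not depend on the choice of the domain.
\<close>

definition covolume :: "'x::ab_group_add measure \<Rightarrow> 'x set \<Rightarrow> real" where
  "covolume M \<Lambda> = measure M (SOME D. D \<in> sets M \<and> (\<forall>g. \<exists>!x. x \<in> \<Lambda> \<and> g - x \<in> D))"

definition cocycle ::
    "'g::topological_ab_group_add dual_group \<times> 'g \<Rightarrow> 'g dual_group \<times> 'g \<Rightarrow> complex" where
  "cocycle = (\<lambda>(\<gamma>\<^sub>1, t\<^sub>1) (\<gamma>\<^sub>2, t\<^sub>2). cnj (character \<gamma>\<^sub>2 t\<^sub>1))"

definition adjoint_lattice ::
    "('g::topological_ab_group_add dual_group \<times> 'g) set \<Rightarrow> ('g dual_group \<times> 'g) set" where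
  "adjoint_lattice \<Lambda> = {x. \<forall>y\<in>\<Lambda>. cocycle x y * cnj (cocycle y x) = 1}"

text \<open>
  Rapidly decreasing functions on a lattice: a lattice is a discrete elementary group, and these
  are its Schwartz functions (all polynomial multiples are bounded).  The values off \<open>\<Lambda>\<close> are
  irrelevant.
\<close>

definition rapidly_decreasing :: "'x::ab_group_add set \<Rightarrow> ('x \<Rightarrow> complex) set" where
  "rapidly_decreasing \<Lambda> = {a. \<forall>\<phi>s :: ('x \<Rightarrow> real) list.
     (\<forall>\<phi>\<in>set \<phi>s. \<forall>x\<in>\<Lambda>. \<forall>y\<in>\<Lambda>. \<phi> (x + y) = \<phi> x + \<phi> y) \<longrightarrow>
     bounded ((\<lambda>x. complex_of_real (\<Prod>\<phi>\<leftarrow>\<phi>s. \<phi> x) * a x) ` \<Lambda>)}"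

section \<open>Operators on \<open>L\<^sup>2\<close>\<close>

text \<open>
  Operators act on square integrable functions rather than on almost-everywhere classes; equality
  of operators on \<open>L\<^sup>2\<close> is therefore the relation \<open>op_eq\<close>.
\<close>

type_synonym 'x oper = "('x \<Rightarrow> complex) \<Rightarrow> 'x \<Rightarrow> complex"

definition op_eq :: "'x measure \<Rightarrow> 'x oper \<Rightarrow> 'x oper \<Rightarrow> bool" where
  "op_eq \<mu> K L \<longleftrightarrow> (\<forall>\<xi>\<in>L2_space \<mu>. AE s in \<mu>. K \<xi> s = L \<xi> s)"

definition op_adjoint :: "'x measure \<Rightarrow> 'x oper \<Rightarrow> 'x oper \<Rightarrow> bool" where
  "op_adjoint \<mu> K L \<longleftrightarrow>
     (\<forall>\<xi>\<in>L2_space \<mu>. \<forall>\<eta>\<in>L2_space \<mu>. L2_inner \<mu> (K \<xi>) \<eta> = L2_inner \<mu> \<xi> (L \<eta>))"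

definition tf_shift :: "'g::topological_ab_group_add dual_group \<times> 'g \<Rightarrow> 'g oper" where
  "tf_shift = (\<lambda>(\<gamma>, t) \<xi> s. character \<gamma> s * \<xi> (s - t))"

definition tf_shift_adj :: "'g::topological_ab_group_add dual_group \<times> 'g \<Rightarrow> 'g oper" where
  "tf_shift_adj = (\<lambda>(\<gamma>, t) \<xi> s. cnj (character \<gamma> (s + t)) * \<xi> (s + t))"

definition dual_tf_shift ::
    "'g::topological_ab_group_add dual_group \<times> 'g \<Rightarrow> 'g dual_group oper" where
  "dual_tf_shift = (\<lambda>(\<gamma>, t) \<xi> \<delta>. cnj (character (\<delta> - \<gamma>) t) * \<xi> (\<delta> - \<gamma>))"

definition dual_tf_shift_adj ::
    "'g::topological_ab_group_add dual_group \<times> 'g \<Rightarrow> 'g dual_group oper" where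
  "dual_tf_shift_adj = (\<lambda>(\<gamma>, t) \<xi> \<delta>. character \<delta> t * \<xi> (\<delta> + \<gamma>))"

lemma borel_measurable_cnj' [measurable]: "cnj \<in> borel_measurable borel"
  by (intro borel_measurable_continuous_onI continuous_intros)

lemma haar_integral_translate:
  fixes f :: "'g::topological_ab_group_add \<Rightarrow> complex"
  assumes "haar_measure \<mu>" "f \<in> borel_measurable \<mu>"
  shows "integral\<^sup>L \<mu> (\<lambda>s. f (t + s)) = integral\<^sup>L \<mu> f"
proof -
  have s: "sets \<mu> = sets borel" and d: "distr \<mu> borel (\<lambda>s. t + s) = \<mu>"
    using assms by (auto simp: haar_measure_def)
  have f: "f \<in> borel_measurable borel"
    using assms(2) by (simp only: measurable_cong_sets[OF s refl])
  have "continuous_on UNIV (\<lambda>s. t + s)"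
    by (intro continuous_intros)
  then have m: "(\<lambda>s. t + s) \<in> measurable \<mu> borel"
    by (simp only: measurable_cong_sets[OF s refl] borel_measurable_continuous_onI)
  show ?thesis
    using integral_distr[OF m f] d by simp
qed

lemma tf_shift_adjoint:
  fixes \<mu> :: "'g::topological_ab_group_add measure"
  assumes "haar_measure \<mu>"
  shows "op_adjoint \<mu> (tf_shift g) (tf_shift_adj g)"
  unfolding op_adjoint_def
proof (intro ballI)
  fix \<xi> \<eta> assume \<xi>: "\<xi> \<in> L2_space \<mu>" and \<eta>: "\<eta> \<in> L2_space \<mu>"
  obtain \<gamma> t where g: "g = (\<gamma>, t)" by (cases g)
  let ?h = "\<lambda>s. character \<gamma> s * \<xi> (s - t) * cnj (\<eta> s)"
  have s: "sets \<mu> = sets borel" using assms by (auto simp: haar_measure_def)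
  have c [measurable]: "character \<gamma> \<in> borel_measurable borel"
    by (rule borel_measurable_continuous_onI[OF continuous_character])
  have [measurable]: "\<xi> \<in> borel_measurable borel" "\<eta> \<in> borel_measurable borel"
    using \<xi> \<eta> by (simp_all only: L2_space_def mem_Collect_eq measurable_cong_sets[OF s refl])
  have "continuous_on UNIV (\<lambda>s. s - t)" by (intro continuous_intros)
  then have [measurable]: "(\<lambda>s. s - t) \<in> measurable borel borel"
    by (rule borel_measurable_continuous_onI)
  have [measurable]: "(\<lambda>s. \<xi> (s - t)) \<in> borel_measurable borel"
    by (rule measurable_compose[of "\<lambda>s. s - t" borel borel]) measurable
  have h: "?h \<in> borel_measurable \<mu>"
    by (subst measurable_cong_sets[OF s refl]) measurable
  show "L2_inner \<mu> (tf_shift g \<xi>) \<eta> = L2_inner \<mu> \<xi> (tf_shift_adj g \<eta>)"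
    using haar_integral_translate[OF assms h, of t]
    by (simp add: L2_inner_def tf_shift_def tf_shift_adj_def g mult_ac add.commute)
qed

lemma dual_tf_shift_adjoint:
  fixes \<nu> :: "'g::topological_ab_group_add dual_group measure"
  assumes "haar_measure \<nu>"
  shows "op_adjoint \<nu> (dual_tf_shift g) (dual_tf_shift_adj g)"
  unfolding op_adjoint_def
proof (intro ballI)
  fix \<xi> \<eta> assume \<xi>: "\<xi> \<in> L2_space \<nu>" and \<eta>: "\<eta> \<in> L2_space \<nu>"
  obtain \<gamma> t where g: "g = (\<gamma>, t)" by (cases g)
  let ?h = "\<lambda>\<delta>. cnj (character (\<delta> - \<gamma>) t) * \<xi> (\<delta> - \<gamma>) * cnj (\<eta> \<delta>)"
  have s: "sets \<nu> = sets borel" using assms by (auto simp: haar_measure_def)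
  have "((\<lambda>\<delta>. character \<delta> t) \<longlongrightarrow> character \<delta>0 t) (nhds \<delta>0)" for \<delta>0 :: "'g dual_group"
  proof (rule tendstoI)
    fix e :: real assume "e > 0"
    from eventually_nhds_dual_group[OF compact_sing[of t] this]
    show "eventually (\<lambda>x. dist (character x t) (character \<delta>0 t) < e) (nhds \<delta>0)"
      by (simp add: dist_norm)
  qed
  then have "continuous_on UNIV (\<lambda>\<delta> :: 'g dual_group. character \<delta> t)"
    unfolding continuous_on_def using filterlim_mono[OF _ order_refl at_within_le_nhds] by blast
  then have c [measurable]: "(\<lambda>\<delta> :: 'g dual_group. character \<delta> t) \<in> borel_measurable borel"
    by (rule borel_measurable_continuous_onI)
  have [measurable]: "\<xi> \<in> borel_measurable borel" "\<eta> \<in> borel_measurable borel"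
    using \<xi> \<eta> by (simp_all only: L2_space_def mem_Collect_eq measurable_cong_sets[OF s refl])
  have "continuous_on UNIV (\<lambda>s. s - \<gamma>)" by (intro continuous_intros)
  then have [measurable]: "(\<lambda>s. s - \<gamma>) \<in> measurable borel borel"
    by (rule borel_measurable_continuous_onI)
  have [measurable]: "(\<lambda>\<delta>. character (\<delta> - \<gamma>) t) \<in> borel_measurable borel"
    by (rule measurable_compose[OF _ c]) measurable
  have [measurable]: "(\<lambda>\<delta>. \<xi> (\<delta> - \<gamma>)) \<in> borel_measurable borel"
    by (rule measurable_compose[of "\<lambda>\<delta>. \<delta> - \<gamma>" borel borel]) measurable
  have h: "?h \<in> borel_measurable \<nu>"
    by (subst measurable_cong_sets[OF s refl]) measurable
  show "L2_inner \<nu> (dual_tf_shift g \<xi>) \<eta> = L2_inner \<nu> \<xi> (dual_tf_shift_adj g \<eta>)"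
    using haar_integral_translate[OF assms h, of \<gamma>]
    by (simp add: L2_inner_def dual_tf_shift_def dual_tf_shift_adj_def g mult_ac add.commute)
qed

section \<open>The algebras and the hermitian products\<close>

text \<open>
  For \<open>\<xi>\<close> in \<open>L\<^sup>2\<close> and \<open>a\<close> in \<open>\<ell>\<^sup>1\<close> the series converges absolutely almost everywhere and represents
  the norm convergent series of \<open>L\<^sup>2\<close> elements.
\<close>

definition op_series ::
    "('i \<Rightarrow> 'x oper) \<Rightarrow> 'i set \<Rightarrow> ('i \<Rightarrow> complex) \<Rightarrow> 'x oper" where
  "op_series \<rho> \<Lambda> a \<xi> s = (\<Sum>\<^sub>\<infinity>x\<in>\<Lambda>. a x * \<rho> x \<xi> s)"

definition op_algebra ::
    "'x measure \<Rightarrow> ('i::ab_group_add \<Rightarrow> 'x oper) \<Rightarrow> 'i set \<Rightarrow> 'x oper set" where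
  "op_algebra \<mu> \<rho> \<Lambda> = {K \<in> L2_space \<mu> \<rightarrow> L2_space \<mu>.
     \<exists>a\<in>rapidly_decreasing \<Lambda>. op_eq \<mu> K (op_series \<rho> \<Lambda> a)}"

definition op_trace ::
    "'x measure \<Rightarrow> ('i::ab_group_add \<Rightarrow> 'x oper) \<Rightarrow> 'i set \<Rightarrow> 'x oper \<Rightarrow> complex" where
  "op_trace \<mu> \<rho> \<Lambda> K =
     (THE c. \<exists>a\<in>rapidly_decreasing \<Lambda>. op_eq \<mu> K (op_series \<rho> \<Lambda> a) \<and> a 0 = c)"

definition left_product ::
    "'x measure \<Rightarrow> ('i \<Rightarrow> 'x oper) \<Rightarrow> 'i set \<Rightarrow> ('x \<Rightarrow> complex) \<Rightarrow> ('x \<Rightarrow> complex) \<Rightarrow> 'x oper" where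
  "left_product \<mu> \<rho> \<Lambda> \<xi> \<eta> = op_series \<rho> \<Lambda> (\<lambda>x. L2_inner \<mu> \<xi> (\<rho> x \<eta>))"

definition right_product ::
    "'x measure \<Rightarrow> ('i \<Rightarrow> 'x oper) \<Rightarrow> ('i \<Rightarrow> 'x oper) \<Rightarrow> real \<Rightarrow> 'i set \<Rightarrow>
     ('x \<Rightarrow> complex) \<Rightarrow> ('x \<Rightarrow> complex) \<Rightarrow> 'x oper" where
  "right_product \<mu> \<rho> \<rho>adj c \<Lambda>' \<xi> \<eta> =
     (\<lambda>\<zeta> s. complex_of_real (1 / c) * op_series \<rho>adj \<Lambda>' (\<lambda>x. L2_inner \<mu> (\<rho> x \<eta>) \<xi>) \<zeta> s)"

text \<open>
  The Leibniz rule is stated for composition; it is the same condition for the opposite product.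
\<close>

definition star_derivation :: "'x measure \<Rightarrow> 'x oper set \<Rightarrow> ('x oper \<Rightarrow> 'x oper) \<Rightarrow> bool" where
  "star_derivation \<mu> A d \<longleftrightarrow>
     (\<forall>K\<in>A. d K \<in> A) \<and>
     (\<forall>K\<in>A. \<forall>L\<in>A. op_eq \<mu> K L \<longrightarrow> op_eq \<mu> (d K) (d L)) \<and>
     (\<forall>K\<in>A. \<forall>L\<in>A. \<forall>c. op_eq \<mu> (d (\<lambda>\<xi> s. c * K \<xi> s + L \<xi> s)) (\<lambda>\<xi> s. c * d K \<xi> s + d L \<xi> s)) \<and>
     (\<forall>K\<in>A. \<forall>L\<in>A. op_eq \<mu> (d (\<lambda>\<xi>. K (L \<xi>))) (\<lambda>\<xi> s. d K (L \<xi>) s + K (d L \<xi>) s)) \<and>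
     (\<forall>K\<in>A. \<forall>L\<in>A. op_adjoint \<mu> K L \<longrightarrow> op_adjoint \<mu> (d K) (d L))"

text \<open>
  A covariant derivative \<open>D\<close> on the Schwartz space for derivations \<open>d\<close> and \<open>d'\<close> of the left algebra
  (generated by \<open>\<rho>\<close> on \<open>\<Lambda>\<close>) and of the right algebra (generated by the adjoints \<open>\<rho>adj\<close> on \<open>\<Lambda>'\<close>).
  The element \<open>K \<cdot> \<xi>\<close> of the Schwartz space is the Schwartz function \<open>\<zeta>\<close> that agrees almost
  everywhere with \<open>K \<xi>\<close>; likewise for the right action, where \<open>\<xi> \<cdot> b\<close> is the operator \<open>b\<close> applied
  to \<open>\<xi>\<close>.
\<close>

definition compatible_connection ::
    "'x::{topological_space,ab_group_add} measure \<Rightarrow> ('i::ab_group_add \<Rightarrow> 'x oper) \<Rightarrow>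
     ('i \<Rightarrow> 'x oper) \<Rightarrow> real \<Rightarrow> 'i set \<Rightarrow> 'i set \<Rightarrow> ('x oper \<Rightarrow> 'x oper) \<Rightarrow>
     ('x oper \<Rightarrow> 'x oper) \<Rightarrow> (('x \<Rightarrow> complex) \<Rightarrow> 'x \<Rightarrow> complex) \<Rightarrow> bool" where
  "compatible_connection \<mu> \<rho> \<rho>adj c \<Lambda> \<Lambda>' d d' D \<longleftrightarrow>
     (let A = op_algebra \<mu> \<rho> \<Lambda>; B = op_algebra \<mu> \<rho>adj \<Lambda>';
          lp = left_product \<mu> \<rho> \<Lambda>; rp = right_product \<mu> \<rho> \<rho>adj c \<Lambda>' in
      star_derivation \<mu> A d \<and> star_derivation \<mu> B d' \<and>
      (\<forall>K\<in>A. op_trace \<mu> \<rho> \<Lambda> (d K) = 0) \<and>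
      (\<forall>\<xi>\<in>schwartz. D \<xi> \<in> schwartz) \<and>
      (\<forall>\<xi>\<in>schwartz. \<forall>\<eta>\<in>schwartz. \<forall>a. D (\<lambda>s. a * \<xi> s + \<eta> s) = (\<lambda>s. a * D \<xi> s + D \<eta> s)) \<and>
      (\<forall>K\<in>A. \<forall>\<xi>\<in>schwartz. \<forall>\<zeta>\<in>schwartz. (AE s in \<mu>. \<zeta> s = K \<xi> s) \<longrightarrow>
         (AE s in \<mu>. D \<zeta> s = d K \<xi> s + K (D \<xi>) s)) \<and>
      (\<forall>\<xi>\<in>schwartz. \<forall>\<eta>\<in>schwartz.
         op_eq \<mu> (d (lp \<xi> \<eta>)) (\<lambda>\<zeta> s. lp (D \<xi>) \<eta> \<zeta> s + lp \<xi> (D \<eta>) \<zeta> s)) \<and>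
      (\<forall>b\<in>B. \<forall>\<xi>\<in>schwartz. \<forall>\<zeta>\<in>schwartz. (AE s in \<mu>. \<zeta> s = b \<xi> s) \<longrightarrow>
         (AE s in \<mu>. D \<zeta> s = b (D \<xi>) s + d' b \<xi> s)) \<and>
      (\<forall>\<xi>\<in>schwartz. \<forall>\<eta>\<in>schwartz.
         op_eq \<mu> (d' (rp \<xi> \<eta>)) (\<lambda>\<zeta> s. rp (D \<xi>) \<eta> \<zeta> s + rp \<xi> (D \<eta>) \<zeta> s)) \<and>
      (\<forall>\<xi>\<in>schwartz. \<forall>\<eta>\<in>schwartz. L2_inner \<mu> (D \<xi>) \<eta> = - L2_inner \<mu> \<xi> (D \<eta>)))"

definition del_bar :: "('x oper \<Rightarrow> 'x oper) \<Rightarrow> ('x oper \<Rightarrow> 'x oper) \<Rightarrow> 'x oper \<Rightarrow> 'x oper" where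
  "del_bar d1 d2 K = (\<lambda>\<xi> s. d1 K \<xi> s + \<i> * d2 K \<xi> s)"

definition del :: "('x oper \<Rightarrow> 'x oper) \<Rightarrow> ('x oper \<Rightarrow> 'x oper) \<Rightarrow> 'x oper \<Rightarrow> 'x oper" where
  "del d1 d2 K = (\<lambda>\<xi> s. d1 K \<xi> s - \<i> * d2 K \<xi> s)"

definition self_dual :: "'x measure \<Rightarrow> ('x oper \<Rightarrow> 'x oper) \<Rightarrow> ('x oper \<Rightarrow> 'x oper) \<Rightarrow> 'x oper \<Rightarrow> bool" where
  "self_dual \<mu> d1 d2 p \<longleftrightarrow> op_eq \<mu> (\<lambda>\<xi>. del_bar d1 d2 p (p \<xi>)) (\<lambda>\<xi> s. 0)"

definition anti_self_dual :: "'x measure \<Rightarrow> ('x oper \<Rightarrow> 'x oper) \<Rightarrow> ('x oper \<Rightarrow> 'x oper) \<Rightarrow> 'x oper \<Rightarrow> bool" where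
  "anti_self_dual \<mu> d1 d2 p \<longleftrightarrow> op_eq \<mu> (\<lambda>\<xi>. del d1 d2 p (p \<xi>)) (\<lambda>\<xi> s. 0)"

end

theory Submission
  imports Defs
begin

text \<open>
  The Fourier transform intertwines \<open>\<pi>\<close> with \<open>\<pi>\<^sup>o\<iota>\<close>, and by Plancherel it preserves the
  coefficients of both hermitian products.  Since these coefficients are absolutely summable, it
  carries \<open>L\<^sup>1\<close>-convergent operator series to operator series with the same coefficients, so every
  operator identity on \<open>L\<^sup>2(\<Gamma>)\<close> holds on the transforms of \<open>L\<^sup>1 \<inter> L\<^sup>2\<close>; these are dense, and
  all operators involved are Lipschitz.  The covariant derivatives are exchanged, which turns
  \<open>\<partial>\<^sub>1 + \<i> \<partial>\<^sub>2\<close> into \<open>\<i> (\<partial>\<^sub>1 - \<i> \<partial>\<^sub>2)\<close>.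

  The summability comes from the decay of \<open>(\<gamma>, t) \<mapsto> \<langle>f, \<pi>(\<gamma>, t) g\<rangle>\<close>: multiplication by a real
  character of \<open>t\<close> or by a frequency of \<open>\<gamma>\<close> (integration by parts) leads to a sum of functions of
  the same kind, so all polynomial multiples are bounded.  Only the local finiteness of the lattice
  is used besides; for the adjoint lattice it is read off the frame identity.
\<close>

section \<open>Characters and homomorphisms\<close>

text \<open>Neither Pontryagin duality nor Fourier inversion is invoked. That the transform of a
  Schwartz function is Schwartz needs two facts about the dual group: its one-parameter subgroups
  come from real characters of the group, and its real characters come from one-parameter subgroups
  of the group. The first follows from the compact-open topology; the second is read off an explicit
  decomposition of every character along the coordinates of R^n x Z^m x T^k x F. The same
  coordinates give the majorant \<open>weight\<close>, a product of factors 1 / (1 + q^2). It is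
  integrable for Haar measure and summable on locally finite subgroups by one argument: unit cells
  in the coordinates have bounded measure, because a cell translated by one of its points falls into
  a fixed compact set. A further obstacle is that an operator series is a series of functions, with
  value 0 where it diverges, so it is linear only almost everywhere. The extension by density
  therefore rests on a Lipschitz estimate for differences and not on linearity.\<close>

lemma additive_of_nat:
  fixes f :: "real \<Rightarrow> 'a::real_vector"
  assumes "\<And>a b. f (a + b) = f a + f b"
  shows "f (real n * x) = real n *\<^sub>R f x"
proof (induction n)
  case 0
  show ?case using assms[of 0 0] by simp
next
  case (Suc n)
  have "f (real (Suc n) * x) = f (x + real n * x)" by (simp add: algebra_simps)
  then show ?case using Suc assms by (simp add: algebra_simps)
qed

lemma additive_of_int:
  fixes f :: "real \<Rightarrow> 'a::real_vector"
  assumes "\<And>a b. f (a + b) = f a + f b"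
  shows "f (of_int k * x) = of_int k *\<^sub>R f x"
proof (cases k rule: int_cases2)
  case (nonneg n)
  then show ?thesis using additive_of_nat[OF assms] by simp
next
  case (nonpos n)
  have "f (- y) = - f y" for y
    using assms[of y "- y"] assms[of 0 0] by (simp add: add_eq_0_iff)
  then show ?thesis using nonpos additive_of_nat[OF assms, of n x] by simp
qed

text \<open>Both sides are continuous and agree on the rationals, where additivity alone gives
  homogeneity.\<close>

lemma continuous_additive_linear:
  fixes f :: "real \<Rightarrow> 'a::real_normed_vector"
  assumes add: "\<And>a b. f (a + b) = f a + f b" and cont: "continuous_on UNIV f"
  shows "f x = x *\<^sub>R f 1"
proof -
  let ?S = "{x. f x = x *\<^sub>R f 1}"
  have "closed ?S"
    by (intro closed_Collect_eq cont continuous_intros)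
  moreover have "\<rat> \<subseteq> ?S"
  proof
    fix x :: real assume "x \<in> \<rat>"
    then obtain p q where pq: "x = of_int p / of_int q" "q > 0"
      by (metis Rats_cases')
    have "of_int q *\<^sub>R f x = f (of_int p)"
      using additive_of_int[of f q x, OF add] pq by simp
    also have "\<dots> = of_int p *\<^sub>R f 1"
      using additive_of_int[of f p 1, OF add] by simp
    also have "\<dots> = of_int q *\<^sub>R (x *\<^sub>R f 1)" using pq by simp
    finally have "real_of_int q *\<^sub>R f x = real_of_int q *\<^sub>R (x *\<^sub>R f 1)" .
    moreover have "real_of_int q \<noteq> 0" using pq by simp
    ultimately show "x \<in> ?S" unfolding mem_Collect_eq scaleR_cancel_left by blast
  qed
  ultimately have "closure \<rat> \<subseteq> ?S" by (rule closure_minimal[rotated])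
  then show ?thesis using Rats_closure_real by auto
qed

text \<open>The zeros of exp - 1 form the lattice 2 pi i Z, so 1 is a crude lower bound for the
  nonzero ones; \<open>circle_hom_cis\<close> needs only some positive gap.\<close>

lemma norm_ge_1_if_exp_eq_1:
  fixes z :: complex
  assumes "exp z = 1" "z \<noteq> 0"
  shows "1 \<le> norm z"
proof -
  obtain n :: int where n: "Re z = 0" "Im z = of_int (2 * n) * pi"
    using assms(1) unfolding exp_eq_1 by blast
  then have "n \<noteq> 0" using assms(2) by (auto simp: complex_eq_iff)
  then have "1 * 1 \<le> \<bar>real_of_int n\<bar> * (2 * pi)"
    using pi_gt3 by (intro mult_mono) linarith+
  also have "\<dots> = \<bar>Im z\<bar>" unfolding n by (simp add: abs_mult)
  also have "\<dots> \<le> norm z" by (rule abs_Im_le_cmod)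
  finally show ?thesis by simp
qed

text \<open>The line is contractible, so g has a continuous logarithm, and its normalisation at 0 is
  additive. Linearity of continuous additive maps then gives a frequency, which is real because g
  has modulus 1.\<close>

lemma circle_hom_cis:
  fixes g :: "real \<Rightarrow> complex"
  assumes cont: "continuous_on UNIV g" and nrm: "\<And>t. cmod (g t) = 1"
    and mult: "\<And>a b. g (a + b) = g a * g b"
  obtains a where "\<And>t. g t = cis (a * t)"
proof -
  have "g t \<noteq> 0" for t using nrm[of t] by auto
  then obtain l where l: "continuous_on UNIV l" "\<And>t. g t = exp (l t)"
    using continuous_logarithm_on_contractible[OF cont convex_imp_contractible[OF convex_UNIV]] by auto
  define f where "f t = l t - l 0" for t
  have g0: "g 0 = 1" using mult[of 0 0] nrm[of 0] by auto
  have ef: "exp (f t) = g t" for t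
    using g0 l(2)[of 0] l(2)[of t] by (simp add: f_def exp_diff)
  have contf: "continuous_on UNIV f" unfolding f_def by (intro continuous_intros l)
  \<comment> \<open>For fixed b the additivity defect is continuous in a with values in the discrete
    set 2 pi i Z, hence constant; its value at a = 0 is - f 0 = 0.\<close>
  have "f (a + b) - f a - f b = f (0 + b) - f 0 - f b" for a b
  proof -
    let ?d = "\<lambda>a. f (a + b) - f a - f b"
    have "?d constant_on UNIV"
    proof (rule continuous_discrete_range_constant)
      show "continuous_on UNIV ?d"
        by (intro continuous_intros continuous_on_compose2[OF contf]) auto
      fix x
      show "\<exists>e>0. \<forall>y. y \<in> UNIV \<and> ?d y \<noteq> ?d x \<longrightarrow> e \<le> norm (?d y - ?d x)"
      proof (intro exI[of _ 1] conjI allI impI)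
        fix y assume y: "y \<in> UNIV \<and> ?d y \<noteq> ?d x"
        have "exp (?d z) = 1" for z
          using ef nrm[of z] nrm[of b] mult[of z b] by (auto simp: exp_diff)
        then have "exp (?d y - ?d x) = 1" by (subst exp_diff) simp
        moreover have "?d y - ?d x \<noteq> 0" using y unfolding right_minus_eq by blast
        ultimately show "1 \<le> norm (?d y - ?d x)" by (rule norm_ge_1_if_exp_eq_1)
      qed simp
    qed simp
    then obtain d where d: "\<And>a. ?d a = d" unfolding constant_on_def by auto
    show ?thesis using d[of a] d[of 0] by (simp only:)
  qed
  moreover have "f 0 = 0" by (simp add: f_def)
  ultimately have add: "f (a + b) = f a + f b" for a b
    by (metis add_0 diff_0_right diff_add_cancel add.commute diff_self diff_eq_eq)
  have f: "f t = t *\<^sub>R f 1" for t by (rule continuous_additive_linear[OF add contf])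
  have "cmod (exp (f 1)) = 1" using ef nrm by simp
  then have "Re (f 1) = 0" by simp
  then have ft: "f t = \<i> * of_real (Im (f 1) * t)" for t
    using f[of t] by (simp add: complex_eq_iff)
  have "g t = cis (Im (f 1) * t)" for t
    using ef[of t] unfolding cis_conv_exp ft[of t, symmetric] by (rule sym)
  then show ?thesis by (rule that)
qed

text \<open>A nonzero value at x would grow linearly along the multiples of x, all of which stay in
  S. This kills a real character of the dual on its finite part.\<close>

lemma additive_bounded_eq_0:
  fixes \<psi> :: "'a::ab_group_add \<Rightarrow> real"
  assumes add: "\<And>x y. \<psi> (x + y) = \<psi> x + \<psi> y"
    and bdd: "bounded (\<psi> ` S)" and closed: "\<And>x y. x \<in> S \<Longrightarrow> y \<in> S \<Longrightarrow> x + y \<in> S"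
    and x: "x \<in> S"
  shows "\<psi> x = 0"
proof (rule ccontr)
  assume nz: "\<psi> x \<noteq> 0"
  obtain B where B: "\<And>y. y \<in> S \<Longrightarrow> \<bar>\<psi> y\<bar> \<le> B"
    using bdd by (auto simp: bounded_iff)
  have *: "\<exists>y\<in>S. \<psi> y = real (Suc n) * \<psi> x" for n
  proof (induction n)
    case 0
    then show ?case using x by auto
  next
    case (Suc n)
    then obtain y where "y \<in> S" "\<psi> y = real (Suc n) * \<psi> x" by auto
    then show ?case using closed[OF x, of y] add[of x y]
      by (intro bexI[of _ "x + y"]) (auto simp: algebra_simps)
  qed
  obtain n where "B < real n * \<bar>\<psi> x\<bar>"
    using nz reals_Archimedean3[of "\<bar>\<psi> x\<bar>"] by auto
  moreover obtain y where "y \<in> S" "\<psi> y = real (Suc n) * \<psi> x" using * by blast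
  then have "real (Suc n) * \<bar>\<psi> x\<bar> \<le> B" using B[of y] by (simp add: abs_mult)
  ultimately show False by (simp add: algebra_simps)
qed

section \<open>Minkowski sums of compact sets\<close>

lemma compact_sum_sets:
  fixes C :: "'i \<Rightarrow> 'a::topological_ab_group_add set"
  assumes "finite I" "\<And>i. i \<in> I \<Longrightarrow> compact (C i)"
  shows "compact {\<Sum>i\<in>I. f i | f. \<forall>i\<in>I. f i \<in> C i}"
  using assms
proof (induction I rule: finite_induct)
  case empty
  then show ?case by simp
next
  case (insert j I)
  let ?S = "{\<Sum>i\<in>I. f i | f. \<forall>i\<in>I. f i \<in> C i}"
  have "{\<Sum>i\<in>insert j I. f i | f. \<forall>i\<in>insert j I. f i \<in> C i} = (\<lambda>(x, y). x + y) ` (C j \<times> ?S)"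
  proof (intro equalityI subsetI)
    fix x assume "x \<in> (\<lambda>(x, y). x + y) ` (C j \<times> ?S)"
    then obtain y f where *: "x = y + (\<Sum>i\<in>I. f i)" "y \<in> C j" "\<forall>i\<in>I. f i \<in> C i" by auto
    let ?f = "f(j := y)"
    have "(\<Sum>i\<in>I. ?f i) = (\<Sum>i\<in>I. f i)" using insert.hyps by (intro sum.cong) auto
    then have "x = (\<Sum>i\<in>insert j I. ?f i)" using * insert.hyps by simp
    moreover have "\<forall>i\<in>insert j I. ?f i \<in> C i" using * by auto
    ultimately show "x \<in> {\<Sum>i\<in>insert j I. f i | f. \<forall>i\<in>insert j I. f i \<in> C i}" by blast
  qed (use insert.hyps in force)
  moreover have "compact ((\<lambda>(x, y). x + y) ` (C j \<times> ?S))"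
    by (intro compact_continuous_image compact_Times insert.IH)
       (auto simp: case_prod_unfold insert.prems intro!: continuous_intros)
  ultimately show ?case by simp
qed

lemma compact_add_sets:
  fixes A B :: "'a::topological_ab_group_add set"
  assumes "compact A" "compact B"
  shows "compact {x + y | x y. x \<in> A \<and> y \<in> B}"
proof -
  have "{x + y | x y. x \<in> A \<and> y \<in> B} = (\<lambda>(x, y). x + y) ` (A \<times> B)" by auto
  moreover have "compact ((\<lambda>(x, y). x + y) ` (A \<times> B))"
    by (intro compact_continuous_image compact_Times assms)
       (auto simp: case_prod_unfold intro!: continuous_intros)
  ultimately show ?thesis by simp
qed

section \<open>Pointwise calculus in the dual group\<close>

lemma character_nz [simp]: "character \<gamma> s \<noteq> 0"
proof
  assume "character \<gamma> s = 0"
  then have "cmod (character \<gamma> s) = 0" by (simp only: norm_zero)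
  then show False by simp
qed

lemma character_0 [simp]: "character \<gamma> 0 = 1"
proof -
  have "character \<gamma> 0 * character \<gamma> 0 = character \<gamma> 0 * 1"
    using character_add[of \<gamma> 0 0] by simp
  then show ?thesis unfolding mult_cancel_left by simp
qed

lemma character_minus: "character \<gamma> (- s) = cnj (character \<gamma> s)"
proof -
  have "character \<gamma> s * character \<gamma> (- s) = 1"
    using character_add[of \<gamma> s "- s"] by simp
  moreover have "character \<gamma> s * cnj (character \<gamma> s) = 1"
    using norm_character[of \<gamma> s] by (simp add: complex_norm_square[symmetric])
  ultimately show ?thesis by (metis mult_cancel_left character_nz)
qed

lemma character_diff: "character \<gamma> (s - t) = character \<gamma> s * cnj (character \<gamma> t)"
  using character_add[of \<gamma> s "- t"] by (simp add: character_minus)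

lemma character_sum: "character \<gamma> (\<Sum>i\<in>I. f i) = (\<Prod>i\<in>I. character \<gamma> (f i))"
  by (induction I rule: infinite_finite_induct) (auto simp: character_add)

lemma character_plus_dual: "character (\<gamma> + \<delta>) s = character \<gamma> s * character \<delta> s"
  by (simp add: plus_dual_group.rep_eq)

lemma character_zero_dual [simp]: "character 0 s = 1"
  by (simp add: zero_dual_group.rep_eq)

lemma character_minus_dual: "character (\<gamma> - \<delta>) s = character \<gamma> s * cnj (character \<delta> s)"
  by (simp only: minus_dual_group_def plus_dual_group.rep_eq uminus_dual_group.rep_eq)

lemma character_sum_dual: "character (\<Sum>i\<in>I. f i) s = (\<Prod>i\<in>I. character (f i) s)"
  by (induction I rule: infinite_finite_induct) (auto simp: character_plus_dual)

lemma dual_group_eqI: "(\<And>s. character \<gamma> s = character \<delta> s) \<Longrightarrow> \<gamma> = \<delta>"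
  by (rule iffD1[OF character_inject]) (rule ext)

lemma Abs_dual_group_character:
  assumes "continuous_on UNIV u" "\<And>s. cmod (u s) = 1" "\<And>s t. u (s + t) = u s * u t"
  shows "character (Abs_dual_group u) = u"
  using assms by (intro Abs_dual_group_inverse) auto

text \<open>For fixed \<phi> this is the one-parameter subgroup of the dual generated by \<phi>;
  \<open>dual_one_parameter\<close> shows that every one-parameter subgroup of the dual has this
  form.\<close>

definition real_character_dual :: "('g::{topological_space,ab_group_add} \<Rightarrow> real) \<Rightarrow> real \<Rightarrow> 'g dual_group"
  where "real_character_dual \<phi> a = Abs_dual_group (\<lambda>s. cis (a * \<phi> s))"

lemma character_real_character_dual:
  assumes "\<phi> \<in> real_characters"
  shows "character (real_character_dual \<phi> a) s = cis (a * \<phi> s)"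
  unfolding real_character_dual_def
  by (subst Abs_dual_group_character)
     (use assms in \<open>auto simp: real_characters_def cis_mult distrib_left intro!: continuous_intros continuous_on_cis\<close>)

lemma real_character_dual_add:
  assumes "\<phi> \<in> real_characters"
  shows "real_character_dual \<phi> (a + b) = real_character_dual \<phi> a + real_character_dual \<phi> b"
  by (rule dual_group_eqI)
     (simp add: character_real_character_dual[OF assms] character_plus_dual cis_mult distrib_right)

lemma has_vector_derivative_cis: "((\<lambda>u. cis (u * b)) has_vector_derivative b *\<^sub>R (\<i> * cis (t * b))) (at t within S)"
proof -
  have "((\<lambda>z. exp (\<i> * of_real b * z)) has_field_derivative
      exp (\<i> * of_real b * of_real t) * (\<i> * of_real b)) (at (of_real t))"
    by (auto intro!: derivative_eq_intros)
  then have "((\<lambda>u. exp (\<i> * of_real b * of_real u)) has_vector_derivative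
      exp (\<i> * of_real b * of_real t) * (\<i> * of_real b)) (at t within S)"
    by (rule has_vector_derivative_real_field)
  then show ?thesis
    by (simp add: cis_conv_exp scaleR_conv_of_real mult_ac)
qed

lemma norm_cis_diff_le: "cmod (cis a - cis b) \<le> \<bar>a - b\<bar>"
proof -
  have "norm (cis a - cis b) \<le> 1 * norm (a - b)"
  proof (rule differentiable_bound)
    show "(cis has_derivative (\<lambda>h. h *\<^sub>R (\<i> * cis t))) (at t within UNIV)" for t
      using has_vector_derivative_cis[of 1 t UNIV] by (simp add: has_vector_derivative_def)
    show "onorm (\<lambda>h. h *\<^sub>R (\<i> * cis t)) \<le> 1" for t
      by (rule onorm_le) (simp add: norm_mult)
  qed auto
  then show ?thesis by (simp add: real_norm_def)
qed

text \<open>The derivative of t \<mapsto> cis t - i t is i (cis t - 1), of modulus at most |t|, so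
  the mean value inequality on [-|u|, |u|] gives the constant 1.\<close>

lemma norm_cis_diff_linear_le: "cmod (cis u - 1 - \<i> * of_real u) \<le> u\<^sup>2"
proof -
  let ?f = "\<lambda>t. cis t - \<i> * of_real t"
  let ?S = "{- \<bar>u\<bar>..\<bar>u\<bar>}"
  have "norm (?f u - ?f 0) \<le> \<bar>u\<bar> * norm (u - 0)"
  proof (rule differentiable_bound)
    fix t assume t: "t \<in> ?S"
    have "((\<lambda>t. of_real t) has_vector_derivative of_real 1) (at t within ?S)"
      by (rule has_vector_derivative_of_real[OF DERIV_ident])
    then have "(?f has_vector_derivative (\<i> * cis t - \<i> * of_real 1)) (at t within ?S)"
      using has_vector_derivative_cis[of 1 t ?S]
      by (intro has_vector_derivative_diff has_vector_derivative_mult_right) auto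
    then show "(?f has_derivative (\<lambda>h. h *\<^sub>R (\<i> * cis t - \<i>))) (at t within ?S)"
      by (simp add: has_vector_derivative_def)
    have "\<i> * cis t - \<i> = \<i> * (cis t - cis 0)" by (simp add: algebra_simps)
    then have "cmod (\<i> * cis t - \<i>) = cmod (cis t - cis 0)"
      by (simp only: norm_mult) simp
    also have "\<dots> \<le> \<bar>u\<bar>" using norm_cis_diff_le[of t 0] t by auto
    finally show "onorm (\<lambda>h. h *\<^sub>R (\<i> * cis t - \<i>)) \<le> \<bar>u\<bar>"
      by (intro onorm_le) (simp add: mult.commute mult_left_mono)
  qed auto
  moreover have "?f u - ?f 0 = cis u - 1 - \<i> * of_real u" by simp
  ultimately show ?thesis by (simp only: power2_eq_square) simp
qed

text \<open>\<phi> is bounded on a compact set and cis is 1-Lipschitz, which gives uniform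
  convergence on compact sets.\<close>

lemma continuous_real_character_dual:
  fixes \<phi> :: "'a::{topological_space,ab_group_add} \<Rightarrow> real"
  assumes \<phi>: "\<phi> \<in> real_characters"
  shows "continuous_on UNIV (real_character_dual \<phi>)"
proof -
  have "(real_character_dual \<phi> \<longlongrightarrow> real_character_dual \<phi> a) (at a)" for a
  proof (rule tendsto_nhds_dual_groupI)
    fix K :: "'a set" and e :: real assume K: "compact K" and e: "e > 0"
    have "continuous_on K \<phi>" using \<phi> by (auto simp: real_characters_def intro: continuous_on_subset)
    then have "bounded (\<phi> ` K)" using K by (intro compact_imp_bounded compact_continuous_image)
    then obtain B where B: "B > 0" "\<And>s. s \<in> K \<Longrightarrow> \<bar>\<phi> s\<bar> \<le> B"
      by (auto simp: bounded_pos)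
    have "eventually (\<lambda>b. dist b a < e / B) (at a)"
      using B e unfolding eventually_at by (intro exI[of _ "e / B"]) auto
    then show "eventually (\<lambda>x. \<forall>s\<in>K. cmod (character (real_character_dual \<phi> x) s
         - character (real_character_dual \<phi> a) s) < e) (at a)"
    proof eventually_elim
      case (elim b)
      show ?case
      proof
        fix s assume s: "s \<in> K"
        have "cmod (cis (b * \<phi> s) - cis (a * \<phi> s)) \<le> \<bar>b - a\<bar> * \<bar>\<phi> s\<bar>"
          using norm_cis_diff_le[of "b * \<phi> s" "a * \<phi> s"] by (simp add: left_diff_distrib[symmetric] abs_mult)
        also have "\<dots> \<le> \<bar>b - a\<bar> * B" using B(2)[OF s] by (intro mult_left_mono) auto
        also have "\<dots> < e" using elim B(1) by (simp add: dist_real_def field_simps)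
        finally show "cmod (character (real_character_dual \<phi> b) s - character (real_character_dual \<phi> a) s) < e"
          by (simp add: character_real_character_dual[OF \<phi>])
      qed
    qed
  qed
  then show ?thesis by (simp add: continuous_on_def)
qed

section \<open>Elementary groups and their duals\<close>

text \<open>The isomorphism with R^n x Z^m x T^k x F is split into coordinate functions
  \<open>x\<close>, \<open>y\<close>, \<open>z\<close>, \<open>u\<close> and maps \<open>X\<close>,
  \<open>Y\<close>, \<open>Z\<close> back into the group. A circle factor is parametrised by its
  angle, so \<open>Z j\<close> lives on the line with period 2 pi, and \<open>Arg\<close> picks the
  angle in \<open>decomp\<close>. \<open>Y j\<close> takes real arguments like \<open>X j\<close>,
  but its additivity is claimed on integers. The finite component \<open>u\<close> takes values in
  the group itself.\<close>

locale elementary_coordinates =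
  fixes n m k :: nat and F :: "'g::topological_ab_group_add set"
    and x y :: "nat \<Rightarrow> 'g \<Rightarrow> real" and z :: "nat \<Rightarrow> 'g \<Rightarrow> complex" and u :: "'g \<Rightarrow> 'g"
    and X :: "nat \<Rightarrow> real \<Rightarrow> 'g" and Y :: "nat \<Rightarrow> real \<Rightarrow> 'g" and Z :: "nat \<Rightarrow> real \<Rightarrow> 'g"
  assumes finite_F: "finite F" and add_F: "\<And>v w. v \<in> F \<Longrightarrow> w \<in> F \<Longrightarrow> v + w \<in> F"
    and x: "j < n \<Longrightarrow> x j \<in> real_characters"
    and y: "j < m \<Longrightarrow> y j \<in> real_characters" and y_Ints: "j < m \<Longrightarrow> y j s \<in> \<int>"
    and z: "j < k \<Longrightarrow> continuous_on UNIV (z j)" and z_norm: "j < k \<Longrightarrow> cmod (z j s) = 1"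
    and z_mult: "j < k \<Longrightarrow> z j (s + t) = z j s * z j t"
    and u: "continuous_on UNIV u" and u_add: "u (s + t) = u s + u t" and u_F: "u s \<in> F"
    and X: "j < n \<Longrightarrow> X j \<in> one_parameter_subgroups"
    and Y: "j < m \<Longrightarrow> a \<in> \<int> \<Longrightarrow> b \<in> \<int> \<Longrightarrow> Y j (a + b) = Y j a + Y j b"
    and Z: "j < k \<Longrightarrow> Z j \<in> one_parameter_subgroups" and Z_2pi: "j < k \<Longrightarrow> Z j (2 * pi) = 0"
    and decomp: "s = (\<Sum>j<n. X j (x j s)) + (\<Sum>j<m. Y j (y j s)) + (\<Sum>j<k. Z j (Arg (z j s))) + u s"

lemma elementary_group_coordinates:
  assumes "elementary_group TYPE('g::topological_ab_group_add)"
  obtains n m k and F :: "'g::topological_ab_group_add set" and x y z u X Y Z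
  where "elementary_coordinates n m k F x y z u X Y Z"
proof -
  let ?E = "\<lambda>(n::nat) (m::nat) (k::nat) (F :: 'g set). {x :: nat \<Rightarrow> real. \<forall>i\<ge>n. x i = 0} \<times> {y :: nat \<Rightarrow> real. (\<forall>i. y i \<in> \<int>) \<and> (\<forall>i\<ge>m. y i = 0)} \<times>
                {z :: nat \<Rightarrow> complex. (\<forall>i. cmod (z i) = 1) \<and> (\<forall>i\<ge>k. z i = 1)} \<times> F"
  obtain n m k and F0 :: "'g set"
    and h :: "(nat \<Rightarrow> real) \<times> (nat \<Rightarrow> real) \<times> (nat \<Rightarrow> complex) \<times> 'g \<Rightarrow> 'g" and h'
    where F0: "finite F0" "0 \<in> F0" "\<forall>u\<in>F0. \<forall>v\<in>F0. u - v \<in> F0"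
      and hom0: "homeomorphism (?E n m k F0) UNIV h h'"
      and add0: "\<forall>(x, y, z, u)\<in>?E n m k F0. \<forall>(x', y', z', u')\<in>?E n m k F0.
              h (\<lambda>i. x i + x' i, \<lambda>i. y i + y' i, \<lambda>i. z i * z' i, u + u')
                = h (x, y, z, u) + h (x', y', z', u')"
    using assms unfolding elementary_group_def Let_def by (elim exE conjE) (rule that)
  define E where "E = ?E n m k F0"
  note hom = hom0[folded E_def] and add = add0[folded E_def]
  have F0_add: "v + w \<in> F0" if "v \<in> F0" "w \<in> F0" for v w
  proof -
    have "0 - w \<in> F0" using F0 that by blast
    then have "v - (0 - w) \<in> F0" using F0 that by blast
    then show ?thesis by simp
  qed
  have h_add: "h (\<lambda>i. x i + x' i, \<lambda>i. y i + y' i, \<lambda>i. z i * z' i, u + u') = h (x, y, z, u) + h (x', y', z', u')"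
    if "(x, y, z, u) \<in> E" "(x', y', z', u') \<in> E" for x y z u x' y' z' u'
    using add that by blast
  \<comment> \<open>The sum of two points may be given up to pointwise equality of its sequences,
    since the uses below contain case distinctions.\<close>
  have h_add': "h (a, b, c, d) = h (x, y, z, u) + h (x', y', z', u')"
    if "(x, y, z, u) \<in> E" "(x', y', z', u') \<in> E" "\<And>i. a i = x i + x' i" "\<And>i. b i = y i + y' i"
      "\<And>i. c i = z i * z' i" "d = u + u'" for x y z u x' y' z' u' a b c d
  proof -
    have "a = (\<lambda>i. x i + x' i)" "b = (\<lambda>i. y i + y' i)" "c = (\<lambda>i. z i * z' i)" using that by auto
    then show ?thesis using h_add[OF that(1,2)] that(6) by simp
  qed
  have h'h: "h' (h e) = e" if "e \<in> E" for e using hom that by (simp add: homeomorphism_def)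
  have hh': "h (h' s) = s" for s using hom by (simp add: homeomorphism_def)
  have h'E: "h' s \<in> E" for s using hom by (auto simp: homeomorphism_def)
  have conth: "continuous_on E h" and conth': "continuous_on UNIV h'"
    using hom by (auto simp: homeomorphism_def)
  define x y z u where "x i s = fst (h' s) i" and "y i s = fst (snd (h' s)) i"
    and "z i s = fst (snd (snd (h' s))) i" and "u s = h (\<lambda>_. 0, \<lambda>_. 0, \<lambda>_. 1, snd (snd (snd (h' s))))"
    for i s
  define u0 where "u0 s = snd (snd (snd (h' s)))" for s
  have E: "(\<lambda>i. x i s, \<lambda>i. y i s, \<lambda>i. z i s, u0 s) = h' s" for s
    by (simp add: x_def y_def z_def u0_def)
  have coordE: "(\<lambda>i. x i s, \<lambda>i. y i s, \<lambda>i. z i s, u0 s) \<in> E" for s unfolding E by (rule h'E)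
  define X where "X j t = h (\<lambda>i. if i = j then t else 0, \<lambda>_. 0, \<lambda>_. 1, 0)" for j t
  define Y where "Y j t = h (\<lambda>_. 0, \<lambda>i. if i = j then t else 0, \<lambda>_. 1, 0)" for j t
  define Z where "Z j t = h (\<lambda>_. 0, \<lambda>_. 0, \<lambda>i. if i = j then cis t else 1, 0)" for j t
  \<comment> \<open>The neutral element of \<open>E\<close> is its own double.\<close>
  have h0: "h (\<lambda>_. 0, \<lambda>_. 0, \<lambda>_. 1, 0) = 0"
    using h_add[of "\<lambda>_. 0" "\<lambda>_. 0" "\<lambda>_. 1" 0 "\<lambda>_. 0" "\<lambda>_. 0" "\<lambda>_. 1" 0] F0 by (simp add: E_def)
  have coord_add: "h' (s + t) = (\<lambda>i. x i s + x i t, \<lambda>i. y i s + y i t, \<lambda>i. z i s * z i t, u0 s + u0 t)" for s t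
  proof -
    let ?e = "(\<lambda>i. x i s + x i t, \<lambda>i. y i s + y i t, \<lambda>i. z i s * z i t, u0 s + u0 t)"
    have "?e \<in> E" using coordE[of s] coordE[of t] F0_add by (auto simp: E_def norm_mult)
    moreover have "h ?e = s + t"
      using h_add[OF coordE[of s] coordE[of t]] by (simp add: E hh')
    ultimately show ?thesis using h'h[of ?e] by simp
  qed
  have cont_x: "continuous_on UNIV (x i)" and cont_y: "continuous_on UNIV (y i)"
    and cont_z: "continuous_on UNIV (z i)" and cont_u0: "continuous_on UNIV u0" for i
    unfolding x_def y_def z_def u0_def
    by (fact continuous_on_product_then_coordinatewise[OF continuous_on_fst[OF conth']]
        continuous_on_product_then_coordinatewise[OF continuous_on_fst[OF continuous_on_snd[OF conth']]]
        continuous_on_product_then_coordinatewise[OF continuous_on_fst[OF continuous_on_snd[OF continuous_on_snd[OF conth']]]]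
        continuous_on_snd[OF continuous_on_snd[OF continuous_on_snd[OF conth']]])+
  have contX: "continuous_on UNIV (X j)" if "j < n" for j
    unfolding X_def
  proof (rule continuous_on_compose2[OF conth])
    have "continuous_on UNIV (\<lambda>t::real. if i = j then t else 0)" for i
      by (cases "i = j") simp_all
    then show "continuous_on UNIV (\<lambda>t::real. (\<lambda>i. if i = j then t else 0, \<lambda>_. 0, \<lambda>_. 1, 0))"
      by (intro continuous_on_Pair continuous_on_const continuous_on_coordinatewise_then_product)
  qed (use that F0 in \<open>auto simp: E_def\<close>)
  have contZ: "continuous_on UNIV (Z j)" if "j < k" for j
    unfolding Z_def
  proof (rule continuous_on_compose2[OF conth])
    have "continuous_on UNIV (\<lambda>t. if i = j then cis t else 1)" for i
      by (cases "i = j") (simp_all add: continuous_on_cis continuous_on_id)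
    then show "continuous_on UNIV (\<lambda>t. (\<lambda>_. 0, \<lambda>_. 0, \<lambda>i. if i = j then cis t else 1, 0))"
      by (intro continuous_on_Pair continuous_on_const continuous_on_coordinatewise_then_product)
  qed (use that F0 in \<open>auto simp: E_def\<close>)
  \<comment> \<open>\<open>h\<close> need not fix the points of \<open>F0\<close>, so the finite
    subgroup used for the coordinates is the image of the last factor.\<close>
  let ?F = "{\<lambda>_. 0} \<times> {\<lambda>_. 0} \<times> {\<lambda>_. 1} \<times> F0"
  have cl: "elementary_coordinates n m k (h ` ?F) x y z u X Y Z"
  proof
    show "finite (h ` ?F)" using F0 by auto
    show "v + w \<in> h ` ?F"
      if v: "v \<in> h ` ?F" and w: "w \<in> h ` ?F" for v w
    proof -
      obtain a where a: "a \<in> F0" "v = h (\<lambda>_. 0, \<lambda>_. 0, \<lambda>_. 1, a)" using v by auto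
      obtain b where b: "b \<in> F0" "w = h (\<lambda>_. 0, \<lambda>_. 0, \<lambda>_. 1, b)" using w by auto
      have "h (\<lambda>_. 0, \<lambda>_. 0, \<lambda>_. 1, a + b) = v + w"
        unfolding a b by (rule h_add') (use a b in \<open>auto simp: E_def\<close>)
      then show ?thesis using F0_add[OF a(1) b(1)] by force
    qed
    show "x j \<in> real_characters" if "j < n" for j
      using cont_x[of j] coord_add unfolding real_characters_def by (auto simp: x_def)
    show "y j \<in> real_characters" if "j < m" for j
      using cont_y[of j] coord_add unfolding real_characters_def by (auto simp: y_def)
    show "y j s \<in> \<int>" if "j < m" for j s using coordE[of s] by (auto simp: E_def)
    show "continuous_on UNIV (z j)" if "j < k" for j by (rule cont_z)
    show "cmod (z j s) = 1" if "j < k" for j s using coordE[of s] by (auto simp: E_def)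
    show "z j (s + t) = z j s * z j t" if "j < k" for j s t using coord_add[of s t] by (simp add: z_def)
    show "continuous_on UNIV u"
      unfolding u_def u0_def[symmetric]
    proof (rule continuous_on_compose2[OF conth])
      show "continuous_on UNIV (\<lambda>s. (\<lambda>_. 0, \<lambda>_. 0, \<lambda>_. 1, u0 s))"
        by (intro continuous_on_Pair continuous_on_const cont_u0)
    qed (use coordE in \<open>auto simp: E_def\<close>)
    have u0F: "u0 s \<in> F0" for s using coordE[of s] by (auto simp: E_def)
    have u0_add: "u0 (s + t) = u0 s + u0 t" for s t using coord_add[of s t] by (simp add: u0_def)
    show "u (s + t) = u s + u t" for s t
      unfolding u_def u0_def[symmetric]
      by (rule h_add') (use u0F u0_add in \<open>auto simp: E_def\<close>)
    show "u s \<in> h ` ?F" for s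
      using u0F by (simp add: u_def u0_def[symmetric])
    show "X j \<in> one_parameter_subgroups" if "j < n" for j
      unfolding one_parameter_subgroups_def
    proof safe
      show "X j (a + b) = X j a + X j b" for a b
        unfolding X_def by (rule h_add') (use that F0 in \<open>auto simp: E_def\<close>)
    qed (rule contX[OF that])
    show "Z j \<in> one_parameter_subgroups" if "j < k" for j
      unfolding one_parameter_subgroups_def
    proof safe
      show "Z j (a + b) = Z j a + Z j b" for a b
        unfolding Z_def by (rule h_add') (use that F0 in \<open>auto simp: E_def cis_mult\<close>)
    qed (rule contZ[OF that])
    show "Z j (2 * pi) = 0" if "j < k" for j
      using h0 unfolding Z_def cis_2pi by simp
    show "Y j (a + b) = Y j a + Y j b" if "j < m" "a \<in> \<int>" "b \<in> \<int>" for j a b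
      unfolding Y_def by (rule h_add') (use that F0 in \<open>auto simp: E_def\<close>)
    show "s = (\<Sum>j<n. X j (x j s)) + (\<Sum>j<m. Y j (y j s)) + (\<Sum>j<k. Z j (Arg (z j s))) + u s" for s
    proof -
      \<comment> \<open>The coordinates are put back one at a time: the first N summands give the
        point whose sequence is cut off after N entries.\<close>
      have sx: "(\<Sum>j<N. X j (x j s)) = h (\<lambda>i. if i < N then x i s else 0, \<lambda>_. 0, \<lambda>_. 1, 0)" if "N \<le> n" for N
        using that
      proof (induction N)
        case 0 show ?case using h0 by simp
      next
        case (Suc N)
        have "h (\<lambda>i. if i < Suc N then x i s else 0, \<lambda>_. 0, \<lambda>_. 1, 0)
            = h (\<lambda>i. if i < N then x i s else 0, \<lambda>_. 0, \<lambda>_. 1, 0) + X N (x N s)"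
          unfolding X_def by (rule h_add') (use Suc.prems F0 in \<open>auto simp: E_def less_Suc_eq\<close>)
        then show ?case using Suc by simp
      qed
      have sy: "(\<Sum>j<N. Y j (y j s)) = h (\<lambda>_. 0, \<lambda>i. if i < N then y i s else 0, \<lambda>_. 1, 0)" if "N \<le> m" for N
        using that
      proof (induction N)
        case 0 show ?case using h0 by simp
      next
        case (Suc N)
        have "h (\<lambda>_. 0, \<lambda>i. if i < Suc N then y i s else 0, \<lambda>_. 1, 0)
            = h (\<lambda>_. 0, \<lambda>i. if i < N then y i s else 0, \<lambda>_. 1, 0) + Y N (y N s)"
          unfolding Y_def by (rule h_add') (use Suc.prems F0 coordE[of s] in \<open>auto simp: E_def less_Suc_eq\<close>)
        then show ?case using Suc by simp
      qed
      have sz: "(\<Sum>j<N. Z j (Arg (z j s))) = h (\<lambda>_. 0, \<lambda>_. 0, \<lambda>i. if i < N then z i s else 1, 0)" if "N \<le> k" for N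
        using that
      proof (induction N)
        case 0 show ?case using h0 by simp
      next
        case (Suc N)
        have "cmod (z N s) = 1" using coordE[of s] by (auto simp: E_def)
        then have [simp]: "cis (Arg (z N s)) = z N s"
          by (subst cis_Arg) (auto simp: sgn_eq)
        have "h (\<lambda>_. 0, \<lambda>_. 0, \<lambda>i. if i < Suc N then z i s else 1, 0)
            = h (\<lambda>_. 0, \<lambda>_. 0, \<lambda>i. if i < N then z i s else 1, 0) + Z N (Arg (z N s))"
          unfolding Z_def by (rule h_add') (use Suc.prems F0 coordE[of s] in \<open>auto simp: E_def less_Suc_eq\<close>)
        then show ?case using Suc by simp
      qed
      have xn: "(\<lambda>i. if i < n then x i s else 0) = (\<lambda>i. x i s)"
        and ym: "(\<lambda>i. if i < m then y i s else 0) = (\<lambda>i. y i s)"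
        and zk: "(\<lambda>i. if i < k then z i s else 1) = (\<lambda>i. z i s)"
        using coordE[of s] by (auto simp: E_def fun_eq_iff)
      have "s = h (\<lambda>i. x i s, \<lambda>i. y i s, \<lambda>i. z i s, u0 s)" by (simp add: E hh')
      also have "\<dots> = h (\<lambda>i. x i s, \<lambda>i. y i s, \<lambda>i. z i s, 0) + u s"
        unfolding u_def u0_def[symmetric]
        by (rule h_add') (use coordE[of s] F0 in \<open>auto simp: E_def\<close>)
      also have "h (\<lambda>i. x i s, \<lambda>i. y i s, \<lambda>i. z i s, 0)
          = h (\<lambda>i. x i s, \<lambda>i. y i s, \<lambda>_. 1, 0) + h (\<lambda>_. 0, \<lambda>_. 0, \<lambda>i. z i s, 0)"
        by (rule h_add') (use coordE[of s] F0 in \<open>auto simp: E_def\<close>)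
      also have "h (\<lambda>i. x i s, \<lambda>i. y i s, \<lambda>_. 1, 0)
          = h (\<lambda>i. x i s, \<lambda>_. 0, \<lambda>_. 1, 0) + h (\<lambda>_. 0, \<lambda>i. y i s, \<lambda>_. 1, 0)"
        by (rule h_add') (use coordE[of s] F0 in \<open>auto simp: E_def\<close>)
      finally show ?thesis using sx[of n] sy[of m] sz[of k] by (simp add: xn ym zk)
    qed
  qed
  show ?thesis by (rule that[OF cl])
qed

lemma cis_eq_iff_all: "(\<forall>t. cis (a * t) = cis (b * t)) \<longleftrightarrow> a = b"
proof
  assume *: "\<forall>t. cis (a * t) = cis (b * t)"
  show "a = b"
  proof (rule ccontr)
    assume ne: "a \<noteq> b"
    \<comment> \<open>At this time the quotient of the two sides is cis pi = - 1.\<close>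
    let ?t = "pi / (a - b)"
    have ab: "cis (a * ?t) = cis (b * ?t)" using * by blast
    have "cis ((a - b) * ?t) = cis (a * ?t) * cnj (cis (b * ?t))"
      by (simp only: cis_cnj cis_mult left_diff_distrib) simp
    also have "\<dots> = cis (b * ?t) * cnj (cis (b * ?t))" unfolding ab ..
    also have "\<dots> = 1" by (simp only: cis_cnj cis_mult) simp
    finally show False using ne by simp
  qed
qed simp

text \<open>On a one-parameter subgroup a character is t \<mapsto> cis (a t) with a unique a, see
  \<open>character_one_parameter\<close>; in the Euclidean directions this is the usual dual
  variable.\<close>

definition frequency :: "(real \<Rightarrow> 'g::{topological_space,ab_group_add}) \<Rightarrow> 'g dual_group \<Rightarrow> real"
  where "frequency X \<gamma> = (THE a. \<forall>t. character \<gamma> (X t) = cis (a * t))"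

lemma frequency_eqI:
  assumes "\<And>t. character \<gamma> (X t) = cis (a * t)"
  shows "frequency X \<gamma> = a"
  unfolding frequency_def
proof (rule the_equality)
  fix b assume "\<forall>t. character \<gamma> (X t) = cis (b * t)"
  then show "b = a" using assms by (subst cis_eq_iff_all[symmetric]) simp
qed (use assms in simp)

lemma character_one_parameter:
  assumes "X \<in> one_parameter_subgroups"
  shows "character \<gamma> (X t) = cis (frequency X \<gamma> * t)"
proof -
  have X: "continuous_on UNIV X" "\<And>a b. X (a + b) = X a + X b"
    using assms by (auto simp: one_parameter_subgroups_def)
  have "continuous_on UNIV (\<lambda>t. character \<gamma> (X t))"
    by (rule continuous_on_compose2[OF continuous_character X(1)]) auto
  then obtain a where a: "\<And>t. character \<gamma> (X t) = cis (a * t)"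
    by (rule circle_hom_cis) (auto simp: X(2) character_add)
  then show ?thesis using frequency_eqI[of \<gamma> X a] by simp
qed

lemma real_character_sum:
  assumes "\<psi> \<in> real_characters"
  shows "\<psi> (\<Sum>i\<in>I. f i) = (\<Sum>i\<in>I. \<psi> (f i))"
proof -
  have add: "\<psi> (a + b) = \<psi> a + \<psi> b" for a b using assms by (auto simp: real_characters_def)
  have "\<psi> 0 = 0" using add[of 0 0] by simp
  then show ?thesis by (induction I rule: infinite_finite_induct) (auto simp: add)
qed

lemma one_parameter_sum:
  fixes X :: "'i \<Rightarrow> real \<Rightarrow> 'g::topological_ab_group_add"
  assumes "\<And>i. i \<in> I \<Longrightarrow> X i \<in> one_parameter_subgroups"
  shows "(\<lambda>t. \<Sum>i\<in>I. X i (t * c i)) \<in> one_parameter_subgroups"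
  unfolding one_parameter_subgroups_def
proof safe
  have "continuous_on UNIV (\<lambda>t. X i (t * c i))" if "i \<in> I" for i
    by (rule continuous_on_compose2[of UNIV "X i"])
      (use assms that in \<open>auto simp: one_parameter_subgroups_def intro!: continuous_intros\<close>)
  then show "continuous_on UNIV (\<lambda>t. \<Sum>i\<in>I. X i (t * c i))" by (intro continuous_on_sum)
  show "(\<Sum>i\<in>I. X i ((a + b) * c i)) = (\<Sum>i\<in>I. X i (a * c i)) + (\<Sum>i\<in>I. X i (b * c i))" for a b
    unfolding sum.distrib[symmetric]
    by (intro sum.cong refl) (use assms in \<open>auto simp: one_parameter_subgroups_def distrib_right\<close>)
qed

lemma one_parameter_add:
  fixes X Y :: "real \<Rightarrow> 'g::topological_ab_group_add"
  assumes "X \<in> one_parameter_subgroups" "Y \<in> one_parameter_subgroups"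
  shows "(\<lambda>t. X t + Y t) \<in> one_parameter_subgroups"
  using assms by (auto simp: one_parameter_subgroups_def intro!: continuous_intros)

section \<open>The dual of an elementary group in coordinates\<close>

context elementary_coordinates
begin

definition circle_dual :: "nat \<Rightarrow> int \<Rightarrow> 'g dual_group"
  where "circle_dual j b = Abs_dual_group (\<lambda>s. z j s powi b)"

definition finite_part :: "'g dual_group \<Rightarrow> 'g dual_group"
  where "finite_part \<gamma> = Abs_dual_group (\<lambda>s. character \<gamma> (u s))"

lemma z_nz: "j < k \<Longrightarrow> z j s \<noteq> 0"
  using z_norm[of j s] by auto

lemma character_circle_dual: "j < k \<Longrightarrow> character (circle_dual j b) s = z j s powi b"
  unfolding circle_dual_def
  by (subst Abs_dual_group_character)
    (auto simp: z_nz z_norm z_mult norm_power_int power_int_mult_distrib intro!: continuous_on_power_int z)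

lemma circle_dual_add: "j < k \<Longrightarrow> circle_dual j (a + b) = circle_dual j a + circle_dual j b"
  by (rule dual_group_eqI) (simp add: character_circle_dual character_plus_dual power_int_add z_nz)

lemma character_finite_part: "character (finite_part \<gamma>) s = character \<gamma> (u s)"
  unfolding finite_part_def
  by (subst Abs_dual_group_character)
    (auto simp: u_add character_add intro!: continuous_on_compose2[OF continuous_character u])

lemma finite_part_add: "finite_part (\<gamma> + \<delta>) = finite_part \<gamma> + finite_part \<delta>"
  by (rule dual_group_eqI) (simp add: character_finite_part character_plus_dual)

text \<open>
  \<open>n\<close>-fold sums have no library notation in an additive group; pigeonhole among them gives a
  period at most \<open>card F\<close>, which divides the factorial.
\<close>

lemma character_F_power:
  assumes v: "v \<in> F"
  shows "character \<gamma> v ^ fact (card F) = 1"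
proof -
  define w where "w i = (\<Sum>j<Suc i. v)" for i :: nat
  have w: "w i \<in> F" for i
    by (induction i) (auto simp: w_def v intro: add_F)
  have cw: "character \<gamma> (w i) = character \<gamma> v ^ Suc i" for i
    by (simp only: w_def character_sum prod_constant card_lessThan)
  have "card (w ` {..card F}) \<le> card F"
    by (intro card_mono finite_F) (use w in auto)
  then have "\<not> inj_on w {..card F}"
    using card_image[of w "{..card F}"] by auto
  then obtain p q where pq: "p \<le> card F" "q \<le> card F" "p < q" "w p = w q"
    unfolding inj_on_def by (metis atMost_iff linorder_neqE_nat)
  have "Suc p + (q - p) = Suc q" using pq by simp
  then have "character \<gamma> v ^ Suc p * character \<gamma> v ^ (q - p) = character \<gamma> v ^ Suc p * 1"
    using cw[of p] cw[of q] pq(4) by (metis power_add mult_1_right)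
  then have 1: "character \<gamma> v ^ (q - p) = 1"
    unfolding mult_cancel_left using power_not_zero[OF character_nz] by blast
  have "(q - p) dvd fact (card F)" using pq by (intro dvd_fact) auto
  then obtain r where "fact (card F) = (q - p) * r" by (elim dvdE)
  then show ?thesis using 1 by (simp add: power_mult)
qed

text \<open>The part depends on \<gamma> only through its restriction to \<open>F\<close>, whose
  values are roots of unity of a fixed order.\<close>

lemma finite_finite_part: "finite (range finite_part)"
proof -
  let ?R = "{c :: complex. c ^ fact (card F) = 1}"
  have "range finite_part \<subseteq> (\<lambda>f. Abs_dual_group (\<lambda>s. f (u s))) ` (PiE F (\<lambda>_. ?R))"
  proof (intro image_subsetI)
    fix \<gamma>
    have "finite_part \<gamma> = Abs_dual_group (\<lambda>s. restrict (character \<gamma>) F (u s))"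
      by (simp add: finite_part_def u_F)
    moreover have "restrict (character \<gamma>) F \<in> PiE F (\<lambda>_. ?R)" by (auto simp: character_F_power)
    ultimately show "finite_part \<gamma> \<in> (\<lambda>f. Abs_dual_group (\<lambda>s. f (u s))) ` (PiE F (\<lambda>_. ?R))"
      by (rule image_eqI)
  qed
  moreover have "finite ?R" by (rule finite_roots_unity) (simp add: fact_ge_1)
  ultimately show ?thesis by (rule finite_subset[OF _ finite_imageI[OF finite_PiE[OF finite_F]]])
qed

text \<open>\<open>Y j\<close> is a homomorphism on the integers, so the left side is a power of the
  value at 1; the angle of that value turns the power into a formula in a real variable.\<close>

lemma character_Y:
  assumes j: "j < m" and t: "t \<in> \<int>"
  shows "character \<gamma> (Y j t) = cis (Arg (character \<gamma> (Y j 1)) * t)"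
proof -
  let ?\<theta> = "Arg (character \<gamma> (Y j 1))"
  have c1: "cis ?\<theta> = character \<gamma> (Y j 1)" by (subst cis_Arg) (auto simp: sgn_eq)
  have Y0: "Y j 0 = 0" using Y[OF j, of 0 0] by simp
  have nat: "character \<gamma> (Y j (real i)) = cis (?\<theta> * real i)" for i
  proof (induction i)
    case (Suc i)
    have "Y j (real (Suc i)) = Y j (real i) + Y j 1"
      using Y[OF j, of "real i" 1] by (simp add: add.commute)
    then show ?case using Suc by (simp add: character_add c1 flip: cis_mult add: distrib_left)
  qed (simp add: Y0)
  obtain l where l: "t = of_int l" using t by (rule Ints_cases)
  show ?thesis
  proof (cases l rule: int_cases2)
    case (nonneg i)
    then show ?thesis using nat l by simp
  next
    case (nonpos i)
    have "Y j (real i + - real i) = Y j (real i) + Y j (- real i)" by (rule Y[OF j]) auto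
    then have "Y j (- real i) = - Y j (real i)" by (simp add: Y0 add_eq_0_iff)
    then show ?thesis using nat[of i] l nonpos by (simp add: character_minus cis_cnj)
  qed
qed

lemma frequency_Z_Ints:
  assumes j: "j < k"
  shows "frequency (Z j) \<gamma> \<in> \<int>"
proof -
  have "cis (frequency (Z j) \<gamma> * (2 * pi)) = 1"
    using character_one_parameter[OF Z[OF j], of \<gamma> "2 * pi"] by (simp add: Z_2pi[OF j])
  then have "cos (frequency (Z j) \<gamma> * (2 * pi)) = 1" by (simp add: complex_eq_iff)
  then obtain i :: int where "frequency (Z j) \<gamma> * (2 * pi) = of_int i * 2 * pi"
    unfolding cos_one_2pi_int by auto
  then have "frequency (Z j) \<gamma> = of_int i" by simp
  then show ?thesis by simp
qed

text \<open>The dual of R^n x Z^m x T^k x F is R^n x T^m x Z^k times the dual of F. The angle on the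
  circle dual to the j-th copy of Z is read off the value at \<open>Y j 1\<close>. The frequency
  along \<open>Z j\<close> is an integer because of the period 2 pi, so the floor is exact.\<close>

lemma dual_decomp:
  "\<gamma> = (\<Sum>j<n. real_character_dual (x j) (frequency (X j) \<gamma>))
     + (\<Sum>j<m. real_character_dual (y j) (Arg (character \<gamma> (Y j 1))))
     + (\<Sum>j<k. circle_dual j \<lfloor>frequency (Z j) \<gamma>\<rfloor>) + finite_part \<gamma>"
proof (rule dual_group_eqI)
  fix s
  have "character \<gamma> (X j (x j s)) = character (real_character_dual (x j) (frequency (X j) \<gamma>)) s" if "j < n" for j
    by (simp add: character_one_parameter[OF X[OF that]] character_real_character_dual[OF x[OF that]])
  moreover have "character \<gamma> (Y j (y j s)) = character (real_character_dual (y j) (Arg (character \<gamma> (Y j 1)))) s"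
    if "j < m" for j
    by (simp add: character_Y[OF that y_Ints[OF that]] character_real_character_dual[OF y[OF that]])
  moreover have "character \<gamma> (Z j (Arg (z j s))) = character (circle_dual j \<lfloor>frequency (Z j) \<gamma>\<rfloor>) s" if "j < k" for j
  proof -
    obtain i where i: "frequency (Z j) \<gamma> = of_int i" using frequency_Z_Ints[OF \<open>j < k\<close>] by (rule Ints_cases)
    have "cis (Arg (z j s)) = z j s" using z_norm[OF that] z_nz[OF that] by (subst cis_Arg) (auto simp: sgn_eq)
    then have "cis (of_int i * Arg (z j s)) = z j s powi i"
      using cis_power_int[of "Arg (z j s)" i] by simp
    then show ?thesis
      by (simp add: character_one_parameter[OF Z[OF that]] character_circle_dual[OF that] i)
  qed
  ultimately show "character \<gamma> s = character ((\<Sum>j<n. real_character_dual (x j) (frequency (X j) \<gamma>))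
     + (\<Sum>j<m. real_character_dual (y j) (Arg (character \<gamma> (Y j 1))))
     + (\<Sum>j<k. circle_dual j \<lfloor>frequency (Z j) \<gamma>\<rfloor>) + finite_part \<gamma>) s"
    by (subst decomp) (simp add: character_plus_dual character_add character_sum character_sum_dual
        character_finite_part)
qed

text \<open>A real character of the dual is linear on each line, a multiple of the integer on each
  copy of Z, and zero on the compact factors, so by \<open>dual_decomp\<close> it is a linear form
  in the frequencies. Such a form is itself the frequency along a suitable one-parameter
  subgroup.\<close>

lemma dual_real_character:
  fixes \<psi> :: "'g dual_group \<Rightarrow> real"
  assumes \<psi>: "\<psi> \<in> real_characters"
  shows "\<exists>X\<in>one_parameter_subgroups. \<forall>\<gamma> t. character \<gamma> (X t) = cis (t * \<psi> \<gamma>)"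
proof -
  have cont: "continuous_on UNIV \<psi>" using \<psi> by (auto simp: real_characters_def)
  have add: "\<psi> (a + b) = \<psi> a + \<psi> b" for a b using \<psi> by (auto simp: real_characters_def)
  have lin: "\<psi> (real_character_dual q a) = a * \<psi> (real_character_dual q 1)" if "q \<in> real_characters" for q a
  proof -
    have "continuous_on UNIV (\<lambda>a. \<psi> (real_character_dual q a))"
      by (rule continuous_on_compose2[OF cont continuous_real_character_dual[OF that]]) auto
    then show ?thesis
      using continuous_additive_linear[of "\<lambda>a. \<psi> (real_character_dual q a)" a]
      by (simp add: real_character_dual_add[OF that] add)
  qed
  \<comment> \<open>\<open>a \<mapsto> real_character_dual (y j) a\<close> has period \<open>2\<pi>\<close>, because \<open>y j\<close> is integer valued\<close>
  have y0: "\<psi> (real_character_dual (y j) a) = 0" if "j < m" for j a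
  proof -
    have "real_character_dual (y j) (2 * pi) = 0"
    proof (rule dual_group_eqI)
      fix s
      obtain i where i: "y j s = of_int i" using y_Ints[OF \<open>j < m\<close>] by (rule Ints_cases)
      show "character (real_character_dual (y j) (2 * pi)) s = character 0 s"
        by (simp add: character_real_character_dual[OF y[OF that]] i complex_eq_iff cos_int_2pin sin_int_2pin)
    qed
    then have "2 * pi * \<psi> (real_character_dual (y j) 1) = 0"
      using lin[OF y[OF that], of "2 * pi"] add[of 0 0] by simp
    then show ?thesis using lin[OF y[OF that], of a] by simp
  qed
  have z1: "\<psi> (circle_dual j b) = of_int b * \<psi> (circle_dual j 1)" if "j < k" for j b
  proof -
    have 0: "\<psi> (circle_dual j 0) = 0" using add[of "circle_dual j 0" "circle_dual j 0"]
      by (simp flip: circle_dual_add[OF that])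
    have nat: "\<psi> (circle_dual j (int i)) = of_nat i * \<psi> (circle_dual j 1)" for i
      by (induction i) (auto simp: 0 circle_dual_add[OF that] add algebra_simps)
    show ?thesis
    proof (cases b rule: int_cases2)
      case (nonpos i)
      have "\<psi> (circle_dual j (int i + - int i)) = \<psi> (circle_dual j (int i)) + \<psi> (circle_dual j (- int i))"
        by (simp only: circle_dual_add[OF that] add)
      then show ?thesis using nat[of i] nonpos 0 by simp
    qed (use nat in simp)
  qed
  have fin: "\<psi> (finite_part \<gamma>) = 0" for \<gamma>
  proof (rule additive_bounded_eq_0[where S = "range finite_part"])
    show "bounded (\<psi> ` range finite_part)" using finite_finite_part by (intro finite_imp_bounded) (rule finite_imageI)
    show "a + b \<in> range finite_part" if "a \<in> range finite_part" "b \<in> range finite_part" for a b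
      using that by (auto simp flip: finite_part_add)
  qed (auto simp: add)
  \<comment> \<open>The coefficients of the linear form serve as velocities along the lines
    \<open>X j\<close> and the circles \<open>Z j\<close>.\<close>
  define W where "W t = (\<Sum>j<n. X j (t * \<psi> (real_character_dual (x j) 1))) + (\<Sum>j<k. Z j (t * \<psi> (circle_dual j 1)))"
    for t
  have "W \<in> one_parameter_subgroups"
    unfolding W_def[abs_def] by (intro one_parameter_add one_parameter_sum) (auto intro: X Z)
  moreover have "character \<gamma> (W t) = cis (t * \<psi> \<gamma>)" for \<gamma> t
  proof -
    have fl: "of_int \<lfloor>frequency (Z j) \<gamma>\<rfloor> = frequency (Z j) \<gamma>" if "j < k" for j
      using frequency_Z_Ints[OF that, of \<gamma>] by (auto elim: Ints_cases)
    have "\<psi> \<gamma> = (\<Sum>j<n. \<psi> (real_character_dual (x j) (frequency (X j) \<gamma>)))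
        + (\<Sum>j<k. \<psi> (circle_dual j \<lfloor>frequency (Z j) \<gamma>\<rfloor>))"
      by (subst dual_decomp) (simp add: add real_character_sum[OF \<psi>] y0 fin)
    also have "(\<Sum>j<n. \<psi> (real_character_dual (x j) (frequency (X j) \<gamma>)))
        = (\<Sum>j<n. frequency (X j) \<gamma> * \<psi> (real_character_dual (x j) 1))"
      by (intro sum.cong refl lin x) simp
    also have "(\<Sum>j<k. \<psi> (circle_dual j \<lfloor>frequency (Z j) \<gamma>\<rfloor>))
        = (\<Sum>j<k. frequency (Z j) \<gamma> * \<psi> (circle_dual j 1))"
    proof (intro sum.cong refl)
      fix j assume "j \<in> {..<k}"
      then show "\<psi> (circle_dual j \<lfloor>frequency (Z j) \<gamma>\<rfloor>) = frequency (Z j) \<gamma> * \<psi> (circle_dual j 1)"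
        using z1[of j "\<lfloor>frequency (Z j) \<gamma>\<rfloor>"] fl[of j] by (simp only: lessThan_iff)
    qed
    finally have "\<psi> \<gamma> = (\<Sum>j<n. frequency (X j) \<gamma> * \<psi> (real_character_dual (x j) 1))
        + (\<Sum>j<k. frequency (Z j) \<gamma> * \<psi> (circle_dual j 1))" .
    moreover have "character \<gamma> (W t) = (\<Prod>j<n. cis (t * (frequency (X j) \<gamma> * \<psi> (real_character_dual (x j) 1))))
        * (\<Prod>j<k. cis (t * (frequency (Z j) \<gamma> * \<psi> (circle_dual j 1))))"
      by (simp add: W_def character_add character_sum character_one_parameter[OF X]
          character_one_parameter[OF Z] mult_ac)
    moreover have "(\<Prod>j\<in>J. cis (f j)) = cis (\<Sum>j\<in>J. f j)" for J and f :: "nat \<Rightarrow> real"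
      by (induction J rule: infinite_finite_induct) (auto simp: cis_mult)
    ultimately show ?thesis by (simp add: cis_mult sum_distrib_left distrib_left)
  qed
  ultimately show ?thesis by blast
qed

text \<open>These are the directions in which the group is not compact. In the dual, where Z and T
  change places, the frequencies along \<open>one_parameter_coordinates\<close> have this
  role.\<close>

definition "real_coordinates = map x [0..<n] @ map y [0..<m]"
definition "one_parameter_coordinates = map X [0..<n] @ map Z [0..<k]"

lemma real_coordinates: "set real_coordinates \<subseteq> real_characters"
  by (auto simp: real_coordinates_def x y)

lemma one_parameter_coordinates: "set one_parameter_coordinates \<subseteq> one_parameter_subgroups"
  by (auto simp: one_parameter_coordinates_def X Z)

lemma compact_one_parameter_image:
  assumes "W \<in> one_parameter_subgroups"
  shows "compact (W ` {a..b})"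
  using assms by (intro compact_continuous_image) (auto simp: one_parameter_subgroups_def intro: continuous_on_subset)

lemma finite_bounded_ints: "finite {i :: int. \<bar>real_of_int i\<bar> \<le> N}"
proof -
  have "{i :: int. \<bar>real_of_int i\<bar> \<le> N} \<subseteq> {\<lfloor>- N\<rfloor>..\<lceil>N\<rceil>}" by (auto simp: abs_le_iff le_ceiling_iff) linarith+
  then show ?thesis by (rule finite_subset) simp
qed

text \<open>By \<open>decomp\<close> a point with bounded coordinates is a sum of points of compact
  sets: segments of the lines, finitely many points of each copy of Z, the full circles and the
  finite part.\<close>

lemma real_coordinates_compact:
  "\<exists>K. compact K \<and> {s. \<forall>q\<in>set real_coordinates. \<bar>q s\<bar> \<le> N} \<subseteq> K"
proof -
  let ?A = "{\<Sum>j<n. f j | f. \<forall>j\<in>{..<n}. f j \<in> X j ` {-N..N}}"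
  let ?B = "{\<Sum>j<m. f j | f. \<forall>j\<in>{..<m}. f j \<in> (\<lambda>i. Y j (of_int i)) ` {i. \<bar>real_of_int i\<bar> \<le> N}}"
  let ?C = "{\<Sum>j<k. f j | f. \<forall>j\<in>{..<k}. f j \<in> Z j ` {-pi..pi}}"
  let ?K = "{v + w | v w. v \<in> {v + w | v w. v \<in> {v + w | v w. v \<in> ?A \<and> w \<in> ?B} \<and> w \<in> ?C} \<and> w \<in> F}"
  have "compact ?K"
    by (intro compact_add_sets compact_sum_sets)
      (auto intro!: finite_imp_compact finite_F finite_imageI finite_bounded_ints compact_one_parameter_image X Z)
  moreover have "{s. \<forall>q\<in>set real_coordinates. \<bar>q s\<bar> \<le> N} \<subseteq> ?K"
  proof (rule subsetI)
    fix s assume "s \<in> {s. \<forall>q\<in>set real_coordinates. \<bar>q s\<bar> \<le> N}"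
    then have s: "\<forall>q\<in>set real_coordinates. \<bar>q s\<bar> \<le> N" by simp
    have "(\<Sum>j<n. X j (x j s)) \<in> ?A"
      using s by (force simp: real_coordinates_def)
    moreover have "(\<Sum>j<m. Y j (y j s)) \<in> ?B"
    proof -
      have "Y j (y j s) \<in> (\<lambda>i. Y j (of_int i)) ` {i. \<bar>real_of_int i\<bar> \<le> N}" if "j < m" for j
      proof -
        obtain i where i: "y j s = of_int i" using y_Ints[OF \<open>j < m\<close>] by (rule Ints_cases)
        have "\<bar>y j s\<bar> \<le> N" using s that by (auto simp: real_coordinates_def)
        then show ?thesis using i by auto
      qed
      then show ?thesis by blast
    qed
    moreover have "(\<Sum>j<k. Z j (Arg (z j s))) \<in> ?C"
      using Arg_bounded by (force intro: less_imp_le)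
    ultimately show "s \<in> ?K" using u_F[of s] decomp[of s] by blast
  qed
  ultimately show ?thesis by blast
qed

text \<open>The argument is that for the group with \<open>dual_decomp\<close> in place of
  \<open>decomp\<close>: now the angles belong to Z^m and the bounded integers are the frequencies
  along the circles.\<close>

lemma dual_coordinates_compact:
  "\<exists>K. compact K \<and> {\<gamma>. \<forall>W\<in>set one_parameter_coordinates. \<bar>frequency W \<gamma>\<bar> \<le> N} \<subseteq> K"
proof -
  let ?A = "{\<Sum>j<n. f j | f. \<forall>j\<in>{..<n}. f j \<in> real_character_dual (x j) ` {-N..N}}"
  let ?B = "{\<Sum>j<m. f j | f. \<forall>j\<in>{..<m}. f j \<in> real_character_dual (y j) ` {-pi..pi}}"
  let ?C = "{\<Sum>j<k. f j | f. \<forall>j\<in>{..<k}. f j \<in> circle_dual j ` {i. \<bar>real_of_int i\<bar> \<le> N}}"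
  let ?K = "{v + w | v w. v \<in> {v + w | v w. v \<in> {v + w | v w. v \<in> ?A \<and> w \<in> ?B} \<and> w \<in> ?C} \<and> w \<in> range finite_part}"
  have "compact (real_character_dual q ` {a..b})" if "q \<in> real_characters" for q :: "'g \<Rightarrow> real" and a b
    by (intro compact_continuous_image continuous_on_subset[OF continuous_real_character_dual[OF that]]) auto
  note c = this[OF x] this[OF y]
  have "compact ?K"
    by (intro compact_add_sets compact_sum_sets finite_imp_compact finite_finite_part finite_imageI
        finite_bounded_ints finite_lessThan c) auto
  moreover have "{\<gamma>. \<forall>W\<in>set one_parameter_coordinates. \<bar>frequency W \<gamma>\<bar> \<le> N} \<subseteq> ?K"
  proof (rule subsetI)
    fix \<gamma> :: "'g dual_group"
    assume "\<gamma> \<in> {\<gamma>. \<forall>W\<in>set one_parameter_coordinates. \<bar>frequency W \<gamma>\<bar> \<le> N}"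
    then have g: "\<forall>W\<in>set one_parameter_coordinates. \<bar>frequency W \<gamma>\<bar> \<le> N" by simp
    have "(\<Sum>j<n. real_character_dual (x j) (frequency (X j) \<gamma>)) \<in> ?A"
      using g by (force simp: one_parameter_coordinates_def)
    moreover have "(\<Sum>j<m. real_character_dual (y j) (Arg (character \<gamma> (Y j 1)))) \<in> ?B"
      using Arg_bounded by (force intro: less_imp_le)
    moreover have "(\<Sum>j<k. circle_dual j \<lfloor>frequency (Z j) \<gamma>\<rfloor>) \<in> ?C"
    proof -
      have "\<bar>real_of_int \<lfloor>frequency (Z j) \<gamma>\<rfloor>\<bar> \<le> N" if "j < k" for j
        using frequency_Z_Ints[OF that, of \<gamma>] g that
        by (auto simp: one_parameter_coordinates_def elim!: Ints_cases)
      then show ?thesis by blast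
    qed
    moreover have "finite_part \<gamma> \<in> range finite_part" by simp
    ultimately show "\<gamma> \<in> ?K" using dual_decomp[of \<gamma>] by blast
  qed
  ultimately show ?thesis by blast
qed

end

section \<open>Schwartz functions\<close>

lemma schwartz_continuous: "f \<in> schwartz \<Longrightarrow> continuous_on UNIV f"
  unfolding schwartz_def by (drule CollectD, drule spec[of _ "[]"], drule spec[of _ "[]"]) simp

lemma schwartz_bounded:
  "f \<in> schwartz \<Longrightarrow> set \<phi>s \<subseteq> real_characters \<Longrightarrow>
    bounded (range (\<lambda>s. complex_of_real (\<Prod>\<phi>\<leftarrow>\<phi>s. \<phi> s) * f s))"
  unfolding schwartz_def by (drule CollectD, drule spec[of _ "[]"], drule spec[of _ \<phi>s]) simp

lemma schwartz_differentiable: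
  "f \<in> schwartz \<Longrightarrow> X \<in> one_parameter_subgroups \<Longrightarrow> (\<lambda>t. f (s + X t)) differentiable (at 0)"
  unfolding schwartz_def by (drule CollectD, drule spec[of _ "[]"], drule spec[of _ "[]"]) simp

lemma iterated_derivative_append:
  "iterated_derivative Xs (iterated_derivative Ys f) = iterated_derivative (Xs @ Ys) f"
  by (induction Xs) simp_all

lemma schwartz_derivative:
  fixes f :: "'a::{topological_space,ab_group_add} \<Rightarrow> complex"
  assumes "f \<in> schwartz" "X \<in> one_parameter_subgroups"
  shows "iterated_derivative [X] f \<in> schwartz"
  unfolding schwartz_def
proof (rule CollectI, intro allI impI)
  fix Xs :: "(real \<Rightarrow> 'a) list" and \<phi>s :: "('a \<Rightarrow> real) list" assume "set Xs \<subseteq> one_parameter_subgroups \<and> set \<phi>s \<subseteq> real_characters"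
  then have "set (Xs @ [X]) \<subseteq> one_parameter_subgroups \<and> set \<phi>s \<subseteq> real_characters"
    using assms(2) by simp
  then show "continuous_on UNIV (iterated_derivative Xs (iterated_derivative [X] f)) \<and>
     (\<forall>Xa\<in>one_parameter_subgroups. \<forall>s.
        (\<lambda>t. iterated_derivative Xs (iterated_derivative [X] f) (s + Xa t)) differentiable (at 0)) \<and>
     bounded (range (\<lambda>s. complex_of_real (\<Prod>\<phi>\<leftarrow>\<phi>s. \<phi> s) * iterated_derivative Xs (iterated_derivative [X] f) s))"
    using assms(1) unfolding schwartz_def iterated_derivative_append by blast
qed

text \<open>No formula for iterated derivatives is needed: a class that contains the derivative of
  each member in each direction contains all iterated ones, by uniqueness of derivatives, and the
  other two properties are checked once for the whole class.\<close>

lemma schwartz_coinduct: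
  fixes f :: "'a::{topological_space,ab_group_add} \<Rightarrow> complex"
  assumes "f \<in> S"
    and cont: "\<And>f. f \<in> S \<Longrightarrow> continuous_on UNIV f"
    and diff: "\<And>f X s. f \<in> S \<Longrightarrow> X \<in> one_parameter_subgroups \<Longrightarrow>
      \<exists>g\<in>S. \<forall>s. ((\<lambda>t. f (s + X t)) has_vector_derivative g s) (at 0)"
    and bdd: "\<And>f \<phi>s. f \<in> S \<Longrightarrow> set \<phi>s \<subseteq> real_characters \<Longrightarrow>
      bounded (range (\<lambda>s. complex_of_real (\<Prod>\<phi>\<leftarrow>\<phi>s. \<phi> s) * f s))"
  shows "f \<in> schwartz"
proof -
  have iter: "iterated_derivative Xs f \<in> S" if "set Xs \<subseteq> one_parameter_subgroups" for Xs
    using that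
  proof (induction Xs)
    case Nil
    then show ?case using assms(1) by simp
  next
    case (Cons X Xs)
    then obtain g where g: "g \<in> S"
      "\<And>s. ((\<lambda>t. iterated_derivative Xs f (s + X t)) has_vector_derivative g s) (at 0)"
      using diff[of "iterated_derivative Xs f" X] by auto
    then have "iterated_derivative (X # Xs) f = g"
      by (auto intro!: ext vector_derivative_at)
    then show ?case using g by simp
  qed
  show ?thesis
    unfolding schwartz_def
  proof (rule CollectI, intro allI impI, elim conjE, intro conjI ballI allI)
    fix Xs :: "(real \<Rightarrow> 'a) list" and X :: "real \<Rightarrow> 'a" and \<phi>s :: "('a \<Rightarrow> real) list" and s :: 'a
    assume Xs: "set Xs \<subseteq> one_parameter_subgroups" and \<phi>s: "set \<phi>s \<subseteq> (real_characters :: ('a \<Rightarrow> real) set)"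
    show "continuous_on UNIV (iterated_derivative Xs f)" by (rule cont[OF iter[OF Xs]])
    show "bounded (range (\<lambda>s. complex_of_real (\<Prod>\<phi>\<leftarrow>\<phi>s. \<phi> s) * iterated_derivative Xs f s))"
      by (rule bdd[OF iter[OF Xs] \<phi>s])
    show "(\<lambda>t. iterated_derivative Xs f (s + X t)) differentiable at 0"
      if "X \<in> one_parameter_subgroups"
      using diff[OF iter[OF Xs] that] by (auto intro: differentiableI_vector)
  qed
qed

lemma one_parameter_0:
  "X \<in> one_parameter_subgroups \<Longrightarrow> X 0 = 0"
proof -
  assume "X \<in> one_parameter_subgroups"
  then have "X (0 + 0) = X 0 + X 0" unfolding one_parameter_subgroups_def by blast
  then show ?thesis by simp
qed

lemma schwartz_has_derivative_0:
  assumes "f \<in> schwartz" "X \<in> one_parameter_subgroups"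
  shows "((\<lambda>t. f (s + X t)) has_vector_derivative iterated_derivative [X] f s) (at 0)"
  using schwartz_differentiable[OF assms, of s] by (simp add: vector_derivative_works)

text \<open>By the homomorphism property, moving along X from time t0 amounts to moving from time 0
  at the point s + X t0.\<close>

lemma schwartz_has_derivative:
  assumes f: "f \<in> schwartz" and X: "X \<in> one_parameter_subgroups"
  shows "((\<lambda>t. f (s + X t)) has_vector_derivative iterated_derivative [X] f (s + X t0)) (at t0)"
proof -
  have "((\<lambda>t. t - t0) has_vector_derivative 1) (at t0)"
    by (auto intro!: derivative_eq_intros)
  moreover have "((\<lambda>t. f ((s + X t0) + X t)) has_vector_derivative iterated_derivative [X] f (s + X t0)) (at (t0 - t0))"
    using schwartz_has_derivative_0[OF f X, of "s + X t0"] by simp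
  ultimately have "((\<lambda>t. f ((s + X t0) + X t)) \<circ> (\<lambda>t. t - t0) has_vector_derivative
      1 *\<^sub>R iterated_derivative [X] f (s + X t0)) (at t0)"
    by (rule vector_diff_chain_at)
  moreover have "(s + X t0) + X (t - t0) = s + X t" for t
  proof -
    have "X (t0 + (t - t0)) = X t0 + X (t - t0)" using X unfolding one_parameter_subgroups_def by blast
    then show ?thesis by (simp add: add.assoc)
  qed
  ultimately show ?thesis by (simp add: o_def)
qed

lemma bounded_cmult_range: "bounded (range f) \<Longrightarrow> bounded (range (\<lambda>s. c * f s :: complex))"
  using bounded_linear_image[OF _ bounded_linear_mult_right, of "range f" c] by (simp add: image_image)

lemma schwartz_linear:
  fixes f g :: "'a::{topological_space,ab_group_add} \<Rightarrow> complex"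
  assumes "f \<in> schwartz" "g \<in> schwartz"
  shows "(\<lambda>s. c * f s + g s) \<in> schwartz"
proof (rule schwartz_coinduct[where S = "{(\<lambda>s. c * f s + g s) | f g. f \<in> schwartz \<and> g \<in> schwartz}"])
  show "(\<lambda>s. c * f s + g s) \<in> {(\<lambda>s. c * f s + g s) | f g. f \<in> schwartz \<and> g \<in> schwartz}"
    using assms by blast
next
  fix h :: "'a \<Rightarrow> complex" assume "h \<in> {(\<lambda>s. c * f s + g s) | f g. f \<in> schwartz \<and> g \<in> schwartz}"
  then obtain f g where h: "h = (\<lambda>s. c * f s + g s)" and fg: "f \<in> schwartz" "g \<in> schwartz" by blast
  show "continuous_on UNIV h" unfolding h by (intro continuous_intros schwartz_continuous fg)
  show "bounded (range (\<lambda>s. complex_of_real (\<Prod>\<phi>\<leftarrow>\<phi>s. \<phi> s) * h s))" if \<phi>s: "set \<phi>s \<subseteq> real_characters" for \<phi>s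
  proof -
    have "bounded (range (\<lambda>s. c * (complex_of_real (\<Prod>\<phi>\<leftarrow>\<phi>s. \<phi> s) * f s) + complex_of_real (\<Prod>\<phi>\<leftarrow>\<phi>s. \<phi> s) * g s))"
      by (intro bounded_plus_comp bounded_cmult_range schwartz_bounded fg \<phi>s)
    then show ?thesis by (simp add: h algebra_simps)
  qed
  fix X :: "real \<Rightarrow> 'a" assume X: "X \<in> one_parameter_subgroups"
  show "\<exists>k\<in>{(\<lambda>s. c * f s + g s) | f g. f \<in> schwartz \<and> g \<in> schwartz}.
      \<forall>s. ((\<lambda>t. h (s + X t)) has_vector_derivative k s) (at 0)"
  proof (intro bexI allI)
    show "((\<lambda>t. h (s + X t)) has_vector_derivative
        (c * iterated_derivative [X] f s + iterated_derivative [X] g s)) (at 0)" for s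
      unfolding h by (intro has_vector_derivative_add has_vector_derivative_mult_right schwartz_has_derivative_0 fg X)
    show "(\<lambda>s. c * iterated_derivative [X] f s + iterated_derivative [X] g s)
        \<in> {(\<lambda>s. c * f s + g s) | f g. f \<in> schwartz \<and> g \<in> schwartz}"
      using schwartz_derivative[OF fg(1) X] schwartz_derivative[OF fg(2) X] by blast
  qed
qed

lemma schwartz_zero: "(\<lambda>s. 0) \<in> schwartz"
  by (rule schwartz_coinduct[where S = "{\<lambda>s. 0}"]) (auto simp: bounded_iff)

lemma schwartz_scale: "f \<in> schwartz \<Longrightarrow> (\<lambda>s. c * f s) \<in> schwartz"
  using schwartz_linear[OF _ schwartz_zero, of f c] by simp

lemma schwartz_add: "f \<in> schwartz \<Longrightarrow> g \<in> schwartz \<Longrightarrow> (\<lambda>s. f s + g s) \<in> schwartz"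
  using schwartz_linear[of f g 1] by simp

lemma real_character_one_parameter:
  assumes \<phi>: "\<phi> \<in> real_characters" and X: "X \<in> one_parameter_subgroups"
  shows "\<phi> (s + X t) = \<phi> s + t * \<phi> (X 1)"
proof -
  have "continuous_on UNIV (\<lambda>t. \<phi> (X t))"
    by (rule continuous_on_compose2[of UNIV \<phi>])
      (use \<phi> X in \<open>auto simp: real_characters_def one_parameter_subgroups_def\<close>)
  moreover have "\<phi> (X (a + b)) = \<phi> (X a) + \<phi> (X b)" for a b
    using \<phi> X unfolding real_characters_def one_parameter_subgroups_def by auto
  ultimately have "\<phi> (X t) = t *\<^sub>R \<phi> (X 1)"
    by (intro continuous_additive_linear[where f = "\<lambda>t. \<phi> (X t)"])
  moreover have "\<phi> (s + X t) = \<phi> s + \<phi> (X t)" using \<phi> unfolding real_characters_def by blast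
  ultimately show ?thesis by simp
qed

lemma schwartz_real_character_mult:
  fixes f :: "'a::{topological_space,ab_group_add} \<Rightarrow> complex"
  assumes \<phi>: "\<phi> \<in> real_characters" and "f \<in> schwartz"
  shows "(\<lambda>s. complex_of_real (\<phi> s) * f s) \<in> schwartz"
proof -
  \<comment> \<open>The summand g keeps the class closed under differentiation: besides \<phi> times
    the derivative, the product rule leaves the constant multiple \<phi> (X 1) f.\<close>
  let ?S = "{(\<lambda>s. complex_of_real (\<phi> s) * f s + g s) | f g. f \<in> schwartz \<and> g \<in> schwartz}"
  show ?thesis
  proof (rule schwartz_coinduct[where S = ?S])
    have "(\<lambda>s. complex_of_real (\<phi> s) * f s) = (\<lambda>s. complex_of_real (\<phi> s) * f s + 0)" by simp
    then show "(\<lambda>s. complex_of_real (\<phi> s) * f s) \<in> ?S"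
      using schwartz_zero assms(2) by (intro CollectI exI[of _ f] exI[of _ "\<lambda>_. 0"] conjI) auto
  next
    fix h :: "'a \<Rightarrow> complex" assume "h \<in> ?S"
    then obtain f g where h: "h = (\<lambda>s. complex_of_real (\<phi> s) * f s + g s)" and fg: "f \<in> schwartz" "g \<in> schwartz" by blast
    have "continuous_on UNIV \<phi>" using \<phi> by (simp add: real_characters_def)
    then show "continuous_on UNIV h" unfolding h by (intro continuous_intros schwartz_continuous fg)
    show "bounded (range (\<lambda>s. complex_of_real (\<Prod>\<phi>\<leftarrow>\<phi>s. \<phi> s) * h s))" if \<phi>s: "set \<phi>s \<subseteq> real_characters" for \<phi>s
    proof -
      have "bounded (range (\<lambda>s. complex_of_real (\<Prod>\<phi>\<leftarrow>\<phi> # \<phi>s. \<phi> s) * f s + complex_of_real (\<Prod>\<phi>\<leftarrow>\<phi>s. \<phi> s) * g s))"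
        by (intro bounded_plus_comp schwartz_bounded fg) (use \<phi> \<phi>s in simp_all)
      then show ?thesis by (simp add: h algebra_simps)
    qed
    fix X :: "real \<Rightarrow> 'a" assume X: "X \<in> one_parameter_subgroups"
    show "\<exists>k\<in>?S. \<forall>s. ((\<lambda>t. h (s + X t)) has_vector_derivative k s) (at 0)"
    proof (intro bexI allI)
      fix s
      have "((\<lambda>t. complex_of_real (\<phi> s + t * \<phi> (X 1))) has_vector_derivative complex_of_real (\<phi> (X 1))) (at 0)"
        by (rule has_vector_derivative_of_real) (auto intro!: derivative_eq_intros)
      from has_vector_derivative_mult[OF this schwartz_has_derivative_0[OF fg(1) X, of s]]
      have "((\<lambda>t. complex_of_real (\<phi> s + t * \<phi> (X 1)) * f (s + X t)) has_vector_derivative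
          complex_of_real (\<phi> s) * iterated_derivative [X] f s + complex_of_real (\<phi> (X 1)) * f s) (at 0)"
        by (simp add: one_parameter_0[OF X])
      from has_vector_derivative_add[OF this schwartz_has_derivative_0[OF fg(2) X, of s]]
      show "((\<lambda>t. h (s + X t)) has_vector_derivative
          complex_of_real (\<phi> s) * iterated_derivative [X] f s
            + (complex_of_real (\<phi> (X 1)) * f s + iterated_derivative [X] g s)) (at 0)"
        unfolding h real_character_one_parameter[OF \<phi> X] by (simp add: add.assoc)
    next
      show "(\<lambda>s. complex_of_real (\<phi> s) * iterated_derivative [X] f s
            + (complex_of_real (\<phi> (X 1)) * f s + iterated_derivative [X] g s)) \<in> ?S"
        using schwartz_derivative[OF fg(1) X] schwartz_linear[OF fg(1) schwartz_derivative[OF fg(2) X]]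
        by (intro CollectI exI[of _ "iterated_derivative [X] f"] exI[of _ "\<lambda>s. complex_of_real (\<phi> (X 1)) * f s + iterated_derivative [X] g s"] conjI refl)
    qed
  qed
qed

text \<open>The common majorant: two powers of decay in each coordinate make it integrable on the
  group and summable on locally finite subgroups.\<close>

definition weight :: "('a \<Rightarrow> real) list \<Rightarrow> 'a \<Rightarrow> real"
  where "weight qs s = (\<Prod>q\<leftarrow>qs. 1 / (1 + (q s)\<^sup>2))"

lemma weight_pos: "weight qs s > 0"
  by (induction qs) (auto simp: weight_def add_pos_nonneg intro!: divide_pos_pos mult_pos_pos)

lemma weight_le_1: "weight qs s \<le> 1"
proof (induction qs)
  case (Cons q qs)
  have "1 / (1 + (q s)\<^sup>2) * weight qs s \<le> 1 * 1"
    using Cons weight_pos[of qs s] by (intro mult_mono) (auto simp: divide_le_eq add_pos_nonneg)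
  then show ?case by (simp add: weight_def)
qed (simp add: weight_def)

text \<open>A class closed under sums and under multiplication by the coordinates is closed under
  multiplication by 1 + q^2, hence by the reciprocal of the weight. It serves for Schwartz functions
  and for matrix coefficients alike.\<close>

lemma weight_boundI:
  fixes f :: "'a \<Rightarrow> complex"
  assumes "f \<in> S" and add: "\<And>f g. f \<in> S \<Longrightarrow> g \<in> S \<Longrightarrow> (\<lambda>s. f s + g s) \<in> S"
    and mult: "\<And>f q. f \<in> S \<Longrightarrow> q \<in> set qs \<Longrightarrow> (\<lambda>s. complex_of_real (q s) * f s) \<in> S"
    and bdd: "\<And>f. f \<in> S \<Longrightarrow> bounded (range f)"
  obtains C where "C \<ge> 0" "\<And>s. cmod (f s) \<le> C * weight qs s"
proof -
  have "(\<lambda>s. complex_of_real (\<Prod>q\<leftarrow>qs'. 1 + (q s)\<^sup>2) * f s) \<in> S" if "set qs' \<subseteq> set qs" for qs'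
    using that
  proof (induction qs')
    case (Cons q qs')
    let ?g = "\<lambda>s. complex_of_real (\<Prod>q\<leftarrow>qs'. 1 + (q s)\<^sup>2) * f s"
    have g: "?g \<in> S" using Cons by auto
    have "(\<lambda>s. ?g s + complex_of_real (q s) * (complex_of_real (q s) * ?g s)) \<in> S"
      by (intro add g mult) (use Cons.prems in auto)
    moreover have "(\<lambda>s. ?g s + complex_of_real (q s) * (complex_of_real (q s) * ?g s))
        = (\<lambda>s. complex_of_real (\<Prod>q\<leftarrow>q # qs'. 1 + (q s)\<^sup>2) * f s)"
      by (auto simp: fun_eq_iff algebra_simps power2_eq_square)
    ultimately show ?case by simp
  qed (use assms in simp)
  from bdd[OF this[OF order_refl]]
  obtain C where C: "\<And>s. cmod (complex_of_real (\<Prod>q\<leftarrow>qs. 1 + (q s)\<^sup>2) * f s) \<le> C"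
    by (auto simp: bounded_iff)
  have w: "weight qs s * (\<Prod>q\<leftarrow>qs. 1 + (q s)\<^sup>2) = 1" for s
  proof (induction qs)
    case (Cons q qs)
    have 1: "1 + (q s)\<^sup>2 \<noteq> 0" by (metis add_pos_nonneg less_irrefl zero_le_power2 zero_less_one)
    show ?case using Cons 1 by (simp add: weight_def)
  qed (simp add: weight_def)
  show ?thesis
  proof
    show "C \<ge> 0" using C norm_ge_zero order_trans by blast
    fix s
    let ?P = "\<Prod>q\<leftarrow>qs. 1 + (q s)\<^sup>2"
    have "?P \<ge> 0" using w[of s] weight_pos[of qs s] by (smt (verit) mult_pos_neg)
    then have "cmod (f s) = weight qs s * cmod (complex_of_real ?P * f s)"
      using w[of s] by (simp add: norm_mult mult.assoc[symmetric])
    also have "\<dots> \<le> weight qs s * C" using C[of s] weight_pos[of qs s] by (intro mult_left_mono) auto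
    finally show "cmod (f s) \<le> C * weight qs s" by (simp add: mult.commute)
  qed
qed

lemma schwartz_weight_bound:
  assumes "f \<in> schwartz" "set qs \<subseteq> real_characters"
  obtains C where "C \<ge> 0" "\<And>s. cmod (f s) \<le> C * weight qs s"
proof (rule weight_boundI[where S = schwartz and f = f and qs = qs])
  show "bounded (range g)" if "g \<in> schwartz" for g :: "'a \<Rightarrow> complex"
    using schwartz_bounded[OF that, of "[]"] by simp
qed (use assms that schwartz_add schwartz_real_character_mult in blast)+

section \<open>Integrability of the weight\<close>

lemma weight_Cons: "weight (q # qs) s = 1 / (1 + (q s)\<^sup>2) * weight qs s"
  by (simp add: weight_def)

text \<open>With k the floor of x, k^2 <= (|x| + 1)^2 <= 2 x^2 + 2, and the 4 absorbs the constants.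
  This makes a factor of the weight constant on unit cells.\<close>

lemma inverse_square_floor_le: "1 / (1 + x\<^sup>2) \<le> 4 / (1 + (real_of_int \<lfloor>x\<rfloor>)\<^sup>2)"
proof -
  have "\<bar>real_of_int \<lfloor>x\<rfloor>\<bar> \<le> \<bar>x\<bar> + 1" by linarith
  then have "(real_of_int \<lfloor>x\<rfloor>)\<^sup>2 \<le> (\<bar>x\<bar> + 1)\<^sup>2" by (simp add: abs_le_square_iff[symmetric])
  also have "\<dots> \<le> 2 * x\<^sup>2 + 2"
    using zero_le_power2[of "\<bar>x\<bar> - 1"] by (simp add: power2_eq_square algebra_simps)
  finally have "(real_of_int \<lfloor>x\<rfloor>)\<^sup>2 \<le> 2 * x\<^sup>2 + 2" .
  moreover have "1 + a \<le> 4 * (1 + b)" if "a \<le> 2 * b + 2" "0 \<le> b" for a b :: real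
    using that by simp
  ultimately have "1 + (real_of_int \<lfloor>x\<rfloor>)\<^sup>2 \<le> 4 * (1 + x\<^sup>2)" using zero_le_power2 by blast
  then show ?thesis by (simp add: divide_le_eq le_divide_eq add_pos_nonneg)
qed

definition int_sum :: ennreal
  where "int_sum = (\<integral>\<^sup>+k. ennreal (4 / (1 + (real_of_int k)\<^sup>2)) \<partial>count_space UNIV)"

text \<open>\<open>int_decode\<close> lists the integers so that the n-th has modulus about n/2,
  whence comparison with the series of 1/n^2. The bounds Suc n <= 2 |k| + 2 and (2 (|k| + 1))^2 <= 8
  (1 + k^2) would give the constant 32; 64 is a safe choice.\<close>

lemma int_sum_finite: "int_sum < \<infinity>"
proof -
  have le: "4 / (1 + (real_of_int (int_decode n))\<^sup>2) \<le> 64 * inverse (real (Suc n) ^ 2)" for n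
  proof -
    have "real (Suc n) \<le> 2 * \<bar>real_of_int (int_decode n)\<bar> + 2"
      by (cases "even n") (auto simp: int_decode_def sum_decode_def elim!: evenE oddE)
    also have "\<dots> \<le> 2 * (\<bar>real_of_int (int_decode n)\<bar> + 1)" by simp
    finally have "(real (Suc n))\<^sup>2 \<le> (2 * (\<bar>real_of_int (int_decode n)\<bar> + 1))\<^sup>2"
      by (rule power_mono) simp
    also have "\<dots> \<le> 8 * (1 + (real_of_int (int_decode n))\<^sup>2)"
      using zero_le_power2[of "\<bar>real_of_int (int_decode n)\<bar> - 1"]
      by (simp add: power2_eq_square algebra_simps)
    finally have "(real (Suc n))\<^sup>2 \<le> 8 * (1 + (real_of_int (int_decode n))\<^sup>2)" .
    moreover have "(real (Suc n))\<^sup>2 > 0" "1 + (real_of_int (int_decode n))\<^sup>2 > 0"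
      by (simp_all add: add_pos_nonneg)
    moreover have "4 / b \<le> 64 * inverse a" if "a \<le> 8 * b" "a > 0" "b > 0" for a b :: real
      using that by (simp add: field_simps)
    ultimately show ?thesis by blast
  qed
  have s: "summable (\<lambda>n. 64 * inverse (real (Suc n) ^ 2))"
    by (intro summable_mult, subst summable_Suc_iff) (rule inverse_power_summable, simp)
  have "int_sum = (\<integral>\<^sup>+n. ennreal (4 / (1 + (real_of_int (int_decode n))\<^sup>2)) \<partial>count_space UNIV)"
    unfolding int_sum_def by (rule nn_integral_bij_count_space[symmetric]) (rule bij_int_decode)
  also have "\<dots> = (\<Sum>n. ennreal (4 / (1 + (real_of_int (int_decode n))\<^sup>2)))"
    by (rule nn_integral_count_space_nat)
  also have "\<dots> \<le> (\<Sum>n. ennreal (64 * inverse (real (Suc n) ^ 2)))"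
    by (intro suminf_le ennreal_leI le summableI)
  also have "\<dots> = ennreal (\<Sum>n. 64 * inverse (real (Suc n) ^ 2))"
    by (rule suminf_ennreal2[OF _ s]) simp
  also have "\<dots> < \<infinity>" by simp
  finally show ?thesis .
qed

lemma borel_measurable_weight:
  assumes "\<And>q. q \<in> set qs \<Longrightarrow> q \<in> borel_measurable M"
  shows "weight qs \<in> borel_measurable M"
  using assms
proof (induction qs)
  case (Cons q qs)
  then have [measurable]: "q \<in> borel_measurable M" "weight qs \<in> borel_measurable M" by auto
  show ?case unfolding weight_Cons[abs_def] by measurable
qed (simp add: weight_def[abs_def])

text \<open>The weight is summed over the unit cells \<open>{s. \<lfloor>q\<^sub>i s\<rfloor> = k\<^sub>i}\<close>.\<close>

lemma nn_integral_weight_le: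
  assumes "\<And>q. q \<in> set qs \<Longrightarrow> q \<in> borel_measurable M" and "A \<in> sets M"
    and "\<And>ks :: int list. length ks = length qs \<Longrightarrow>
      emeasure M (A \<inter> {s\<in>space M. \<forall>(q, k)\<in>set (zip qs ks). \<lfloor>q s\<rfloor> = k}) \<le> B"
  shows "(\<integral>\<^sup>+s\<in>A. ennreal (weight qs s) \<partial>M) \<le> B * int_sum ^ length qs"
  using assms
proof (induction qs arbitrary: A)
  case Nil
  have "A \<inter> space M = A" using Nil.prems(2) sets.sets_into_space by auto
  then show ?case using Nil.prems(2) Nil.prems(3)[of "[]"] by (simp add: weight_def)
next
  case (Cons q qs)
  have [measurable]: "q \<in> borel_measurable M" "weight qs \<in> borel_measurable M" "A \<in> sets M"
    using Cons.prems borel_measurable_weight[of qs M] by auto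
  \<comment> \<open>One coordinate is treated per induction step. Only the slice with k = floor (q
    s) contains s, so the sum over k below has a single nonzero term at s; exchanging it with the
    integral leaves the induction hypothesis on each slice.\<close>
  let ?A = "\<lambda>k. A \<inter> {s\<in>space M. \<lfloor>q s\<rfloor> = k}"
  let ?c = "\<lambda>k::int. ennreal (4 / (1 + (real_of_int k)\<^sup>2))"
  have Ak: "?A k \<in> sets M" for k by measurable
  have IH: "(\<integral>\<^sup>+s\<in>?A k. ennreal (weight qs s) \<partial>M) \<le> B * int_sum ^ length qs" for k
  proof (rule Cons.IH)
    fix ks :: "int list" assume "length ks = length qs"
    then have "emeasure M (A \<inter> {s\<in>space M. \<forall>(q, k)\<in>set (zip (q # qs) (k # ks)). \<lfloor>q s\<rfloor> = k}) \<le> B"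
      by (intro Cons.prems(3)) simp
    moreover have "A \<inter> {s\<in>space M. \<forall>(q, k)\<in>set (zip (q # qs) (k # ks)). \<lfloor>q s\<rfloor> = k}
        = ?A k \<inter> {s\<in>space M. \<forall>(q, k)\<in>set (zip qs ks). \<lfloor>q s\<rfloor> = k}" by auto
    ultimately show "emeasure M (?A k \<inter> {s\<in>space M. \<forall>(q, k)\<in>set (zip qs ks). \<lfloor>q s\<rfloor> = k}) \<le> B" by simp
  qed (use Cons.prems Ak in auto)
  have "(\<integral>\<^sup>+s\<in>A. ennreal (weight (q # qs) s) \<partial>M)
      \<le> (\<integral>\<^sup>+s. (\<integral>\<^sup>+k. ?c k * (ennreal (weight qs s) * indicator (?A k) s) \<partial>count_space UNIV) \<partial>M)"
  proof (rule nn_integral_mono)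
    fix s assume s: "s \<in> space M"
    let ?k = "\<lfloor>q s\<rfloor>"
    have "ennreal (weight (q # qs) s) * indicator A s
        \<le> ?c ?k * (ennreal (weight qs s) * indicator (?A ?k) s)"
    proof (cases "s \<in> A")
      case True
      have "weight (q # qs) s \<le> 4 / (1 + (real_of_int ?k)\<^sup>2) * weight qs s"
        unfolding weight_Cons using weight_pos[of qs s]
        by (intro mult_right_mono inverse_square_floor_le) simp
      then show ?thesis using True s weight_pos[of qs s]
        by (simp add: ennreal_mult''[symmetric] ennreal_leI)
    qed simp
    also have "\<dots> = (\<integral>\<^sup>+k. ?c ?k * (ennreal (weight qs s) * indicator (?A ?k) s) * indicator {?k} k \<partial>count_space UNIV)"
      by (simp add: nn_integral_cmult_indicator)
    also have "\<dots> \<le> (\<integral>\<^sup>+k. ?c k * (ennreal (weight qs s) * indicator (?A k) s) \<partial>count_space UNIV)"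
      by (rule nn_integral_mono) (auto simp: indicator_def)
    finally show "ennreal (weight (q # qs) s) * indicator A s
        \<le> (\<integral>\<^sup>+k. ?c k * (ennreal (weight qs s) * indicator (?A k) s) \<partial>count_space UNIV)" .
  qed
  also have "\<dots> = (\<integral>\<^sup>+k. (\<integral>\<^sup>+s. ?c k * (ennreal (weight qs s) * indicator (?A k) s) \<partial>M) \<partial>count_space UNIV)"
    by (rule nn_integral_count_space_nn_integral) auto
  also have "\<dots> = (\<integral>\<^sup>+k. ?c k * (\<integral>\<^sup>+s\<in>?A k. ennreal (weight qs s) \<partial>M) \<partial>count_space UNIV)"
    by (intro nn_integral_cong nn_integral_cmult) measurable
  also have "\<dots> \<le> (\<integral>\<^sup>+k. ?c k * (B * int_sum ^ length qs) \<partial>count_space UNIV)"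
    by (intro nn_integral_mono mult_left_mono IH) simp
  also have "\<dots> = int_sum * (B * int_sum ^ length qs)"
    unfolding int_sum_def by (rule nn_integral_multc) simp
  finally show ?case by (simp add: mult_ac)
qed

text \<open>
  The last two assumptions take the place of Pontryagin duality: \<open>frequency X\<close> for \<open>X \<in> set Ys\<close> are
  coordinates on the dual group, and every real character of the dual is a frequency.
\<close>

locale haar_coordinates =
  fixes \<mu> :: "'g::{topological_ab_group_add,t2_space,second_countable_topology} measure"
    and qs :: "('g \<Rightarrow> real) list" and Ys :: "(real \<Rightarrow> 'g) list"
  assumes haar: "haar_measure \<mu>"
    and qs: "set qs \<subseteq> real_characters" and Ys: "set Ys \<subseteq> one_parameter_subgroups"
    and ex_compact: "\<And>N. \<exists>K. compact K \<and> {s. \<forall>q\<in>set qs. \<bar>q s\<bar> \<le> N} \<subseteq> K"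
    and ex_compact_dual: "\<And>N. \<exists>K. compact K \<and> {\<gamma>. \<forall>X\<in>set Ys. \<bar>frequency X \<gamma>\<bar> \<le> N} \<subseteq> K"
    and ex_one_parameter: "\<And>\<psi> :: 'g dual_group \<Rightarrow> real. \<psi> \<in> real_characters \<Longrightarrow>
      \<exists>X\<in>one_parameter_subgroups. \<forall>\<gamma> t. character \<gamma> (X t) = cis (t * \<psi> \<gamma>)"

lemma haar_coordinates_exist:
  fixes \<mu> :: "'g::{topological_ab_group_add,t2_space,second_countable_topology} measure"
  assumes "elementary_group TYPE('g)" "haar_measure \<mu>"
  obtains qs Ys where "haar_coordinates \<mu> qs Ys"
proof -
  obtain n m k and F :: "'g set" and x y z u X Y Z where "elementary_coordinates n m k F x y z u X Y Z"
    using elementary_group_coordinates[OF assms(1)] by metis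
  then interpret elementary_coordinates n m k F x y z u X Y Z .
  have "haar_coordinates \<mu> real_coordinates one_parameter_coordinates"
    by standard (use assms real_coordinates one_parameter_coordinates real_coordinates_compact
        dual_coordinates_compact dual_real_character in auto)
  then show ?thesis by (rule that)
qed

section \<open>Invariance of Haar measure\<close>

lemma haar_sets: "haar_measure \<mu> \<Longrightarrow> sets \<mu> = sets borel"
  by (simp add: haar_measure_def)

lemma haar_space: "haar_measure \<mu> \<Longrightarrow> space \<mu> = UNIV"
  using sets_eq_imp_space_eq[OF haar_sets, of \<mu>] by simp

lemma haar_borel_measurable: "haar_measure \<mu> \<Longrightarrow> borel_measurable \<mu> = borel_measurable borel"
  using measurable_cong_sets[OF haar_sets refl, of \<mu>] by auto

lemma measurable_translation:
  "(\<lambda>s. t + s :: 'g::topological_ab_group_add) \<in> measurable borel borel"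
  by (intro borel_measurable_continuous_onI continuous_intros)

lemma haar_translate_emeasure:
  fixes \<mu> :: "'g::topological_ab_group_add measure"
  assumes "haar_measure \<mu>" "A \<in> sets borel"
  shows "emeasure \<mu> ((\<lambda>s. t + s) -` A) = emeasure \<mu> A"
proof -
  have "(\<lambda>s. t + s) \<in> measurable \<mu> borel"
    using measurable_translation measurable_cong_sets[OF haar_sets[OF assms(1)] refl] by blast
  then have "emeasure (distr \<mu> borel (\<lambda>s. t + s)) A = emeasure \<mu> ((\<lambda>s. t + s) -` A \<inter> space \<mu>)"
    by (rule emeasure_distr) (rule assms)
  then show ?thesis using assms by (simp add: haar_measure_def haar_space[OF assms(1)])
qed

lemma haar_translate_nn_integral:
  fixes \<mu> :: "'g::topological_ab_group_add measure"
  assumes "haar_measure \<mu>" "f \<in> borel_measurable borel"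
  shows "(\<integral>\<^sup>+s. f (t + s) \<partial>\<mu>) = (\<integral>\<^sup>+s. f s \<partial>\<mu>)"
proof -
  have m: "(\<lambda>s. t + s) \<in> measurable \<mu> borel"
    using measurable_translation measurable_cong_sets[OF haar_sets[OF assms(1)] refl] by blast
  have "(\<integral>\<^sup>+s. f s \<partial>distr \<mu> borel (\<lambda>s. t + s)) = (\<integral>\<^sup>+s. f (t + s) \<partial>\<mu>)"
    by (rule nn_integral_distr[OF m]) (use assms(2) in simp)
  then show ?thesis using assms(1) by (simp add: haar_measure_def)
qed

lemma haar_translate_integrable:
  fixes \<mu> :: "'g::topological_ab_group_add measure" and f :: "'g \<Rightarrow> 'b::{banach,second_countable_topology}"
  assumes "haar_measure \<mu>" "integrable \<mu> f"
  shows "integrable \<mu> (\<lambda>s. f (t + s))"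
proof -
  have m: "(\<lambda>s. t + s) \<in> measurable \<mu> borel"
    using measurable_translation measurable_cong_sets[OF haar_sets[OF assms(1)] refl] by blast
  have "f \<in> borel_measurable borel" using assms haar_borel_measurable by (metis borel_measurable_integrable)
  then show ?thesis
    using integrable_distr_eq[OF m, of f] assms by (simp add: haar_measure_def)
qed

lemma real_character_diff: "q \<in> real_characters \<Longrightarrow> q (s - t) = q s - q t"
proof -
  assume "q \<in> real_characters"
  then have "q ((s - t) + t) = q (s - t) + q t" unfolding real_characters_def by blast
  then show ?thesis by simp
qed

lemma real_character_0: "q \<in> real_characters \<Longrightarrow> q 0 = 0"
  using real_character_diff[of q 0 0] by simp

context haar_coordinates
begin

lemma sets_haar [measurable_cong, simp]: "sets \<mu> = sets borel" by (rule haar_sets[OF haar])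
lemma space_haar [simp]: "space \<mu> = UNIV" by (rule haar_space[OF haar])

lemma real_character_measurable: "q \<in> real_characters \<Longrightarrow> (q :: 'g \<Rightarrow> real) \<in> borel_measurable borel"
  by (rule borel_measurable_continuous_onI) (simp add: real_characters_def)

lemma qs_measurable: "q \<in> set qs \<Longrightarrow> q \<in> borel_measurable borel"
  using qs real_character_measurable by blast

lemma weight_measurable [measurable]: "weight qs \<in> borel_measurable borel"
  by (rule borel_measurable_weight) (rule qs_measurable)

lemma continuous_weight: "continuous_on UNIV (weight qs)"
proof -
  have "continuous_on UNIV (\<lambda>s. \<Prod>q\<leftarrow>qs'. 1 / (1 + (q s)\<^sup>2))" if "set qs' \<subseteq> real_characters"
    for qs' :: "('g \<Rightarrow> real) list"
    using that
  proof (induction qs')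
    case (Cons q qs')
    have "1 + (q s)\<^sup>2 \<noteq> 0" for s by (metis add_pos_nonneg less_irrefl zero_le_power2 zero_less_one)
    moreover have "continuous_on UNIV q" using Cons.prems by (simp add: real_characters_def)
    ultimately show ?case using Cons by (auto intro!: continuous_intros)
  qed simp
  from this[OF qs] show ?thesis by (simp add: weight_def[abs_def])
qed

text \<open>Two points of a unit cell differ by at most 1 in each coordinate, so the cell lies in a
  translate of the compact set belonging to N = 1, and invariance bounds the measure of every cell
  by that of K.\<close>

lemma weight_integrable: "integrable \<mu> (weight qs)"
proof -
  obtain K where K: "compact K" "{s. \<forall>q\<in>set qs. \<bar>q s\<bar> \<le> 1} \<subseteq> K" using ex_compact by blast
  have Kb: "K \<in> sets borel" by (rule borel_closed[OF compact_imp_closed[OF K(1)]])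
  have "emeasure \<mu> (UNIV \<inter> {s\<in>space \<mu>. \<forall>(q, k)\<in>set (zip qs ks). \<lfloor>q s\<rfloor> = k}) \<le> emeasure \<mu> K"
    if l: "length ks = length qs" for ks
  proof -
    let ?C = "UNIV \<inter> {s\<in>space \<mu>. \<forall>(q, k)\<in>set (zip qs ks). \<lfloor>q s\<rfloor> = k}"
    show ?thesis
    proof (cases "?C = {}")
      case True
      show ?thesis unfolding True by simp
    next
      case False
      then obtain s0 where s0: "s0 \<in> ?C" by blast
      have "?C \<subseteq> (\<lambda>s. - s0 + s) -` K"
      proof
        fix s assume s: "s \<in> ?C"
        have "\<bar>q (s - s0)\<bar> \<le> 1" if "q \<in> set qs" for q
        proof -
          obtain i where i: "i < length qs" "q = qs ! i" using \<open>q \<in> set qs\<close> by (auto simp: in_set_conv_nth)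
          then have "(q, ks ! i) \<in> set (zip qs ks)" using l by (auto simp: set_zip)
          then have "\<lfloor>q s\<rfloor> = ks ! i" "\<lfloor>q s0\<rfloor> = ks ! i" using s s0 by auto
          moreover have "q (s - s0) = q s - q s0" using that qs by (intro real_character_diff) auto
          ultimately show ?thesis by linarith
        qed
        then show "s \<in> (\<lambda>s. - s0 + s) -` K" using K by auto
      qed
      then have "emeasure \<mu> ?C \<le> emeasure \<mu> ((\<lambda>s. - s0 + s) -` K)"
        by (rule emeasure_mono) (use measurable_sets[OF measurable_translation Kb, of "- s0"] in simp)
      then show ?thesis unfolding haar_translate_emeasure[OF haar Kb] .
    qed
  qed
  then have "(\<integral>\<^sup>+s\<in>UNIV. ennreal (weight qs s) \<partial>\<mu>) \<le> emeasure \<mu> K * int_sum ^ length qs"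
    by (intro nn_integral_weight_le) (use qs_measurable in auto)
  also have "\<dots> < \<infinity>"
    using haar K(1) int_sum_finite by (auto simp: haar_measure_def ennreal_mult_less_top power_less_top_ennreal)
  finally have "(\<integral>\<^sup>+s. ennreal (weight qs s) \<partial>\<mu>) < \<infinity>" by simp
  then show ?thesis
    by (intro integrableI_bounded) (use weight_pos less_imp_le in \<open>simp_all add: abs_of_pos weight_pos\<close>)
qed

text \<open>The weight is at most 1 and so dominates its own square; one integrability statement
  thus gives both L1 and L2.\<close>

lemma weight_dominated:
  fixes f :: "'g \<Rightarrow> complex"
  assumes "f \<in> borel_measurable borel" "\<And>s. cmod (f s) \<le> C * weight qs s"
  shows "f \<in> L1_space \<mu>" "f \<in> L2_space \<mu>"
proof -
  have f[measurable]: "f \<in> borel_measurable \<mu>" using assms(1) by simp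
  have C: "0 \<le> C" using order_trans[OF norm_ge_zero assms(2)] weight_pos[of qs]
    by (metis less_le_not_le linorder_not_le mult_less_0_iff)
  show "f \<in> L1_space \<mu>" unfolding L1_space_def
    by (intro CollectI Bochner_Integration.integrable_bound[OF integrable_mult_right[OF weight_integrable, of C]] f)
      (use assms(2) C in \<open>simp add: abs_mult abs_of_pos[OF weight_pos]\<close>)
  have "(cmod (f s))\<^sup>2 \<le> C\<^sup>2 * weight qs s" for s
  proof -
    have "(cmod (f s))\<^sup>2 \<le> (C * weight qs s)\<^sup>2" by (intro power_mono assms) simp
    also have "\<dots> = C\<^sup>2 * (weight qs s * weight qs s)" by (simp add: power2_eq_square)
    also have "\<dots> \<le> C\<^sup>2 * (weight qs s * 1)"
      by (intro mult_left_mono weight_le_1) (auto intro: less_imp_le[OF weight_pos])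
    finally show ?thesis by simp
  qed
  then have "integrable \<mu> (\<lambda>s. (cmod (f s))\<^sup>2)"
    by (intro Bochner_Integration.integrable_bound[OF integrable_mult_right[OF weight_integrable, of "C\<^sup>2"]])
      (simp_all add: abs_mult abs_of_pos[OF weight_pos])
  then show "f \<in> L2_space \<mu>" by (simp add: L2_space_def)
qed

lemma schwartz_measurable: "f \<in> schwartz \<Longrightarrow> (f :: 'g \<Rightarrow> complex) \<in> borel_measurable borel"
  by (intro borel_measurable_continuous_onI schwartz_continuous)

lemma schwartz_L1: "f \<in> schwartz \<Longrightarrow> f \<in> L1_space \<mu>"
  and schwartz_L2: "f \<in> schwartz \<Longrightarrow> f \<in> L2_space \<mu>"
  using schwartz_weight_bound[OF _ qs] weight_dominated[OF schwartz_measurable] by metis+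

lemma schwartz_integrable: "f \<in> schwartz \<Longrightarrow> integrable \<mu> f"
  using schwartz_L1 by (simp add: L1_space_def)

end

section \<open>The Fourier transform of Schwartz functions\<close>

lemma character_measurable: "character \<gamma> \<in> borel_measurable borel"
  by (rule borel_measurable_continuous_onI[OF continuous_character])

lemma continuous_evaluation: "continuous_on UNIV (\<lambda>\<gamma>. character \<gamma> s)"
proof -
  have "((\<lambda>\<gamma>. character \<gamma> s) \<longlongrightarrow> character \<gamma>0 s) (nhds \<gamma>0)" for \<gamma>0 :: "'a dual_group"
  proof (rule tendstoI)
    fix e :: real assume "e > 0"
    from eventually_nhds_dual_group[OF compact_sing[of s] this]
    show "eventually (\<lambda>\<gamma>. dist (character \<gamma> s) (character \<gamma>0 s) < e) (nhds \<gamma>0)"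
      by (simp add: dist_norm)
  qed
  then show ?thesis
    unfolding continuous_on_def using filterlim_mono[OF _ order_refl at_within_le_nhds] by blast
qed

lemma integrable_mult_character:
  assumes "haar_measure \<mu>" "integrable \<mu> f"
  shows "integrable \<mu> (\<lambda>s. f s * cnj (character \<gamma> s))"
proof (rule Bochner_Integration.integrable_bound[OF assms(2)])
  have [measurable]: "character \<gamma> \<in> borel_measurable \<mu>"
    using character_measurable by (simp only: haar_borel_measurable[OF assms(1)])
  have [measurable]: "f \<in> borel_measurable \<mu>" using assms(2) by simp
  show "(\<lambda>s. f s * cnj (character \<gamma> s)) \<in> borel_measurable \<mu>" by measurable
qed (simp add: norm_mult)

lemma fourier_bound:
  assumes "haar_measure \<mu>" "integrable \<mu> f"
  shows "cmod (fourier \<mu> f \<gamma>) \<le> (\<integral>s. cmod (f s) \<partial>\<mu>)"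
proof -
  have "cmod (fourier \<mu> f \<gamma>) \<le> (\<integral>s. cmod (f s * cnj (character \<gamma> s)) \<partial>\<mu>)"
    unfolding fourier_def by (rule integral_norm_bound)
  then show ?thesis by (simp add: norm_mult)
qed

lemma fourier_add:
  assumes "haar_measure \<mu>" "integrable \<mu> f" "integrable \<mu> g"
  shows "fourier \<mu> (\<lambda>s. f s + g s) \<gamma> = fourier \<mu> f \<gamma> + fourier \<mu> g \<gamma>"
  unfolding fourier_def distrib_right
  by (intro Bochner_Integration.integral_add integrable_mult_character assms)

lemma fourier_scale: "fourier \<mu> (\<lambda>s. c * f s) \<gamma> = c * fourier \<mu> f \<gamma>"
  unfolding fourier_def mult.assoc by simp

lemma fourier_translate:
  assumes "haar_measure \<mu>" "f \<in> borel_measurable borel"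
  shows "fourier \<mu> (\<lambda>s. f (s + t)) \<gamma> = character \<gamma> t * fourier \<mu> f \<gamma>"
proof -
  have [measurable]: "character \<gamma> \<in> borel_measurable borel" "f \<in> borel_measurable borel"
    using character_measurable assms(2) by auto
  have "(\<lambda>s. f s * (cnj (character \<gamma> s) * character \<gamma> t)) \<in> borel_measurable \<mu>"
    unfolding haar_borel_measurable[OF assms(1)] by measurable
  from haar_integral_translate[OF assms(1) this, of t]
  have "(\<integral>s. f (t + s) * (cnj (character \<gamma> (t + s)) * character \<gamma> t) \<partial>\<mu>)
      = (\<integral>s. f s * (cnj (character \<gamma> s) * character \<gamma> t) \<partial>\<mu>)" .
  moreover have "cnj (character \<gamma> (t + s)) * character \<gamma> t = cnj (character \<gamma> s)" for s
  proof -
    have "character \<gamma> t * cnj (character \<gamma> t) = 1"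
      using norm_character[of \<gamma> t] by (simp add: complex_norm_square[symmetric])
    then show ?thesis by (simp add: character_add mult_ac)
  qed
  moreover have "(\<integral>s. f s * (cnj (character \<gamma> s) * character \<gamma> t) \<partial>\<mu>)
      = (\<integral>s. character \<gamma> t * (f s * cnj (character \<gamma> s)) \<partial>\<mu>)" by (simp add: mult_ac)
  ultimately show ?thesis unfolding fourier_def by (simp add: add.commute)
qed

lemma has_vector_derivative_quadratic_errorI:
  fixes F :: "real \<Rightarrow> 'b::real_normed_vector"
  assumes "\<And>t. norm (F t - F 0 - t *\<^sub>R D) \<le> C * t\<^sup>2"
  shows "(F has_vector_derivative D) (at 0)"
proof -
  have "(\<lambda>h. norm (F (0 + h) - F 0 - h *\<^sub>R D) / norm h) \<midarrow>0\<rightarrow> 0"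
  proof (rule tendsto_sandwich[OF _ _ tendsto_const])
    show "\<forall>\<^sub>F h in at 0. norm (F (0 + h) - F 0 - h *\<^sub>R D) / norm h \<le> C * \<bar>h\<bar>"
    proof (rule eventually_at_filter[THEN iffD2], intro always_eventually allI impI)
      fix h :: real assume "h \<noteq> 0"
      then show "norm (F (0 + h) - F 0 - h *\<^sub>R D) / norm h \<le> C * \<bar>h\<bar>"
        using assms[of h] by (simp add: divide_le_eq power2_eq_square mult.assoc)
    qed
    have "((\<lambda>h::real. C * \<bar>h\<bar>) \<longlongrightarrow> C * \<bar>0\<bar>) (at 0)" by (intro tendsto_intros)
    then show "((\<lambda>h::real. C * \<bar>h\<bar>) \<longlongrightarrow> 0) (at 0)" by simp
  qed auto
  then show ?thesis
    unfolding has_vector_derivative_def has_derivative_at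
    by (simp add: bounded_linear_scaleR_left)
qed

text \<open>The integrand is expanded in t to first order. The remainder is at most t^2 \<phi>^2
  |f|, so integrability of \<phi>^2 f makes the error of the integral quadratic in t.\<close>

lemma fourier_has_derivative:
  assumes haar: "haar_measure \<mu>" and X: "\<And>t s. character (X t) s = cis (t * \<phi> s)"
    and i0: "integrable \<mu> f" and i1: "integrable \<mu> (\<lambda>s. complex_of_real (\<phi> s) * f s)"
    and i2: "integrable \<mu> (\<lambda>s. complex_of_real (\<phi> s) * (complex_of_real (\<phi> s) * f s))"
  shows "((\<lambda>t. fourier \<mu> f (\<gamma> + X t)) has_vector_derivative
      - \<i> * fourier \<mu> (\<lambda>s. complex_of_real (\<phi> s) * f s) \<gamma>) (at 0)"
proof (rule has_vector_derivative_quadratic_errorI)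
  fix t
  let ?u = "\<lambda>s. f s * cnj (character \<gamma> s)"
  let ?C = "\<integral>s. cmod (complex_of_real (\<phi> s) * (complex_of_real (\<phi> s) * f s)) \<partial>\<mu>"
  let ?e = "\<lambda>s. f s * cnj (character (\<gamma> + X t) s) - ?u s - (- \<i> * t * (complex_of_real (\<phi> s) * f s * cnj (character \<gamma> s)))"
  have "fourier \<mu> f (\<gamma> + X t) - fourier \<mu> f (\<gamma> + X 0)
      - t *\<^sub>R (- \<i> * fourier \<mu> (\<lambda>s. complex_of_real (\<phi> s) * f s) \<gamma>)
      = (\<integral>s. f s * cnj (character (\<gamma> + X t) s) \<partial>\<mu>) - (\<integral>s. ?u s \<partial>\<mu>)
        - (\<integral>s. - \<i> * t * (complex_of_real (\<phi> s) * f s * cnj (character \<gamma> s)) \<partial>\<mu>)"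
    by (simp add: fourier_def character_plus_dual X scaleR_conv_of_real)
  also have "\<dots> = (\<integral>s. ?e s \<partial>\<mu>)"
    by (simp only: Bochner_Integration.integral_diff[symmetric] i0 i1
        Bochner_Integration.integrable_diff integrable_mult_right integrable_mult_character[OF haar])
  also have "cmod \<dots> \<le> (\<integral>s. t\<^sup>2 * cmod (complex_of_real (\<phi> s) * (complex_of_real (\<phi> s) * f s)) \<partial>\<mu>)"
  proof (rule order_trans[OF integral_norm_bound], rule integral_mono)
    fix s
    have "?e s
        = ?u s * (cis (- t * \<phi> s) - 1 - \<i> * of_real (- t * \<phi> s))"
      by (simp add: character_plus_dual X cis_cnj algebra_simps)
    then have "cmod (?e s)
        = cmod (f s) * cmod (cis (- t * \<phi> s) - 1 - \<i> * of_real (- t * \<phi> s))"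
      by (simp only: norm_mult complex_mod_cnj norm_character mult_1_right)
    also have "\<dots> \<le> cmod (f s) * (- t * \<phi> s)\<^sup>2"
      by (intro mult_left_mono norm_cis_diff_linear_le) simp
    also have "\<dots> = t\<^sup>2 * cmod (complex_of_real (\<phi> s) * (complex_of_real (\<phi> s) * f s))"
    proof -
      have "(- t * \<phi> s)\<^sup>2 = t\<^sup>2 * (\<bar>\<phi> s\<bar> * \<bar>\<phi> s\<bar>)" by (simp add: power2_eq_square)
      then show ?thesis by (simp only: norm_mult norm_of_real mult_ac)
    qed
    finally show "cmod (?e s)
       \<le> t\<^sup>2 * cmod (complex_of_real (\<phi> s) * (complex_of_real (\<phi> s) * f s))" .
  qed (intro integrable_norm Bochner_Integration.integrable_diff integrable_mult_right integrable_mult_character[OF haar] i0 i1 i2)+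
  also have "\<dots> = ?C * t\<^sup>2" by simp
  finally show "cmod (fourier \<mu> f (\<gamma> + X t) - fourier \<mu> f (\<gamma> + X 0)
      - t *\<^sub>R (- \<i> * fourier \<mu> (\<lambda>s. complex_of_real (\<phi> s) * f s) \<gamma>)) \<le> ?C * t\<^sup>2" .
qed

text \<open>Integration by parts through difference quotients: translating h by Y t multiplies its
  transform by cis (t a), so the difference quotient of the phase times the transform of h is the
  transform of the difference quotient of h. The first quotient tends to i a; the second is handled
  by dominated convergence with majorant w, which the mean value inequality justifies.\<close>

lemma fourier_derivative:
  assumes haar: "haar_measure \<mu>" and Y: "\<And>t. character \<gamma> (Y t) = cis (t * a)" and Y0: "Y 0 = 0"
    and h: "integrable \<mu> h" and h': "h' \<in> borel_measurable borel"
    and w: "integrable \<mu> w"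
    and deriv: "\<And>s t. ((\<lambda>t. h (s + Y t)) has_vector_derivative h' (s + Y t)) (at t)"
    and bound: "\<And>s t. \<bar>t\<bar> \<le> 1 \<Longrightarrow> cmod (h' (s + Y t)) \<le> w s"
  shows "complex_of_real a * fourier \<mu> h \<gamma> = - \<i> * fourier \<mu> h' \<gamma>"
proof -
  \<comment> \<open>Step sizes in (0, 1], the range in which \<open>bound\<close> can be
    applied.\<close>
  define t where "t n = inverse (real (Suc n))" for n
  have t: "t n > 0" "t n \<le> 1" for n by (auto simp: t_def inverse_le_1_iff)
  have t0: "t \<longlonglongrightarrow> 0" unfolding t_def by (rule LIMSEQ_inverse_real_of_nat)
  have hb: "h \<in> borel_measurable borel"
    using borel_measurable_integrable[OF h] by (simp only: haar_borel_measurable[OF haar])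
  have quot: "((\<lambda>n. (g (t n) - g 0) /\<^sub>R t n) \<longlonglongrightarrow> d)"
    if "(g has_vector_derivative d) (at 0)" for g :: "real \<Rightarrow> complex" and d
  proof -
    have "(\<lambda>h. norm (g (0 + h) - g 0 - h *\<^sub>R d) / norm h) \<midarrow>0\<rightarrow> 0"
      using that unfolding has_vector_derivative_def has_derivative_at by blast
    moreover have "filterlim t (at 0) sequentially"
      unfolding filterlim_at using t0 t(1) by (auto simp: less_imp_neq[symmetric])
    ultimately have "(\<lambda>n. norm (g (0 + t n) - g 0 - t n *\<^sub>R d) / norm (t n)) \<longlonglongrightarrow> 0"
      by (rule filterlim_compose)
    moreover have "norm (g (0 + t n) - g 0 - t n *\<^sub>R d) / norm (t n) = norm ((g (t n) - g 0) /\<^sub>R t n - d)" for n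
    proof -
      have "(g (t n) - g 0) /\<^sub>R t n - d = (g (0 + t n) - g 0 - t n *\<^sub>R d) /\<^sub>R t n"
        using t(1)[of n] by (simp add: scaleR_diff_right)
      then show ?thesis by (simp add: divide_inverse mult.commute)
    qed
    ultimately have "(\<lambda>n. norm ((g (t n) - g 0) /\<^sub>R t n - d)) \<longlonglongrightarrow> 0" by simp
    then show ?thesis by (rule LIM_zero_cancel[OF tendsto_norm_zero_cancel])
  qed
  let ?d = "\<lambda>n s. (h (s + Y (t n)) - h s) /\<^sub>R t n"
  have ih: "integrable \<mu> (\<lambda>s. h (s + Y x))" for x
    using haar_translate_integrable[OF haar h, of "Y x"] by (simp add: add.commute)
  have lim1: "(\<lambda>n. \<integral>s. ?d n s * cnj (character \<gamma> s) \<partial>\<mu>) \<longlonglongrightarrow> (\<integral>s. h' s * cnj (character \<gamma> s) \<partial>\<mu>)"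
  proof (rule integral_dominated_convergence[where w = w])
    have [measurable]: "character \<gamma> \<in> borel_measurable \<mu>" "h' \<in> borel_measurable \<mu>"
      using character_measurable h' by (simp_all only: haar_borel_measurable[OF haar])
    have [measurable]: "h \<in> borel_measurable \<mu>" using h by simp
    have [measurable]: "(\<lambda>s. h (s + Y x)) \<in> borel_measurable \<mu>" for x using ih by (rule borel_measurable_integrable)
    show "(\<lambda>s. h' s * cnj (character \<gamma> s)) \<in> borel_measurable \<mu>" by measurable
    show "(\<lambda>s. ?d n s * cnj (character \<gamma> s)) \<in> borel_measurable \<mu>" for n by measurable
    show "integrable \<mu> w" by (rule w)
    show "AE s in \<mu>. (\<lambda>n. ?d n s * cnj (character \<gamma> s)) \<longlonglongrightarrow> h' s * cnj (character \<gamma> s)"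
    proof (intro AE_I2 tendsto_mult tendsto_const)
      fix s
      show "(\<lambda>n. ?d n s) \<longlonglongrightarrow> h' s"
        using quot[OF deriv[of s 0, unfolded Y0 add_0_right]] by (simp add: Y0)
    qed
    show "AE s in \<mu>. cmod (?d n s * cnj (character \<gamma> s)) \<le> w s" for n
    proof (rule AE_I2)
      fix s
      have "norm (h (s + Y (t n)) - h (s + Y 0)) \<le> w s * norm (t n - 0)"
      proof (rule differentiable_bound[where S = "{0..1}"])
        fix x :: real assume x: "x \<in> {0..1}"
        show "((\<lambda>t. h (s + Y t)) has_derivative (\<lambda>k. k *\<^sub>R h' (s + Y x))) (at x within {0..1})"
          using has_vector_derivative_at_within[OF deriv] by (simp add: has_vector_derivative_def)
        show "onorm (\<lambda>k. k *\<^sub>R h' (s + Y x)) \<le> w s"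
          using bound[of x s] x by (intro onorm_le) (simp add: mult.commute mult_left_mono)
      qed (use t[of n] in auto)
      then have "cmod (h (s + Y (t n)) - h s) \<le> w s * t n" using t[of n] by (simp add: Y0)
      then have "cmod (h (s + Y (t n)) - h s) / t n \<le> w s" using t[of n] by (simp add: divide_le_eq)
      moreover have "cmod (?d n s * cnj (character \<gamma> s)) = cmod (h (s + Y (t n)) - h s) / t n"
        using t(1)[of n] by (simp only: norm_mult norm_scaleR complex_mod_cnj norm_character) (simp add: divide_inverse mult.commute)
      ultimately show "cmod (?d n s * cnj (character \<gamma> s)) \<le> w s" by simp
    qed
  qed
  have eq: "(\<integral>s. ?d n s * cnj (character \<gamma> s) \<partial>\<mu>) = ((cis (t n * a) - cis (0 * a)) /\<^sub>R t n) * fourier \<mu> h \<gamma>" for n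
  proof -
    have "?d n s * cnj (character \<gamma> s) = inverse (complex_of_real (t n)) *
        (h (s + Y (t n)) * cnj (character \<gamma> s) - h s * cnj (character \<gamma> s))" for s
      by (simp add: scaleR_conv_of_real algebra_simps)
    then have "(\<integral>s. ?d n s * cnj (character \<gamma> s) \<partial>\<mu>) =
        inverse (complex_of_real (t n)) * (fourier \<mu> (\<lambda>s. h (s + Y (t n))) \<gamma> - fourier \<mu> h \<gamma>)"
      by (simp add: fourier_def Bochner_Integration.integral_diff[OF integrable_mult_character[OF haar ih]
            integrable_mult_character[OF haar h]])
    then show ?thesis
      by (simp add: fourier_translate[OF haar hb] Y scaleR_conv_of_real algebra_simps)
  qed
  have "(\<lambda>n. (cis (t n * a) - cis (0 * a)) /\<^sub>R t n) \<longlonglongrightarrow> a *\<^sub>R (\<i> * cis (0 * a))"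
    by (rule quot[OF has_vector_derivative_cis])
  then have "(\<lambda>n. ((cis (t n * a) - cis (0 * a)) /\<^sub>R t n) * fourier \<mu> h \<gamma>) \<longlonglongrightarrow> (a *\<^sub>R (\<i> * cis (0 * a))) * fourier \<mu> h \<gamma>"
    by (rule tendsto_mult[OF _ tendsto_const])
  then have "(a *\<^sub>R (\<i> * cis (0 * a))) * fourier \<mu> h \<gamma> = fourier \<mu> h' \<gamma>"
    unfolding fourier_def[of _ h'] by (rule LIMSEQ_unique[OF _ lim1[unfolded eq]])
  then have "\<i> * (complex_of_real a * fourier \<mu> h \<gamma>) = fourier \<mu> h' \<gamma>"
    by (simp add: scaleR_conv_of_real mult_ac)
  then have "- \<i> * (\<i> * (complex_of_real a * fourier \<mu> h \<gamma>)) = - \<i> * fourier \<mu> h' \<gamma>" by simp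
  then show ?thesis by simp
qed

text \<open>For |t| <= 1 the translation changes q by a number c of modulus at most |q (X 1)|, and
  x^2 <= 2 (x + c)^2 + 2 c^2 shows that each factor grows at most by 2 (1 + (q (X 1))^2).\<close>

lemma weight_translate_le:
  fixes qs :: "('g::{topological_space,ab_group_add} \<Rightarrow> real) list"
  assumes "set qs \<subseteq> real_characters" "X \<in> one_parameter_subgroups"
  obtains C where "C \<ge> 0" "\<And>s t. \<bar>t\<bar> \<le> 1 \<Longrightarrow> weight qs (s + X t) \<le> C * weight qs s"
proof -
  have "\<exists>C\<ge>0. \<forall>s t. \<bar>t\<bar> \<le> 1 \<longrightarrow> weight qs (s + X t) \<le> C * weight qs s"
    using assms(1)
  proof (induction qs)
    case Nil
    show ?case by (intro exI[of _ 1]) (simp add: weight_def)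
  next
    case (Cons q qs)
    then obtain C where C: "C \<ge> 0" "\<And>s t. \<bar>t\<bar> \<le> 1 \<Longrightarrow> weight qs (s + X t) \<le> C * weight qs s" by auto
    let ?b = "q (X 1)"
    have *: "1 / (1 + (x + c)\<^sup>2) \<le> 2 * (1 + b\<^sup>2) * (1 / (1 + x\<^sup>2))" if "\<bar>c\<bar> \<le> \<bar>b\<bar>" for x b c :: real
    proof -
      have "x\<^sup>2 \<le> 2 * (x + c)\<^sup>2 + 2 * c\<^sup>2"
        using zero_le_power2[of "x + 2 * c"] by (simp add: power2_eq_square algebra_simps)
      moreover have "c\<^sup>2 \<le> b\<^sup>2" using that by (simp add: abs_le_square_iff)
      moreover have "0 \<le> b\<^sup>2 * (x + c)\<^sup>2" "0 \<le> (x + c)\<^sup>2" "0 \<le> b\<^sup>2" by simp_all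
      moreover have "2 * (1 + b\<^sup>2) * (1 + (x + c)\<^sup>2) = 2 + 2 * (x + c)\<^sup>2 + 2 * b\<^sup>2 + 2 * (b\<^sup>2 * (x + c)\<^sup>2)"
        by (simp add: algebra_simps)
      ultimately have "1 + x\<^sup>2 \<le> 2 * (1 + b\<^sup>2) * (1 + (x + c)\<^sup>2)" by linarith
      moreover have "1 / v \<le> k * (1 / u)" if "u \<le> k * v" "u > 0" "v > 0" for u v k :: real
        using that by (simp add: field_simps)
      ultimately show ?thesis by (simp add: add_pos_nonneg)
    qed
    show ?case
    proof (intro exI[of _ "2 * (1 + ?b\<^sup>2) * C"] conjI allI impI)
      fix s :: 'g and t :: real assume t: "\<bar>t\<bar> \<le> 1"
      have "\<bar>t * ?b\<bar> \<le> \<bar>?b\<bar>" using t by (simp add: abs_mult mult_left_le_one_le)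
      then have "1 / (1 + (q (s + X t))\<^sup>2) \<le> 2 * (1 + ?b\<^sup>2) * (1 / (1 + (q s)\<^sup>2))"
        using * real_character_one_parameter[OF _ assms(2), of q s t] Cons.prems by simp
      then have "weight (q # qs) (s + X t) \<le> (2 * (1 + ?b\<^sup>2) * (1 / (1 + (q s)\<^sup>2))) * (C * weight qs s)"
        unfolding weight_Cons
        by (intro mult_mono C t) (auto intro!: mult_nonneg_nonneg divide_nonneg_nonneg less_imp_le[OF weight_pos])
      then show "weight (q # qs) (s + X t) \<le> 2 * (1 + ?b\<^sup>2) * C * weight (q # qs) s"
        unfolding weight_Cons by (simp add: mult_ac)
    qed (use C in auto)
  qed
  then show ?thesis using that by blast
qed

context haar_coordinates
begin

lemma compact_exhaustion:
  obtains K :: "nat \<Rightarrow> 'g set" where "\<And>n. compact (K n)" "\<And>s. \<exists>N. \<forall>n\<ge>N. s \<in> K n"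
proof -
  have "\<exists>K. \<forall>n. compact (K n) \<and> {s. \<forall>q\<in>set qs. \<bar>q s\<bar> \<le> real n} \<subseteq> K n"
    by (intro choice allI ex_compact)
  then obtain K where K: "\<And>n. compact (K n)" "\<And>n. {s. \<forall>q\<in>set qs. \<bar>q s\<bar> \<le> real n} \<subseteq> K n" by blast
  \<comment> \<open>The sum of all |q s| bounds every single one, so it gives a common
    threshold.\<close>
  have "s \<in> K n" if n: "n \<ge> nat \<lceil>sum_list (map (\<lambda>q. \<bar>q s\<bar>) qs)\<rceil>" for s n
  proof -
    have "\<bar>q s\<bar> \<le> real n" if q: "q \<in> set qs" for q
    proof -
      have "\<bar>q s\<bar> \<le> sum_list (map (\<lambda>q. \<bar>q s\<bar>) qs)"
        by (rule member_le_sum_list) (use q in auto)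
      also have "\<dots> \<le> real n" using n by linarith
      finally show ?thesis .
    qed
    then show ?thesis using K(2)[of n] by blast
  qed
  then show ?thesis by (intro that[of K] K(1)) blast
qed

text \<open>Dominated convergence along the exhaustion: each point lies in only finitely many of the
  complements.\<close>

lemma integral_outside_compact:
  fixes f :: "'g \<Rightarrow> complex"
  assumes f: "integrable \<mu> f" and e: "e > 0"
  obtains K where "compact K" "(\<integral>s. cmod (f s) * indicator (- K) s \<partial>\<mu>) < e"
proof -
  obtain K :: "nat \<Rightarrow> 'g set" where K: "\<And>n. compact (K n)" "\<And>s. \<exists>N. \<forall>n\<ge>N. s \<in> K n"
    by (rule compact_exhaustion) (rule that)
  have Kb [measurable]: "K n \<in> sets borel" for n by (rule borel_closed[OF compact_imp_closed[OF K(1)]])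
  have [measurable]: "f \<in> borel_measurable \<mu>" using f by simp
  have "(\<lambda>n. \<integral>s. cmod (f s) * indicator (- K n) s \<partial>\<mu>) \<longlonglongrightarrow> (\<integral>s. 0 \<partial>\<mu>)"
  proof (rule integral_dominated_convergence[where w = "\<lambda>s. cmod (f s)"])
    show "AE s in \<mu>. (\<lambda>n. cmod (f s) * indicator (- K n) s) \<longlonglongrightarrow> 0"
    proof (rule AE_I2)
      fix s
      obtain N where "\<forall>n\<ge>N. s \<in> K n" using K(2) by blast
      then have "\<forall>\<^sub>F n in sequentially. cmod (f s) * indicator (- K n) s = 0"
        by (intro eventually_sequentiallyI[of N]) simp
      then show "(\<lambda>n. cmod (f s) * indicator (- K n) s) \<longlonglongrightarrow> 0" by (rule tendsto_eventually)
    qed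
    show "AE s in \<mu>. norm (cmod (f s) * indicator (- K n) s) \<le> cmod (f s)" for n
      by (rule AE_I2) (simp add: indicator_def)
  qed (use f in auto)
  then have "\<forall>\<^sub>F n in sequentially. (\<integral>s. cmod (f s) * indicator (- K n) s \<partial>\<mu>) < e"
    using e by (intro order_tendstoD(2)) simp_all
  then obtain n where "(\<integral>s. cmod (f s) * indicator (- K n) s \<partial>\<mu>) < e"
    by (auto simp: eventually_sequentially)
  then show ?thesis using K(1) that by blast
qed

text \<open>Characters near \<gamma> are uniformly close to it on a compact set K; off a large K the
  integral of |f| is small and two characters differ by at most 2. The two contributions are at most
  e/4 and 2 (e/4).\<close>

lemma continuous_fourier:
  assumes f: "integrable \<mu> f"
  shows "continuous_on UNIV (fourier \<mu> f)"
proof -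
  have "(fourier \<mu> f \<longlongrightarrow> fourier \<mu> f \<gamma>) (nhds \<gamma>)" for \<gamma>
  proof (rule tendstoI)
    fix e :: real assume e: "e > 0"
    obtain K where K: "compact K" "(\<integral>s. cmod (f s) * indicator (- K) s \<partial>\<mu>) < e / 4"
      using integral_outside_compact[OF f, of "e / 4"] e by auto
    have [measurable]: "K \<in> sets borel" by (rule borel_closed[OF compact_imp_closed[OF K(1)]])
    have [measurable]: "f \<in> borel_measurable \<mu>" using f by simp
    let ?I = "\<integral>s. cmod (f s) \<partial>\<mu>"
    have I0: "0 \<le> ?I" by simp
    \<comment> \<open>The added 1 keeps the quotient defined when f vanishes almost
      everywhere.\<close>
    define d where "d = e / (4 * (?I + 1))"
    have d: "d > 0" "d * ?I \<le> e / 4"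
    proof -
      show "d > 0" unfolding d_def by (intro divide_pos_pos mult_pos_pos add_nonneg_pos e I0) simp_all
      have "d * ?I \<le> d * (?I + 1)" using \<open>d > 0\<close> by simp
      also have "\<dots> = e / 4"
      proof -
        have "e / (4 * i) * i = e / 4" if "i > 0" for i :: real using that by simp
        from this[of "?I + 1"] show ?thesis unfolding d_def using I0 by (simp only: add_nonneg_pos zero_less_one)
      qed
      finally show "d * ?I \<le> e / 4" .
    qed
    have iK: "integrable \<mu> (\<lambda>s. cmod (f s) * indicator (- K) s)"
      by (rule Bochner_Integration.integrable_bound[OF f]) (auto simp: indicator_def)
    show "\<forall>\<^sub>F \<delta> in nhds \<gamma>. dist (fourier \<mu> f \<delta>) (fourier \<mu> f \<gamma>) < e"
      using eventually_nhds_dual_group[OF K(1) d(1), of \<gamma>]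
    proof eventually_elim
      case (elim \<delta>)
      have "dist (fourier \<mu> f \<delta>) (fourier \<mu> f \<gamma>) = cmod (fourier \<mu> f \<delta> - fourier \<mu> f \<gamma>)"
        by (rule dist_norm)
      also have "\<dots> = cmod (\<integral>s. f s * cnj (character \<delta> s) - f s * cnj (character \<gamma> s) \<partial>\<mu>)"
        unfolding fourier_def
        by (subst Bochner_Integration.integral_diff) (auto intro!: integrable_mult_character haar f)
      also have "\<dots> \<le> (\<integral>s. d * cmod (f s) + 2 * (cmod (f s) * indicator (- K) s) \<partial>\<mu>)"
      proof (rule order_trans[OF integral_norm_bound], rule integral_mono)
        fix s
        have eq: "cmod (f s * cnj (character \<delta> s) - f s * cnj (character \<gamma> s))
            = cmod (f s) * cmod (character \<delta> s - character \<gamma> s)"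
        proof -
          have "f s * cnj (character \<delta> s) - f s * cnj (character \<gamma> s) = f s * cnj (character \<delta> s - character \<gamma> s)"
            by (simp add: right_diff_distrib)
          then show ?thesis by (simp only: norm_mult complex_mod_cnj)
        qed
        show "cmod (f s * cnj (character \<delta> s) - f s * cnj (character \<gamma> s))
            \<le> d * cmod (f s) + 2 * (cmod (f s) * indicator (- K) s)"
        proof (cases "s \<in> K")
          case True
          then have "cmod (f s) * cmod (character \<delta> s - character \<gamma> s) \<le> cmod (f s) * d"
            using elim by (intro mult_left_mono) auto
          then show ?thesis using eq True by (simp add: mult.commute)
        next
          case False
          have "cmod (character \<delta> s - character \<gamma> s) \<le> 2"
            using norm_triangle_ineq4[of "character \<delta> s" "character \<gamma> s"] by simp
          then have "cmod (f s) * cmod (character \<delta> s - character \<gamma> s) \<le> cmod (f s) * 2"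
            by (intro mult_left_mono) auto
          also have "\<dots> \<le> d * cmod (f s) + 2 * (cmod (f s) * indicator (- K) s)"
            using False d(1) by simp
          finally show ?thesis using eq by simp
        qed
      qed (intro integrable_norm Bochner_Integration.integrable_diff Bochner_Integration.integrable_add
          integrable_mult_right integrable_mult_character haar f iK)+
      also have "\<dots> = d * ?I + 2 * (\<integral>s. cmod (f s) * indicator (- K) s \<partial>\<mu>)"
        using f iK by simp
      also have "\<dots> < e" using d(2) K(2) e by linarith
      finally show ?case .
    qed
  qed
  then show ?thesis
    unfolding continuous_on_def using filterlim_mono[OF _ order_refl at_within_le_nhds] by blast
qed

lemma open_unit_cube: "open {s. \<forall>q\<in>set qs. \<bar>q s\<bar> < r}"
proof -
  have "{s. \<forall>q\<in>set qs. \<bar>q s\<bar> < r} = (\<Inter>q\<in>set qs. {s. \<bar>q s\<bar> < r})" by auto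
  moreover have "open {s. \<bar>q s\<bar> < r}" if "q \<in> set qs" for q
  proof -
    have "continuous_on UNIV q" using that qs by (auto simp: real_characters_def)
    then show ?thesis by (intro open_Collect_less continuous_intros)
  qed
  ultimately show ?thesis by (simp only:) (rule open_INT, auto)
qed

text \<open>If the n-fold sum of s - a lies in V, then n |\<phi> (s - a)| <= M, which makes \<phi> s
  close to \<phi> a for large n.\<close>

lemma locally_bounded_real_character:
  fixes \<phi> :: "'g \<Rightarrow> real"
  assumes add: "\<And>s t. \<phi> (s + t) = \<phi> s + \<phi> t"
    and V: "open V" "0 \<in> V" "\<And>s. s \<in> V \<Longrightarrow> \<bar>\<phi> s\<bar> \<le> M"
  shows "\<phi> \<in> real_characters"
proof -
  have "(\<phi> \<longlongrightarrow> \<phi> a) (at a)" for a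
  proof (rule tendstoI)
    fix e :: real assume e: "e > 0"
    obtain n :: nat where n: "M < real n * e" using reals_Archimedean3[OF e] by blast
    have mult: "\<phi> (\<Sum>i<n. s) = real n * \<phi> s" for s n
    proof (induction n)
      case 0
      show ?case using add[of 0 0] by simp
    qed (simp add: add algebra_simps)
    let ?U = "{s. (\<Sum>i<n. s - a) \<in> V}"
    have "open ?U"
      using open_vimage[OF V(1), of "\<lambda>s. \<Sum>i<n. s - a"]
      by (simp add: vimage_def continuous_intros del: sum_constant)
    moreover have "a \<in> ?U" using V(2) by simp
    moreover have "dist (\<phi> s) (\<phi> a) < e" if "s \<in> ?U" for s
    proof -
      have "\<phi> s = \<phi> (s - a) + \<phi> a" using add[of "s - a" a] by simp
      moreover have "real n * \<bar>\<phi> (s - a)\<bar> \<le> M"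
        using V(3)[of "\<Sum>i<n. s - a"] that by (simp add: mult abs_mult del: sum_constant)
      then have "real n * \<bar>\<phi> (s - a)\<bar> < real n * e" using n by simp
      then have "\<bar>\<phi> (s - a)\<bar> < e" by (simp add: mult_less_cancel_left)
      ultimately show ?thesis by (simp add: dist_real_def)
    qed
    ultimately show "\<forall>\<^sub>F s in at a. dist (\<phi> s) (\<phi> a) < e"
      unfolding eventually_at_topological by blast
  qed
  then have "continuous_on UNIV \<phi>" by (simp add: continuous_on_def)
  then show ?thesis using add by (simp add: real_characters_def)
qed

text \<open>Evaluation at s turns X into a homomorphism of the line into the circle, with some
  frequency \<phi> s. Additivity of \<phi> is uniqueness of frequencies; its continuity comes from a
  bound on a neighbourhood of 0.\<close>

lemma dual_one_parameter:
  fixes X :: "real \<Rightarrow> 'g dual_group"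
  assumes X: "X \<in> one_parameter_subgroups"
  obtains \<phi> where "\<phi> \<in> real_characters" "\<And>t s. character (X t) s = cis (t * \<phi> s)"
proof -
  have Xc: "continuous_on UNIV X" and Xa: "\<And>a b. X (a + b) = X a + X b"
    using X by (auto simp: one_parameter_subgroups_def)
  have "\<exists>a. \<forall>t. character (X t) s = cis (a * t)" for s
  proof -
    have "continuous_on UNIV (\<lambda>t. character (X t) s)"
      by (rule continuous_on_compose2[OF continuous_evaluation Xc]) auto
    then obtain a where "\<And>t. character (X t) s = cis (a * t)"
      by (rule circle_hom_cis) (auto simp: Xa character_plus_dual)
    then show ?thesis by blast
  qed
  then obtain \<phi> where \<phi>: "\<And>s t. character (X t) s = cis (\<phi> s * t)" by metis
  have "\<phi> \<in> real_characters"
  proof -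
    obtain K where K: "compact K" "{s. \<forall>q\<in>set qs. \<bar>q s\<bar> \<le> 1} \<subseteq> K" using ex_compact by blast
    have "(X \<longlongrightarrow> 0) (at 0)"
      using Xc one_parameter_0[OF X] unfolding continuous_on_def by (metis UNIV_I)
    from filterlim_iff[THEN iffD1, OF this, rule_format, OF eventually_nhds_dual_group[OF K(1) zero_less_one]]
    obtain d where d: "d > 0" "\<And>t. t \<noteq> 0 \<Longrightarrow> dist t 0 < d \<Longrightarrow> \<forall>s\<in>K. cmod (character (X t) s - 1) < 1"
      unfolding eventually_at by auto
    \<comment> \<open>Uniformly on K, the value of X t stays within distance 1 of 1 for |t| < d. A
      frequency above pi / d would reach the value - 1, at distance 2, before time d.\<close>
    have bound: "\<bar>\<phi> s\<bar> \<le> pi / d" if "s \<in> K" for s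
    proof (rule ccontr)
      assume "\<not> \<bar>\<phi> s\<bar> \<le> pi / d"
      then have s: "\<bar>\<phi> s\<bar> > pi / d" by simp
      moreover have "pi / d > 0" using d(1) by simp
      ultimately have nz: "\<phi> s \<noteq> 0" by auto
      have "dist (pi / \<phi> s) 0 < d" using s d(1) nz by (simp add: field_simps)
      then have "cmod (character (X (pi / \<phi> s)) s - 1) < 1" using d(2)[of "pi / \<phi> s"] nz that by simp
      then show False using nz by (simp add: \<phi> norm_minus_commute)
    qed
    show ?thesis
    proof (rule locally_bounded_real_character)
      show "\<phi> (s + t) = \<phi> s + \<phi> t" for s t
        by (subst cis_eq_iff_all[symmetric])
          (simp add: distrib_right cis_mult[symmetric] \<phi>[symmetric] character_add)
      show "open {s. \<forall>q\<in>set qs. \<bar>q s\<bar> < 1}" by (rule open_unit_cube)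
      show "0 \<in> {s. \<forall>q\<in>set qs. \<bar>q s\<bar> < 1}" by (simp add: real_character_0[OF subsetD[OF qs]])
      show "\<bar>\<phi> s\<bar> \<le> pi / d" if "s \<in> {s. \<forall>q\<in>set qs. \<bar>q s\<bar> < 1}" for s
        using that K(2) by (intro bound) (auto simp: less_imp_le subset_iff)
    qed
  qed
  then show ?thesis using that \<phi> by (metis mult.commute)
qed

text \<open>The majorant is uniform over |t| <= 1, as \<open>fourier_derivative\<close> asks
  for.\<close>

lemma schwartz_translate_bound:
  assumes "f \<in> schwartz" "Y \<in> one_parameter_subgroups"
  obtains C where "C \<ge> 0" "\<And>s t. \<bar>t\<bar> \<le> 1 \<Longrightarrow> cmod (f (s + Y t)) \<le> C * weight qs s"
proof -
  obtain A where A: "A \<ge> 0" "\<And>s. cmod (f s) \<le> A * weight qs s"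
    using schwartz_weight_bound[OF assms(1) qs] by blast
  obtain B where B: "B \<ge> 0" "\<And>s t. \<bar>t\<bar> \<le> 1 \<Longrightarrow> weight qs (s + Y t) \<le> B * weight qs s"
    using weight_translate_le[OF qs assms(2)] by blast
  show ?thesis
  proof (rule that)
    show "A * B \<ge> 0" using A B by simp
    fix s t assume "\<bar>t :: real\<bar> \<le> 1"
    then have "A * weight qs (s + Y t) \<le> A * (B * weight qs s)" using A B by (intro mult_left_mono)
    then show "cmod (f (s + Y t)) \<le> A * B * weight qs s" using A(2)[of "s + Y t"] by (simp add: mult.assoc)
  qed
qed

lemma schwartz_fourier_derivative:
  assumes f: "f \<in> schwartz" and Y: "Y \<in> one_parameter_subgroups"
    and a: "\<And>t. character \<gamma> (Y t) = cis (t * a)"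
  shows "complex_of_real a * fourier \<mu> f \<gamma> = fourier \<mu> (\<lambda>s. - \<i> * iterated_derivative [Y] f s) \<gamma>"
proof -
  have f': "iterated_derivative [Y] f \<in> schwartz" by (rule schwartz_derivative[OF f Y])
  obtain C where "C \<ge> 0" and C: "\<And>s t. \<bar>t\<bar> \<le> 1 \<Longrightarrow> cmod (iterated_derivative [Y] f (s + Y t)) \<le> C * weight qs s"
    by (rule schwartz_translate_bound[OF f' Y]) (rule that)
  have "complex_of_real a * fourier \<mu> f \<gamma> = - \<i> * fourier \<mu> (iterated_derivative [Y] f) \<gamma>"
    by (rule fourier_derivative[OF haar a one_parameter_0[OF Y] schwartz_integrable[OF f] schwartz_measurable[OF f']
          integrable_mult_right[OF weight_integrable] schwartz_has_derivative[OF f Y] C])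
  then show ?thesis unfolding fourier_scale .
qed

text \<open>The class of transforms of Schwartz functions is closed under both operations:
  differentiation in the dual is multiplication by a real character before transforming, and
  multiplication by a real character of the dual is differentiation along a one-parameter subgroup.
  Transforms of integrable functions are bounded and continuous.\<close>

lemma fourier_schwartz:
  assumes "f \<in> schwartz"
  shows "fourier \<mu> f \<in> schwartz"
proof (rule schwartz_coinduct[where S = "{fourier \<mu> f | f. f \<in> schwartz}"])
  show "fourier \<mu> f \<in> {fourier \<mu> f | f. f \<in> schwartz}" using assms by blast
next
  fix h assume "h \<in> {fourier \<mu> f | f. f \<in> schwartz}"
  then obtain f where h: "h = fourier \<mu> f" and f: "f \<in> schwartz" by blast
  show "continuous_on UNIV h" unfolding h by (rule continuous_fourier[OF schwartz_integrable[OF f]])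
  show "bounded (range (\<lambda>\<gamma>. complex_of_real (\<Prod>\<phi>\<leftarrow>\<phi>s. \<phi> \<gamma>) * h \<gamma>))" if "set \<phi>s \<subseteq> real_characters" for \<phi>s
  proof -
    have "\<exists>g\<in>schwartz. \<forall>\<gamma>. complex_of_real (\<Prod>\<phi>\<leftarrow>\<phi>s. \<phi> \<gamma>) * h \<gamma> = fourier \<mu> g \<gamma>"
      using that
    proof (induction \<phi>s)
      case Nil
      then show ?case using f h by auto
    next
      case (Cons \<phi> \<phi>s)
      then obtain g where g: "g \<in> schwartz" "\<And>\<gamma>. complex_of_real (\<Prod>\<phi>\<leftarrow>\<phi>s. \<phi> \<gamma>) * h \<gamma> = fourier \<mu> g \<gamma>" by auto
      obtain Y where Y: "Y \<in> one_parameter_subgroups" "\<And>\<gamma> t. character \<gamma> (Y t) = cis (t * \<phi> \<gamma>)"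
        using ex_one_parameter[of \<phi>] Cons.prems by auto
      show ?case
      proof (intro bexI allI)
        show "complex_of_real (\<Prod>\<phi>\<leftarrow>\<phi> # \<phi>s. \<phi> \<gamma>) * h \<gamma> = fourier \<mu> (\<lambda>s. - \<i> * iterated_derivative [Y] g s) \<gamma>" for \<gamma>
          using schwartz_fourier_derivative[OF g(1) Y(1) Y(2), of \<gamma>] g(2)[of \<gamma>]
          by (simp add: mult.assoc del: iterated_derivative.simps)
        show "(\<lambda>s. - \<i> * iterated_derivative [Y] g s) \<in> schwartz"
          by (rule schwartz_scale[OF schwartz_derivative[OF g(1) Y(1)]])
      qed
    qed
    then obtain g where g: "g \<in> schwartz" "\<And>\<gamma>. complex_of_real (\<Prod>\<phi>\<leftarrow>\<phi>s. \<phi> \<gamma>) * h \<gamma> = fourier \<mu> g \<gamma>" by blast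
    show ?thesis unfolding g(2) bounded_iff
      using fourier_bound[OF haar schwartz_integrable[OF g(1)]] by blast
  qed
  fix X :: "real \<Rightarrow> 'g dual_group" assume X: "X \<in> one_parameter_subgroups"
  obtain \<phi> where \<phi>: "\<phi> \<in> real_characters" "\<And>t s. character (X t) s = cis (t * \<phi> s)"
    using dual_one_parameter[OF X] by blast
  note m = schwartz_real_character_mult[OF \<phi>(1)]
  have "((\<lambda>t. h (\<gamma> + X t)) has_vector_derivative fourier \<mu> (\<lambda>s. - \<i> * (complex_of_real (\<phi> s) * f s)) \<gamma>) (at 0)" for \<gamma>
    unfolding h fourier_scale
    by (rule fourier_has_derivative[OF haar \<phi>(2) schwartz_integrable[OF f] schwartz_integrable[OF m[OF f]]
          schwartz_integrable[OF m[OF m[OF f]]]])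
  moreover have "(\<lambda>s. - \<i> * (complex_of_real (\<phi> s) * f s)) \<in> schwartz" by (rule schwartz_scale[OF m[OF f]])
  ultimately show "\<exists>k\<in>{fourier \<mu> f | f. f \<in> schwartz}. \<forall>\<gamma>. ((\<lambda>t. h (\<gamma> + X t)) has_vector_derivative k \<gamma>) (at 0)"
    by blast
qed

end

section \<open>Decay of matrix coefficients\<close>

text \<open>The linear span is taken because multiplication by a time or frequency coordinate turns
  one coefficient into a combination of two.\<close>

inductive_set matrix_coefficients ::
    "'g::topological_ab_group_add measure \<Rightarrow> ('g dual_group \<times> 'g \<Rightarrow> complex) set" for \<mu>
  where coefficient: "f \<in> schwartz \<Longrightarrow> g \<in> schwartz \<Longrightarrow>
      (\<lambda>x. L2_inner \<mu> f (tf_shift x g)) \<in> matrix_coefficients \<mu>"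
  | lincomb: "u \<in> matrix_coefficients \<mu> \<Longrightarrow> v \<in> matrix_coefficients \<mu> \<Longrightarrow>
      (\<lambda>x. c * u x + v x) \<in> matrix_coefficients \<mu>"

lemma matrix_coefficients_add:
  "u \<in> matrix_coefficients \<mu> \<Longrightarrow> v \<in> matrix_coefficients \<mu> \<Longrightarrow> (\<lambda>x. u x + v x) \<in> matrix_coefficients \<mu>"
  using lincomb[of u \<mu> v 1] by simp

lemma matrix_coefficients_zero: "(\<lambda>x. 0) \<in> matrix_coefficients \<mu>"
  using coefficient[OF schwartz_zero schwartz_zero, of \<mu>] by (simp add: L2_inner_def)

lemma matrix_coefficients_mult:
  assumes "u \<in> matrix_coefficients \<mu>"
    and base: "\<And>f g. f \<in> schwartz \<Longrightarrow> g \<in> schwartz \<Longrightarrow>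
      (\<lambda>x. complex_of_real (r x) * L2_inner \<mu> f (tf_shift x g)) \<in> matrix_coefficients \<mu>"
  shows "(\<lambda>x. complex_of_real (r x) * u x) \<in> matrix_coefficients \<mu>"
  using assms(1)
proof induction
  case (lincomb u v c)
  then have "(\<lambda>x. c * (complex_of_real (r x) * u x) + complex_of_real (r x) * v x) \<in> matrix_coefficients \<mu>"
    by (intro matrix_coefficients.lincomb)
  then show ?case by (simp add: algebra_simps)
qed (use base in blast)

lemma summable_on_norm_iff_integrable:
  fixes f :: "'a \<Rightarrow> 'b::{banach,second_countable_topology}"
  shows "(\<lambda>x. norm (f x)) summable_on A \<longleftrightarrow> integrable (count_space A) f"
  by (simp only: abs_summable_equivalent Infinite_Set_Sum.abs_summable_on_def)

lemma open_nhds_0_diff: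
  fixes U :: "'a::topological_ab_group_add set"
  assumes "open U" "0 \<in> U"
  obtains V where "open V" "0 \<in> V" "\<And>x y. x \<in> V \<Longrightarrow> y \<in> V \<Longrightarrow> x - y \<in> U"
proof -
  have "open ((\<lambda>(x, y). x - y :: 'a) -` U)"
    by (rule open_vimage[OF assms(1)]) (auto simp: case_prod_unfold intro!: continuous_intros)
  moreover have "(0, 0) \<in> (\<lambda>(x, y). x - y :: 'a) -` U" using assms by simp
  ultimately obtain A B where AB: "open A" "open B" "(0, 0) \<in> A \<times> B" "A \<times> B \<subseteq> (\<lambda>(x, y). x - y) -` U"
    by (rule open_prod_elim)
  show ?thesis by (rule that[of "A \<inter> B"]) (use AB in auto)
qed

lemma open_translate:
  fixes V :: "'a::topological_ab_group_add set"
  assumes "open V" shows "open {x. x - a \<in> V}"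
  using open_vimage[OF assms, of "\<lambda>x. x - a"] by (simp add: vimage_def continuous_intros)

text \<open>K is covered by finitely many translates of a product neighbourhood whose differences
  lie in U. If x0 is a point of L in such a translate, subtracting x0 maps the points of L there
  injectively into L \<inter> U.\<close>

lemma finite_subgroup_Int_compact:
  fixes L :: "('a::topological_ab_group_add \<times> 'b::topological_ab_group_add) set"
  assumes diff: "\<And>x y. x \<in> L \<Longrightarrow> y \<in> L \<Longrightarrow> x - y \<in> L"
    and U: "open U" "0 \<in> U" "finite (L \<inter> U)" and K: "compact K"
  shows "finite (L \<inter> K)"
proof -
  obtain A B where AB: "open A" "open B" "0 \<in> A \<times> B" "A \<times> B \<subseteq> U"
    using open_prod_elim[OF U(1,2)] by blast
  obtain A' where A': "open A'" "0 \<in> A'" "\<And>x y. x \<in> A' \<Longrightarrow> y \<in> A' \<Longrightarrow> x - y \<in> A"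
    using open_nhds_0_diff[of A] AB by (auto simp: zero_prod_def)
  obtain B' where B': "open B'" "0 \<in> B'" "\<And>x y. x \<in> B' \<Longrightarrow> y \<in> B' \<Longrightarrow> x - y \<in> B"
    using open_nhds_0_diff[of B] AB by (auto simp: zero_prod_def)
  let ?W = "\<lambda>a. {x. x - fst a \<in> A'} \<times> {x. x - snd a \<in> B'}"
  have "\<exists>C'\<subseteq>?W ` K. finite C' \<and> K \<subseteq> \<Union>C'"
  proof (rule compactE[OF K])
    show "K \<subseteq> \<Union>(?W ` K)" using A' B' by force
    show "open T" if "T \<in> ?W ` K" for T
      using that A' B' by (auto intro!: open_Times open_translate)
  qed blast
  then obtain C' where C': "C' \<subseteq> ?W ` K" "finite C'" "K \<subseteq> \<Union>C'" by blast
  have "finite (L \<inter> ?W a)" for a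
  proof (cases "L \<inter> ?W a = {}")
    case False
    then obtain x0 where x0: "x0 \<in> L" "x0 \<in> ?W a" by blast
    have "x - x0 \<in> L \<inter> U" if "x \<in> L \<inter> ?W a" for x
    proof -
      have "fst x - fst x0 \<in> A"
        using A'(3)[of "fst x - fst a" "fst x0 - fst a"] that x0 by auto
      moreover have "snd x - snd x0 \<in> B"
        using B'(3)[of "snd x - snd a" "snd x0 - snd a"] that x0 by auto
      ultimately have "x - x0 \<in> U" using AB(4) by (auto simp: minus_prod_def)
      then show ?thesis using diff that x0 by blast
    qed
    then have "(\<lambda>x. x - x0) ` (L \<inter> ?W a) \<subseteq> L \<inter> U" by blast
    then show ?thesis using U(3) by (rule inj_on_finite[rotated]) (auto simp: inj_on_def)
  qed simp
  then have "finite (L \<inter> W)" if "W \<in> C'" for W using C'(1) that by auto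
  then have "finite (\<Union>W\<in>C'. L \<inter> W)" using C'(2) by blast
  moreover have "L \<inter> K \<subseteq> (\<Union>W\<in>C'. L \<inter> W)" using C'(3) by blast
  ultimately show ?thesis by (rule finite_subset[rotated])
qed

lemma frequency_diff:
  assumes "X \<in> one_parameter_subgroups"
  shows "frequency X (\<gamma> - \<delta>) = frequency X \<gamma> - frequency X \<delta>"
  by (rule frequency_eqI, simp only: character_minus_dual)
    (simp add: character_one_parameter[OF assms] cis_cnj cis_mult left_diff_distrib)

context haar_coordinates
begin

definition phase_coordinates :: "('g dual_group \<times> 'g \<Rightarrow> real) list"
  where "phase_coordinates = map (\<lambda>q x. q (snd x)) qs @ map (\<lambda>X x. frequency X (fst x)) Ys"

lemma phase_coordinates_diff:
  assumes "r \<in> set phase_coordinates"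
  shows "r (x - y) = r x - r y"
proof -
  consider q where "q \<in> set qs" "r = (\<lambda>x. q (snd x))" | X where "X \<in> set Ys" "r = (\<lambda>x. frequency X (fst x))"
    using assms by (auto simp: phase_coordinates_def)
  then show ?thesis
  proof cases
    case 1
    then show ?thesis using qs real_character_diff[of q] by auto
  next
    case 2
    then show ?thesis using Ys frequency_diff[of X] by auto
  qed
qed

lemma phase_coordinates_compact:
  "\<exists>K. compact K \<and> {x. \<forall>r\<in>set phase_coordinates. \<bar>r x\<bar> \<le> 1} \<subseteq> K"
proof -
  obtain K where K: "compact K" "{s. \<forall>q\<in>set qs. \<bar>q s\<bar> \<le> 1} \<subseteq> K" using ex_compact by blast
  obtain K' where K': "compact K'" "{\<gamma>. \<forall>X\<in>set Ys. \<bar>frequency X \<gamma>\<bar> \<le> 1} \<subseteq> K'" using ex_compact_dual by blast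
  have "{x. \<forall>r\<in>set phase_coordinates. \<bar>r x\<bar> \<le> 1} \<subseteq> K' \<times> K"
  proof
    fix x assume x: "x \<in> {x. \<forall>r\<in>set phase_coordinates. \<bar>r x\<bar> \<le> 1}"
    have "fst x \<in> K'" by (rule subsetD[OF K'(2)]) (use x in \<open>simp add: phase_coordinates_def ball_Un\<close>)
    moreover have "snd x \<in> K" by (rule subsetD[OF K(2)]) (use x in \<open>simp add: phase_coordinates_def ball_Un\<close>)
    ultimately show "x \<in> K' \<times> K" by (simp add: mem_Times_iff)
  qed
  then show ?thesis using compact_Times[OF K'(1) K(1)] by blast
qed

text \<open>\<open>nn_integral_weight_le\<close> is applied to counting measure: a unit cell of L,
  shifted by one of its points, embeds into the finite set L \<inter> K.\<close>

lemma weight_summable_on_subgroup: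
  assumes diff: "\<And>x y. x \<in> L \<Longrightarrow> y \<in> L \<Longrightarrow> x - y \<in> L"
    and U: "open U" "0 \<in> U" "finite (L \<inter> U)"
  shows "weight phase_coordinates summable_on L"
proof -
  let ?w = "weight phase_coordinates"
  obtain K where K: "compact K" "{x. \<forall>r\<in>set phase_coordinates. \<bar>r x\<bar> \<le> 1} \<subseteq> K"
    using phase_coordinates_compact by blast
  have fin: "finite (L \<inter> K)" by (rule finite_subgroup_Int_compact[OF diff U K(1)])
  have "emeasure (count_space L) (L \<inter> {x\<in>space (count_space L). \<forall>(r, k)\<in>set (zip phase_coordinates ks). \<lfloor>r x\<rfloor> = k})
      \<le> of_nat (card (L \<inter> K))" (is "emeasure _ ?C \<le> _") if l: "length ks = length phase_coordinates" for ks
  proof (cases "?C = {}")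
    case True
    show ?thesis unfolding True by simp
  next
    case False
    then obtain x0 where x0: "x0 \<in> ?C" by blast
    have "x - x0 \<in> L \<inter> K" if x: "x \<in> ?C" for x
    proof -
      have "\<bar>r (x - x0)\<bar> \<le> 1" if r: "r \<in> set phase_coordinates" for r
      proof -
        obtain i where i: "i < length phase_coordinates" "r = phase_coordinates ! i"
          using r by (auto simp: in_set_conv_nth)
        then have "(r, ks ! i) \<in> set (zip phase_coordinates ks)" using l by (auto simp: set_zip)
        then have "\<lfloor>r x\<rfloor> = ks ! i" "\<lfloor>r x0\<rfloor> = ks ! i" using x x0 by auto
        then show ?thesis unfolding phase_coordinates_diff[OF r] by linarith
      qed
      then show ?thesis using K(2) diff x x0 by auto
    qed
    then have "(\<lambda>x. x - x0) ` ?C \<subseteq> L \<inter> K" by blast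
    moreover have inj: "inj_on (\<lambda>x. x - x0) ?C" by (auto simp: inj_on_def)
    ultimately have "finite ?C" "card ?C \<le> card (L \<inter> K)"
      using inj_on_finite[OF inj _ fin] card_inj_on_le[OF inj _ fin] by auto
    then show ?thesis by (subst emeasure_count_space_finite) auto
  qed
  then have "(\<integral>\<^sup>+x\<in>L. ennreal (?w x) \<partial>count_space L) \<le> of_nat (card (L \<inter> K)) * int_sum ^ length phase_coordinates"
    by (intro nn_integral_weight_le) auto
  also have "\<dots> < \<infinity>"
    using int_sum_finite by (simp add: ennreal_mult_less_top power_less_top_ennreal of_nat_less_top)
  also have "(\<integral>\<^sup>+x\<in>L. ennreal (?w x) \<partial>count_space L) = (\<integral>\<^sup>+x. ennreal (norm (?w x)) \<partial>count_space L)"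
    by (intro nn_integral_cong) (simp add: abs_of_pos weight_pos)
  finally have "integrable (count_space L) ?w" by (intro integrableI_bounded) auto
  then show ?thesis
    using summable_on_norm_iff_integrable[of ?w L] by (simp add: abs_of_pos weight_pos)
qed

lemma schwartz_bound:
  assumes "(f :: 'g \<Rightarrow> complex) \<in> schwartz"
  obtains B where "B \<ge> 0" "\<And>s. cmod (f s) \<le> B"
proof -
  obtain C where C: "C \<ge> 0" "\<And>s. cmod (f s) \<le> C * weight qs s"
    using schwartz_weight_bound[OF assms qs] by blast
  have "C * weight qs s \<le> C" for s using weight_le_1[of qs s] C(1) by (simp add: mult_left_le)
  then show ?thesis using that[OF C(1)] C(2) order_trans by blast
qed

lemma measurable_diff_right: "(g :: 'g \<Rightarrow> complex) \<in> borel_measurable borel \<Longrightarrow> (\<lambda>s. g (s - t)) \<in> borel_measurable borel"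
  using measurable_compose[OF measurable_translation[of "- t"], of g borel] by simp

lemma integrable_mult_bounded:
  fixes f g :: "'g \<Rightarrow> complex"
  assumes "integrable \<mu> f" "g \<in> borel_measurable borel" "\<And>s. cmod (g s) \<le> B"
  shows "integrable \<mu> (\<lambda>s. f s * g s)"
proof (rule Bochner_Integration.integrable_bound[OF integrable_mult_right[OF assms(1), of "of_real B"]])
  have [measurable]: "f \<in> borel_measurable \<mu>" "g \<in> borel_measurable \<mu>" using assms by simp_all
  show "(\<lambda>s. f s * g s) \<in> borel_measurable \<mu>" by measurable
  have "0 \<le> B" using order_trans[OF norm_ge_zero assms(3)] .
  then show "AE s in \<mu>. cmod (f s * g s) \<le> cmod (of_real B * f s)"
    using assms(3) by (intro AE_I2) (simp add: norm_mult mult.commute[of B] mult_left_mono)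
qed

text \<open>In this form the coefficient is a short-time Fourier transform with window g, to which
  the rules for \<open>fourier\<close> apply.\<close>

lemma coefficient_eq_fourier:
  "L2_inner \<mu> f (tf_shift x g) = fourier \<mu> (\<lambda>s. f s * cnj (g (s - snd x))) (fst x)"
  by (simp add: L2_inner_def fourier_def tf_shift_def case_prod_unfold mult_ac)

lemma coefficient_integrable:
  assumes f: "f \<in> schwartz" and g: "g \<in> schwartz"
  shows "integrable \<mu> (\<lambda>s. f s * cnj (g (s - t)))"
proof -
  obtain B where B: "\<And>s. cmod (g s) \<le> B" using schwartz_bound[OF g] by blast
  have "(\<lambda>s. cnj (g (s - t))) \<in> borel_measurable borel"
    using measurable_diff_right[OF schwartz_measurable[OF g]] by measurable
  then show ?thesis using B by (intro integrable_mult_bounded[OF schwartz_integrable[OF f]]) auto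
qed

text \<open>The time coordinate is distributed by q t = q s - q (s - t): the first term goes to f,
  the second to g.\<close>

lemma matrix_coefficients_real_character:
  assumes "u \<in> matrix_coefficients \<mu>" "q \<in> real_characters"
  shows "(\<lambda>x. complex_of_real (q (snd x)) * u x) \<in> matrix_coefficients \<mu>"
proof (rule matrix_coefficients_mult[OF assms(1)])
  fix f g :: "'g \<Rightarrow> complex" assume f: "f \<in> schwartz" and g: "g \<in> schwartz"
  let ?q = "\<lambda>f s. complex_of_real (q s) * f s"
  have qf: "?q f \<in> schwartz" and qg: "?q g \<in> schwartz"
    by (rule schwartz_real_character_mult[OF assms(2)], fact)+
  have "complex_of_real (q (snd x)) * L2_inner \<mu> f (tf_shift x g)
      = - 1 * L2_inner \<mu> f (tf_shift x (?q g)) + L2_inner \<mu> (?q f) (tf_shift x g)" for x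
  proof -
    have "complex_of_real (q (snd x)) * L2_inner \<mu> f (tf_shift x g)
        = fourier \<mu> (\<lambda>s. complex_of_real (q (snd x)) * (f s * cnj (g (s - snd x)))) (fst x)"
      unfolding coefficient_eq_fourier fourier_scale ..
    also have "(\<lambda>s. complex_of_real (q (snd x)) * (f s * cnj (g (s - snd x))))
        = (\<lambda>s. - 1 * (f s * cnj (?q g (s - snd x))) + ?q f s * cnj (g (s - snd x)))"
      by (simp add: fun_eq_iff real_character_diff[OF assms(2)] algebra_simps)
    also have "fourier \<mu> \<dots> (fst x) = - 1 * fourier \<mu> (\<lambda>s. f s * cnj (?q g (s - snd x))) (fst x)
        + fourier \<mu> (\<lambda>s. ?q f s * cnj (g (s - snd x))) (fst x)"
      unfolding fourier_scale[symmetric]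
      by (intro fourier_add haar integrable_mult_right coefficient_integrable f g qf qg)
    finally show ?thesis unfolding coefficient_eq_fourier .
  qed
  then show "(\<lambda>x. complex_of_real (q (snd x)) * L2_inner \<mu> f (tf_shift x g)) \<in> matrix_coefficients \<mu>"
    by (simp only:) (intro matrix_coefficients.intros f g qf qg)
qed

text \<open>Integration by parts along Y: the frequency becomes a derivative of the product of f
  with a translate of g, and the product rule gives two coefficients.\<close>

lemma matrix_coefficients_frequency:
  assumes "u \<in> matrix_coefficients \<mu>" and Y: "Y \<in> one_parameter_subgroups"
  shows "(\<lambda>x. complex_of_real (frequency Y (fst x)) * u x) \<in> matrix_coefficients \<mu>"
proof (rule matrix_coefficients_mult[OF assms(1)])
  fix f g :: "'g \<Rightarrow> complex" assume f: "f \<in> schwartz" and g: "g \<in> schwartz"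
  let ?d = "iterated_derivative [Y]"
  have df: "?d f \<in> schwartz" and dg: "?d g \<in> schwartz" by (rule schwartz_derivative[OF _ Y], fact)+
  obtain Bg where Bg: "Bg \<ge> 0" "\<And>s. cmod (g s) \<le> Bg" using schwartz_bound[OF g] by blast
  obtain Bdg where Bdg: "Bdg \<ge> 0" "\<And>s. cmod (?d g s) \<le> Bdg" using schwartz_bound[OF dg] by blast
  obtain C where "C \<ge> 0" and C: "\<And>s t. \<bar>t\<bar> \<le> 1 \<Longrightarrow> cmod (f (s + Y t)) \<le> C * weight qs s"
    by (rule schwartz_translate_bound[OF f Y]) (rule that)
  obtain C' where "C' \<ge> 0" and C': "\<And>s t. \<bar>t\<bar> \<le> 1 \<Longrightarrow> cmod (?d f (s + Y t)) \<le> C' * weight qs s"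
    by (rule schwartz_translate_bound[OF df Y]) (rule that)
  \<comment> \<open>The summand 0 completes the shape c u + v of \<open>lincomb\<close>.\<close>
  have "complex_of_real (frequency Y (fst x)) * L2_inner \<mu> f (tf_shift x g)
      = - \<i> * L2_inner \<mu> f (tf_shift x (?d g)) + (- \<i> * L2_inner \<mu> (?d f) (tf_shift x g) + 0)" for x
  proof -
    let ?h = "\<lambda>s. f s * cnj (g (s - snd x))"
    let ?h1 = "\<lambda>s. f s * cnj (?d g (s - snd x))" and ?h2 = "\<lambda>s. ?d f s * cnj (g (s - snd x))"
    have "complex_of_real (frequency Y (fst x)) * fourier \<mu> ?h (fst x) = - \<i> * fourier \<mu> (\<lambda>s. ?h1 s + ?h2 s) (fst x)"
    proof (rule fourier_derivative[OF haar])
      show "Y 0 = 0" by (rule one_parameter_0[OF Y])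
      show "character (fst x) (Y t) = cis (t * frequency Y (fst x))" for t
        by (simp only: character_one_parameter[OF Y] mult.commute)
      show "integrable \<mu> ?h" by (rule coefficient_integrable[OF f g])
      have "integrable \<mu> (\<lambda>s. ?h1 s + ?h2 s)"
        by (intro Bochner_Integration.integrable_add coefficient_integrable f g df dg)
      from borel_measurable_integrable[OF this] show "(\<lambda>s. ?h1 s + ?h2 s) \<in> borel_measurable borel"
        by (simp only: haar_borel_measurable[OF haar])
      show "integrable \<mu> (\<lambda>s. (C * Bdg + C' * Bg) * weight qs s)"
        by (intro integrable_mult_right weight_integrable)
      show "((\<lambda>t. f (s + Y t) * cnj (g (s + Y t - snd x))) has_vector_derivative
          (f (s + Y t) * cnj (?d g (s + Y t - snd x)) + ?d f (s + Y t) * cnj (g (s + Y t - snd x)))) (at t)" for s t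
      proof -
        have "((\<lambda>t. cnj (g ((s - snd x) + Y t))) has_vector_derivative cnj (?d g ((s - snd x) + Y t))) (at t)"
          by (rule has_vector_derivative_cnj[OF schwartz_has_derivative[OF g Y]])
        then have "((\<lambda>t. cnj (g (s + Y t - snd x))) has_vector_derivative cnj (?d g (s + Y t - snd x))) (at t)"
          by (simp add: algebra_simps)
        from has_vector_derivative_mult[OF schwartz_has_derivative[OF f Y] this] show ?thesis .
      qed
      show "cmod (f (s + Y t) * cnj (?d g (s + Y t - snd x)) + ?d f (s + Y t) * cnj (g (s + Y t - snd x)))
          \<le> (C * Bdg + C' * Bg) * weight qs s" if t: "\<bar>t\<bar> \<le> 1" for s t
      proof -
        have "cmod (f (s + Y t)) * cmod (?d g (s + Y t - snd x)) \<le> (C * weight qs s) * Bdg"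
          by (intro mult_mono C Bdg t order_trans[OF norm_ge_zero C[OF t]]) simp
        moreover have "cmod (?d f (s + Y t)) * cmod (g (s + Y t - snd x)) \<le> (C' * weight qs s) * Bg"
          by (intro mult_mono C' Bg t order_trans[OF norm_ge_zero C'[OF t]]) simp
        ultimately show ?thesis
          by (intro order_trans[OF norm_triangle_ineq]) (simp add: norm_mult algebra_simps del: iterated_derivative.simps)
      qed
    qed
    also have "fourier \<mu> (\<lambda>s. ?h1 s + ?h2 s) (fst x) = fourier \<mu> ?h1 (fst x) + fourier \<mu> ?h2 (fst x)"
      by (intro fourier_add haar coefficient_integrable f g df dg)
    finally show ?thesis unfolding coefficient_eq_fourier by (simp add: algebra_simps del: iterated_derivative.simps)
  qed
  then show "(\<lambda>x. complex_of_real (frequency Y (fst x)) * L2_inner \<mu> f (tf_shift x g)) \<in> matrix_coefficients \<mu>"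
    by (simp only:) (intro matrix_coefficients.intros f g df dg matrix_coefficients_zero)
qed

lemma matrix_coefficients_bounded:
  assumes "u \<in> matrix_coefficients \<mu>"
  shows "bounded (range u)"
  using assms
proof induction
  case (coefficient f g)
  obtain B where B: "\<And>s. cmod (g s) \<le> B" using schwartz_bound[OF coefficient(2)] by blast
  have "cmod (L2_inner \<mu> f (tf_shift x g)) \<le> (\<integral>s. cmod (f s) * B \<partial>\<mu>)" for x
  proof -
    have "cmod (L2_inner \<mu> f (tf_shift x g)) \<le> (\<integral>s. cmod (f s * cnj (g (s - snd x))) \<partial>\<mu>)"
      unfolding coefficient_eq_fourier
      by (rule fourier_bound[OF haar coefficient_integrable[OF coefficient]])
    also have "\<dots> \<le> (\<integral>s. cmod (f s) * B \<partial>\<mu>)"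
      by (intro integral_mono integrable_norm coefficient_integrable coefficient integrable_mult_left
          schwartz_integrable) (simp add: norm_mult mult_left_mono B)
    finally show ?thesis .
  qed
  then show ?case unfolding bounded_iff by blast
next
  case (lincomb u v c)
  then show ?case by (intro bounded_plus_comp bounded_cmult_range)
qed

text \<open>The phase coordinates preserve the class of matrix coefficients and its members are
  bounded, so \<open>weight_boundI\<close> dominates the coefficient by the summable weight.\<close>

lemma coefficient_summable_on_subgroup:
  assumes f: "f \<in> schwartz" and g: "g \<in> schwartz"
    and diff: "\<And>x y. x \<in> L \<Longrightarrow> y \<in> L \<Longrightarrow> x - y \<in> L"
    and U: "open U" "0 \<in> U" "finite (L \<inter> U)"
  shows "(\<lambda>x. cmod (L2_inner \<mu> f (tf_shift x g))) summable_on L"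
proof -
  obtain C where C: "\<And>x. cmod (L2_inner \<mu> f (tf_shift x g)) \<le> C * weight phase_coordinates x"
  proof (rule weight_boundI[where S = "matrix_coefficients \<mu>" and f = "\<lambda>x. L2_inner \<mu> f (tf_shift x g)" and qs = phase_coordinates])
    show "(\<lambda>s. complex_of_real (r s) * u s) \<in> matrix_coefficients \<mu>"
      if "u \<in> matrix_coefficients \<mu>" "r \<in> set phase_coordinates" for u r
    proof -
      consider q where "q \<in> set qs" "r = (\<lambda>x. q (snd x))" | X where "X \<in> set Ys" "r = (\<lambda>x. frequency X (fst x))"
        using \<open>r \<in> set phase_coordinates\<close> by (auto simp: phase_coordinates_def)
      then show ?thesis
        by cases (use that qs Ys matrix_coefficients_real_character matrix_coefficients_frequency in auto)
    qed
  qed (use f g in \<open>blast intro: coefficient matrix_coefficients_add matrix_coefficients_bounded\<close>)+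
  have "(\<lambda>x. C * weight phase_coordinates x) summable_on L"
    by (rule summable_on_cmult_right[OF weight_summable_on_subgroup[OF diff U]])
  then show ?thesis by (rule summable_on_comparison_test) (use C in auto)
qed

text \<open>A summable family has countable support, and the weight vanishes nowhere.\<close>

lemma countable_subgroup:
  fixes L :: "('g dual_group \<times> 'g) set"
  assumes diff: "\<And>x y. x \<in> L \<Longrightarrow> y \<in> L \<Longrightarrow> x - y \<in> L"
    and U: "open U" "0 \<in> U" "finite (L \<inter> U)"
  shows "countable L"
proof -
  have "(\<lambda>x. norm (weight phase_coordinates x)) = weight phase_coordinates"
    by (simp add: fun_eq_iff abs_of_pos weight_pos)
  then have "integrable (count_space L) (weight phase_coordinates)"
    using weight_summable_on_subgroup[OF assms] summable_on_norm_iff_integrable[of "weight phase_coordinates" L]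
    by (simp only:)
  then have "countable {x \<in> L. weight phase_coordinates x \<noteq> 0}"
    by (intro Infinite_Sum.abs_summable_countable) (simp only: summable_on_norm_iff_integrable)
  then show ?thesis using weight_pos[of phase_coordinates] by (simp add: less_imp_neq[symmetric])
qed

end

section \<open>Operator series\<close>

text \<open>The shape shared by the time-frequency shifts on both groups and by their adjoints. It
  carries what the estimates for series use: linearity, measurability and, by invariance of Haar
  measure, preservation of the integrals of functions of the modulus.\<close>

definition unimodular_shift :: "'x::topological_ab_group_add oper \<Rightarrow> bool" where
  "unimodular_shift T \<longleftrightarrow> (\<exists>u \<tau>. u \<in> borel_measurable borel \<and> (\<forall>s. cmod (u s) = 1) \<and>
     T = (\<lambda>\<xi> s. u s * \<xi> (\<tau> + s)))"

lemma evaluation_measurable: "(\<lambda>\<gamma>. character \<gamma> t) \<in> borel_measurable borel"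
  by (rule borel_measurable_continuous_onI[OF continuous_evaluation])

lemma unimodular_shift_tf_shift: "unimodular_shift (tf_shift x)"
proof -
  obtain \<gamma> t where x: "x = (\<gamma>, t)" by (cases x)
  show ?thesis unfolding unimodular_shift_def
    by (intro exI[of _ "character \<gamma>"] exI[of _ "- t"]) (simp add: x tf_shift_def character_measurable)
qed

lemma unimodular_shift_tf_shift_adj: "unimodular_shift (tf_shift_adj x)"
proof -
  obtain \<gamma> t where x: "x = (\<gamma>, t)" by (cases x)
  have "(\<lambda>s. character \<gamma> (t + s)) \<in> borel_measurable borel"
    by (rule measurable_compose[OF measurable_translation character_measurable])
  then have [measurable]: "(\<lambda>s. character \<gamma> (s + t)) \<in> borel_measurable borel"
    by (simp only: add.commute)
  show ?thesis unfolding unimodular_shift_def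
    by (intro exI[of _ "\<lambda>s. cnj (character \<gamma> (s + t))"] exI[of _ t])
      (simp add: x tf_shift_adj_def add.commute)
qed

lemma unimodular_shift_dual_tf_shift: "unimodular_shift (dual_tf_shift x)"
proof -
  obtain \<gamma> t where x: "x = (\<gamma>, t)" by (cases x)
  have "(\<lambda>\<delta>. character (- \<gamma> + \<delta>) t) \<in> borel_measurable borel"
    by (rule measurable_compose[OF measurable_translation evaluation_measurable])
  then have [measurable]: "(\<lambda>\<delta>. character (\<delta> - \<gamma>) t) \<in> borel_measurable borel" by simp
  show ?thesis unfolding unimodular_shift_def
    by (intro exI[of _ "\<lambda>\<delta>. cnj (character (\<delta> - \<gamma>) t)"] exI[of _ "- \<gamma>"])
      (simp add: x dual_tf_shift_def)
qed

lemma unimodular_shift_dual_tf_shift_adj: "unimodular_shift (dual_tf_shift_adj x)"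
proof -
  obtain \<gamma> t where x: "x = (\<gamma>, t)" by (cases x)
  show ?thesis unfolding unimodular_shift_def
    by (intro exI[of _ "\<lambda>\<delta>. character \<delta> t"] exI[of _ \<gamma>])
      (simp add: x dual_tf_shift_adj_def evaluation_measurable add.commute)
qed

lemma unimodular_shift_linear:
  "unimodular_shift T \<Longrightarrow> T (\<lambda>s. c * \<xi> s + \<eta> s) s = c * T \<xi> s + T \<eta> s"
  unfolding unimodular_shift_def by (auto simp: algebra_simps)

lemma unimodular_shift_measurable:
  assumes "unimodular_shift T" "\<xi> \<in> borel_measurable borel"
  shows "T \<xi> \<in> borel_measurable borel"
proof -
  obtain u \<tau> where u[measurable]: "u \<in> borel_measurable borel" and T: "T = (\<lambda>\<xi> s. u s * \<xi> (\<tau> + s))"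
    using assms(1) unfolding unimodular_shift_def by auto
  have [measurable]: "(\<lambda>s. \<xi> (\<tau> + s)) \<in> borel_measurable borel"
    by (rule measurable_compose[OF measurable_translation assms(2)])
  show ?thesis unfolding T by measurable
qed

lemma unimodular_shift_nn_integral:
  fixes F :: "real \<Rightarrow> ennreal"
  assumes "haar_measure M" "unimodular_shift T" and [measurable]: "\<xi> \<in> borel_measurable borel" "F \<in> borel_measurable borel"
  shows "(\<integral>\<^sup>+s. F (cmod (T \<xi> s)) \<partial>M) = (\<integral>\<^sup>+s. F (cmod (\<xi> s)) \<partial>M)"
proof -
  obtain u \<tau> where u: "\<And>s. cmod (u s) = 1" and T: "T = (\<lambda>\<xi> s. u s * \<xi> (\<tau> + s))"
    using assms(2) unfolding unimodular_shift_def by auto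
  have "(\<integral>\<^sup>+s. F (cmod (T \<xi> s)) \<partial>M) = (\<integral>\<^sup>+s. F (cmod (\<xi> (\<tau> + s))) \<partial>M)"
    by (simp add: T norm_mult u)
  also have "\<dots> = (\<integral>\<^sup>+s. F (cmod (\<xi> s)) \<partial>M)"
    by (rule haar_translate_nn_integral[OF assms(1)]) measurable
  finally show ?thesis .
qed

section \<open>Estimates in L2 and extension by density\<close>

definition L2_nn :: "'x measure \<Rightarrow> ('x \<Rightarrow> complex) \<Rightarrow> ennreal"
  where "L2_nn M \<xi> = (\<integral>\<^sup>+s. ennreal ((cmod (\<xi> s))\<^sup>2) \<partial>M)"

lemma L2_space_iff: "\<xi> \<in> L2_space M \<longleftrightarrow> \<xi> \<in> borel_measurable M \<and> L2_nn M \<xi> < \<infinity>"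
  by (auto simp: L2_space_def L2_nn_def integrable_iff_bounded)

lemma L2_nn_eq_integral: "\<xi> \<in> L2_space M \<Longrightarrow> L2_nn M \<xi> = ennreal (\<integral>s. (cmod (\<xi> s))\<^sup>2 \<partial>M)"
  unfolding L2_nn_def by (rule nn_integral_eq_integral) (auto simp: L2_space_def)

lemma L2_nn_cong_AE: "AE s in M. \<xi> s = \<eta> s \<Longrightarrow> L2_nn M \<xi> = L2_nn M \<eta>"
  unfolding L2_nn_def by (intro nn_integral_cong_AE) auto

lemma L2_nn_eq_0:
  assumes "\<xi> \<in> borel_measurable M" "L2_nn M \<xi> = 0"
  shows "AE s in M. \<xi> s = 0"
  using assms unfolding L2_nn_def by (subst (asm) nn_integral_0_iff_AE) auto

lemma L2_nn_lincomb_le: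
  assumes [measurable]: "\<xi> \<in> borel_measurable M" "\<eta> \<in> borel_measurable M"
  shows "L2_nn M (\<lambda>s. c * \<xi> s + \<eta> s) \<le> ennreal (2 * (cmod c)\<^sup>2) * L2_nn M \<xi> + 2 * L2_nn M \<eta>"
proof -
  have le: "(cmod (c * x + y))\<^sup>2 \<le> 2 * (cmod c)\<^sup>2 * (cmod x)\<^sup>2 + 2 * (cmod y)\<^sup>2" for x y
  proof -
    have "(cmod (c * x + y))\<^sup>2 \<le> (cmod (c * x) + cmod y)\<^sup>2" by (intro power_mono norm_triangle_ineq) simp
    also have "\<dots> \<le> 2 * (cmod (c * x))\<^sup>2 + 2 * (cmod y)\<^sup>2"
      using zero_le_power2[of "cmod (c * x) - cmod y"] by (simp add: power2_eq_square algebra_simps)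
    finally show ?thesis by (simp add: norm_mult power_mult_distrib)
  qed
  have "L2_nn M (\<lambda>s. c * \<xi> s + \<eta> s) \<le> (\<integral>\<^sup>+s. ennreal (2 * (cmod c)\<^sup>2) * ennreal ((cmod (\<xi> s))\<^sup>2) + 2 * ennreal ((cmod (\<eta> s))\<^sup>2) \<partial>M)"
    unfolding L2_nn_def
  proof (rule nn_integral_mono)
    fix s
    have "ennreal ((cmod (c * \<xi> s + \<eta> s))\<^sup>2) \<le> ennreal (2 * (cmod c)\<^sup>2 * (cmod (\<xi> s))\<^sup>2 + 2 * (cmod (\<eta> s))\<^sup>2)"
      by (rule ennreal_leI[OF le])
    also have "\<dots> = ennreal (2 * (cmod c)\<^sup>2) * ennreal ((cmod (\<xi> s))\<^sup>2) + ennreal 2 * ennreal ((cmod (\<eta> s))\<^sup>2)"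
      by (subst ennreal_plus) (auto simp: ennreal_mult simp del: ennreal_numeral)
    finally show "ennreal ((cmod (c * \<xi> s + \<eta> s))\<^sup>2) \<le> ennreal (2 * (cmod c)\<^sup>2) * ennreal ((cmod (\<xi> s))\<^sup>2) + 2 * ennreal ((cmod (\<eta> s))\<^sup>2)"
      by simp
  qed
  also have "\<dots> = ennreal (2 * (cmod c)\<^sup>2) * L2_nn M \<xi> + 2 * L2_nn M \<eta>"
    unfolding L2_nn_def by (subst nn_integral_add) (auto simp: nn_integral_cmult)
  finally show ?thesis .
qed

lemma L2_space_lincomb:
  assumes "\<xi> \<in> L2_space M" "\<eta> \<in> L2_space M"
  shows "(\<lambda>s. c * \<xi> s + \<eta> s) \<in> L2_space M"
proof -
  have m [measurable]: "\<xi> \<in> borel_measurable M" "\<eta> \<in> borel_measurable M" and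
    f: "L2_nn M \<xi> < \<infinity>" "L2_nn M \<eta> < \<infinity>" using assms by (auto simp: L2_space_iff)
  have "ennreal (2 * (cmod c)\<^sup>2) * L2_nn M \<xi> + 2 * L2_nn M \<eta> < \<infinity>"
    using f by (simp add: ennreal_mult_less_top)
  with L2_nn_lincomb_le[OF m, of c] show ?thesis
    unfolding L2_space_iff by (auto intro: le_less_trans)
qed

lemma L2_space_diff:
  assumes "\<xi> \<in> L2_space M" "\<eta> \<in> L2_space M"
  shows "(\<lambda>s. \<xi> s - \<eta> s) \<in> L2_space M"
  using L2_space_lincomb[OF assms(2,1), of "- 1"] by simp

text \<open>The estimate is imposed on differences because operator series are linear only almost
  everywhere. In this form the property passes to compositions and linear combinations; C compares
  squared norms.\<close>

definition L2_lipschitz :: "'x measure \<Rightarrow> 'x oper \<Rightarrow> bool" where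
  "L2_lipschitz M \<Phi> \<longleftrightarrow> (\<forall>\<xi>\<in>L2_space M. \<Phi> \<xi> \<in> L2_space M) \<and>
     (\<exists>C<\<infinity>. \<forall>\<xi>\<in>L2_space M. \<forall>\<eta>\<in>L2_space M. L2_nn M (\<lambda>s. \<Phi> \<xi> s - \<Phi> \<eta> s) \<le> C * L2_nn M (\<lambda>s. \<xi> s - \<eta> s))"

lemma L2_lipschitz_space: "L2_lipschitz M \<Phi> \<Longrightarrow> \<xi> \<in> L2_space M \<Longrightarrow> \<Phi> \<xi> \<in> L2_space M"
  by (simp add: L2_lipschitz_def)

lemma L2_lipschitz_id: "L2_lipschitz M (\<lambda>\<xi>. \<xi>)"
  unfolding L2_lipschitz_def by (auto intro!: exI[of _ 1])

lemma L2_lipschitz_zero: "L2_lipschitz M (\<lambda>\<xi> s. 0)"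
  unfolding L2_lipschitz_def by (auto intro!: exI[of _ 0] simp: L2_nn_def L2_space_def)

lemma L2_lipschitz_comp:
  assumes "L2_lipschitz M \<Phi>" "L2_lipschitz M \<Psi>"
  shows "L2_lipschitz M (\<lambda>\<xi>. \<Phi> (\<Psi> \<xi>))"
proof -
  obtain C where C: "C < \<infinity>" "\<And>\<xi> \<eta>. \<xi> \<in> L2_space M \<Longrightarrow> \<eta> \<in> L2_space M \<Longrightarrow>
      L2_nn M (\<lambda>s. \<Phi> \<xi> s - \<Phi> \<eta> s) \<le> C * L2_nn M (\<lambda>s. \<xi> s - \<eta> s)"
    using assms(1) unfolding L2_lipschitz_def by blast
  obtain D where D: "D < \<infinity>" "\<And>\<xi> \<eta>. \<xi> \<in> L2_space M \<Longrightarrow> \<eta> \<in> L2_space M \<Longrightarrow>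
      L2_nn M (\<lambda>s. \<Psi> \<xi> s - \<Psi> \<eta> s) \<le> D * L2_nn M (\<lambda>s. \<xi> s - \<eta> s)"
    using assms(2) unfolding L2_lipschitz_def by blast
  note sp = L2_lipschitz_space[OF assms(1)] L2_lipschitz_space[OF assms(2)]
  have "L2_nn M (\<lambda>s. \<Phi> (\<Psi> \<xi>) s - \<Phi> (\<Psi> \<eta>) s) \<le> (C * D) * L2_nn M (\<lambda>s. \<xi> s - \<eta> s)"
    if "\<xi> \<in> L2_space M" "\<eta> \<in> L2_space M" for \<xi> \<eta>
    using order_trans[OF C(2)[OF sp(2)[OF that(1)] sp(2)[OF that(2)]] mult_left_mono[OF D(2)[OF that]]]
    by (simp add: mult.assoc)
  moreover have "C * D < \<infinity>" using C D by (simp add: ennreal_mult_less_top)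
  ultimately show ?thesis using sp unfolding L2_lipschitz_def by blast
qed

lemma L2_lipschitz_lincomb:
  assumes "L2_lipschitz M \<Phi>" "L2_lipschitz M \<Psi>"
  shows "L2_lipschitz M (\<lambda>\<xi> s. c * \<Phi> \<xi> s + \<Psi> \<xi> s)"
proof -
  obtain C where C: "C < \<infinity>" "\<And>\<xi> \<eta>. \<xi> \<in> L2_space M \<Longrightarrow> \<eta> \<in> L2_space M \<Longrightarrow>
      L2_nn M (\<lambda>s. \<Phi> \<xi> s - \<Phi> \<eta> s) \<le> C * L2_nn M (\<lambda>s. \<xi> s - \<eta> s)"
    using assms(1) unfolding L2_lipschitz_def by blast
  obtain D where D: "D < \<infinity>" "\<And>\<xi> \<eta>. \<xi> \<in> L2_space M \<Longrightarrow> \<eta> \<in> L2_space M \<Longrightarrow>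
      L2_nn M (\<lambda>s. \<Psi> \<xi> s - \<Psi> \<eta> s) \<le> D * L2_nn M (\<lambda>s. \<xi> s - \<eta> s)"
    using assms(2) unfolding L2_lipschitz_def by blast
  note sp = L2_lipschitz_space[OF assms(1)] L2_lipschitz_space[OF assms(2)]
  let ?E = "ennreal (2 * (cmod c)\<^sup>2) * C + 2 * D"
  have "L2_nn M (\<lambda>s. (c * \<Phi> \<xi> s + \<Psi> \<xi> s) - (c * \<Phi> \<eta> s + \<Psi> \<eta> s)) \<le> ?E * L2_nn M (\<lambda>s. \<xi> s - \<eta> s)"
    if "\<xi> \<in> L2_space M" "\<eta> \<in> L2_space M" for \<xi> \<eta>
  proof -
    have m: "(\<lambda>s. \<Phi> \<xi> s - \<Phi> \<eta> s) \<in> borel_measurable M" "(\<lambda>s. \<Psi> \<xi> s - \<Psi> \<eta> s) \<in> borel_measurable M"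
      using L2_space_diff[OF sp(1)[OF that(1)] sp(1)[OF that(2)]] L2_space_diff[OF sp(2)[OF that(1)] sp(2)[OF that(2)]]
      by (auto simp: L2_space_iff)
    have "(\<lambda>s. (c * \<Phi> \<xi> s + \<Psi> \<xi> s) - (c * \<Phi> \<eta> s + \<Psi> \<eta> s)) = (\<lambda>s. c * (\<Phi> \<xi> s - \<Phi> \<eta> s) + (\<Psi> \<xi> s - \<Psi> \<eta> s))"
      by (simp add: algebra_simps)
    then have "L2_nn M (\<lambda>s. (c * \<Phi> \<xi> s + \<Psi> \<xi> s) - (c * \<Phi> \<eta> s + \<Psi> \<eta> s))
        \<le> ennreal (2 * (cmod c)\<^sup>2) * L2_nn M (\<lambda>s. \<Phi> \<xi> s - \<Phi> \<eta> s) + 2 * L2_nn M (\<lambda>s. \<Psi> \<xi> s - \<Psi> \<eta> s)"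
      using L2_nn_lincomb_le[OF m, of c] by simp
    also have "\<dots> \<le> ennreal (2 * (cmod c)\<^sup>2) * (C * L2_nn M (\<lambda>s. \<xi> s - \<eta> s)) + 2 * (D * L2_nn M (\<lambda>s. \<xi> s - \<eta> s))"
      by (intro add_mono mult_left_mono C D that) auto
    finally show ?thesis by (simp add: algebra_simps)
  qed
  moreover have "?E < \<infinity>" using C D by (simp add: ennreal_mult_less_top)
  moreover have "(\<lambda>s. c * \<Phi> \<xi> s + \<Psi> \<xi> s) \<in> L2_space M" if "\<xi> \<in> L2_space M" for \<xi>
    by (intro L2_space_lincomb sp that)
  ultimately show ?thesis unfolding L2_lipschitz_def by blast
qed

lemma fourier_L2: "plancherel \<mu> \<nu> \<Longrightarrow> f \<in> L1_space \<mu> \<inter> L2_space \<mu> \<Longrightarrow> fourier \<mu> f \<in> L2_space \<nu>"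
  by (auto simp: plancherel_def)

text \<open>The difference of the two operators is Lipschitz and vanishes on the transforms of L1
  \<inter> L2, which are dense by Plancherel; so its value at any \<eta> has squared norm at most C
  e for every e > 0.\<close>

lemma L2_lipschitz_eqI:
  assumes pl: "plancherel \<mu> \<nu>" and lip: "L2_lipschitz \<nu> \<Phi>" "L2_lipschitz \<nu> \<Psi>"
    and eq: "\<And>f. f \<in> L1_space \<mu> \<inter> L2_space \<mu> \<Longrightarrow> AE s in \<nu>. \<Phi> (fourier \<mu> f) s = \<Psi> (fourier \<mu> f) s"
  shows "op_eq \<nu> \<Phi> \<Psi>"
  unfolding op_eq_def
proof
  fix \<eta> assume \<eta>: "\<eta> \<in> L2_space \<nu>"
  let ?\<Xi> = "\<lambda>\<xi> s. - 1 * \<Psi> \<xi> s + \<Phi> \<xi> s"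
  have lip\<Xi>: "L2_lipschitz \<nu> ?\<Xi>" by (rule L2_lipschitz_lincomb[OF lip(2,1)])
  then obtain C where C: "C < \<infinity>" "\<And>\<xi> \<eta>. \<xi> \<in> L2_space \<nu> \<Longrightarrow> \<eta> \<in> L2_space \<nu> \<Longrightarrow>
      L2_nn \<nu> (\<lambda>s. ?\<Xi> \<xi> s - ?\<Xi> \<eta> s) \<le> C * L2_nn \<nu> (\<lambda>s. \<xi> s - \<eta> s)"
    unfolding L2_lipschitz_def by blast
  have le: "L2_nn \<nu> (?\<Xi> \<eta>) \<le> C * ennreal e" if "e > 0" for e
  proof -
    obtain f where f: "f \<in> L1_space \<mu> \<inter> L2_space \<mu>" "(\<integral>\<gamma>. (cmod (\<eta> \<gamma> - fourier \<mu> f \<gamma>))\<^sup>2 \<partial>\<nu>) < e"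
      using pl \<eta> \<open>e > 0\<close> unfolding plancherel_def by blast
    note f' = fourier_L2[OF pl f(1)]
    have "AE s in \<nu>. ?\<Xi> \<eta> s = ?\<Xi> \<eta> s - ?\<Xi> (fourier \<mu> f) s" using eq[OF f(1)] by eventually_elim simp
    then have "L2_nn \<nu> (?\<Xi> \<eta>) = L2_nn \<nu> (\<lambda>s. ?\<Xi> \<eta> s - ?\<Xi> (fourier \<mu> f) s)" by (rule L2_nn_cong_AE)
    also have "\<dots> \<le> C * L2_nn \<nu> (\<lambda>s. \<eta> s - fourier \<mu> f s)" by (rule C(2)[OF \<eta> f'])
    also have "\<dots> \<le> C * ennreal e"
      unfolding L2_nn_eq_integral[OF L2_space_diff[OF \<eta> f']] using f(2)
      by (intro mult_left_mono ennreal_leI) auto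
    finally show ?thesis .
  qed
  have "L2_nn \<nu> (?\<Xi> \<eta>) = 0"
  proof (cases C)
    case (real c)
    have small: "L2_nn \<nu> (?\<Xi> \<eta>) \<le> ennreal e" if "e > 0" for e
    proof -
      \<comment> \<open>Dividing by c + 1 instead of c covers c = 0.\<close>
      have "c * (e / (c + 1)) \<le> e" using real \<open>e > 0\<close> by (simp add: divide_le_eq)
      moreover have "L2_nn \<nu> (?\<Xi> \<eta>) \<le> ennreal c * ennreal (e / (c + 1))"
        using le[of "e / (c + 1)"] real \<open>e > 0\<close> by simp
      ultimately show ?thesis
        using real \<open>e > 0\<close> by (simp add: ennreal_mult[symmetric]) (meson ennreal_leI order_trans)
    qed
    have "L2_nn \<nu> (?\<Xi> \<eta>) \<le> 0" by (rule ennreal_le_epsilon) (simp only: add_0 small)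
    then show ?thesis by (simp only: le_zero_eq)
  qed (use C in simp)
  moreover have "?\<Xi> \<eta> \<in> borel_measurable \<nu>" using L2_lipschitz_space[OF lip\<Xi> \<eta>] by (simp add: L2_space_iff)
  ultimately have "AE s in \<nu>. ?\<Xi> \<eta> s = 0" by (intro L2_nn_eq_0)
  then show "AE s in \<nu>. \<Phi> \<eta> s = \<Psi> \<eta> s" by eventually_elim simp
qed

text \<open>If the series does not converge absolutely, both sides are 0.\<close>

lemma op_series_eq_integral:
  "op_series \<rho> L a \<xi> s = (\<integral>x. a x * \<rho> x \<xi> s \<partial>count_space L)"
proof (cases "(\<lambda>x. a x * \<rho> x \<xi> s) summable_on L")
  case True
  then have "integrable (count_space L) (\<lambda>x. a x * \<rho> x \<xi> s)"
    by (simp only: summable_on_iff_abs_summable_on_complex summable_on_norm_iff_integrable)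
  then have "infsetsum (\<lambda>x. a x * \<rho> x \<xi> s) L = infsum (\<lambda>x. a x * \<rho> x \<xi> s) L"
    by (intro infsetsum_infsum) (simp only: Infinite_Set_Sum.abs_summable_on_def)
  then show ?thesis by (simp add: op_series_def infsetsum_def)
next
  case False
  then have "\<not> integrable (count_space L) (\<lambda>x. a x * \<rho> x \<xi> s)"
    by (simp only: summable_on_iff_abs_summable_on_complex summable_on_norm_iff_integrable not_False_eq_True)
  then show ?thesis using False
    by (simp add: op_series_def infsum_not_exists not_integrable_integral_eq)
qed

locale shift_series =
  fixes M :: "'x::topological_ab_group_add measure" and \<rho> :: "'i \<Rightarrow> 'x oper" and L :: "'i set" and a :: "'i \<Rightarrow> complex"
  assumes haar: "haar_measure M" and countable: "countable L"
    and shift: "\<And>x. x \<in> L \<Longrightarrow> unimodular_shift (\<rho> x)"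
    and summable: "(\<lambda>x. cmod (a x)) summable_on L"
begin

definition total :: ennreal where "total = (\<integral>\<^sup>+x. ennreal (cmod (a x)) \<partial>count_space L)"

lemma total_finite: "total < \<infinity>"
  using summable unfolding summable_on_norm_iff_integrable total_def by (simp add: integrable_iff_bounded)

lemma borel: "borel_measurable M = borel_measurable borel" by (rule haar_borel_measurable[OF haar])

lemma measurable_term: "\<xi> \<in> borel_measurable borel \<Longrightarrow> x \<in> L \<Longrightarrow> \<rho> x \<xi> \<in> borel_measurable borel"
  by (rule unimodular_shift_measurable[OF shift])

text \<open>Countability of L reduces joint measurability to one index at a time; the exchange of
  sum and integral in \<open>fourier_op_series\<close> rests on it.\<close>

lemma measurable_pair:
  assumes \<xi>: "\<xi> \<in> borel_measurable borel"
  shows "(\<lambda>(s, x). a x * \<rho> x \<xi> s) \<in> borel_measurable (M \<Otimes>\<^sub>M count_space L)"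
proof -
  have "(\<lambda>z. a (snd z) * \<rho> (snd z) \<xi> (fst z)) \<in> borel_measurable (M \<Otimes>\<^sub>M count_space L)"
  proof (rule measurable_compose_countable'[where f = "\<lambda>x z. a x * \<rho> x \<xi> (fst z)" and g = snd and I = L])
    fix x assume "x \<in> L"
    then have [measurable]: "\<rho> x \<xi> \<in> borel_measurable M" unfolding borel by (rule measurable_term[OF \<xi>])
    show "(\<lambda>z. a x * \<rho> x \<xi> (fst z)) \<in> borel_measurable (M \<Otimes>\<^sub>M count_space L)" by measurable
  qed (auto simp: countable)
  then show ?thesis by (simp add: case_prod_unfold)
qed

lemma op_series_measurable:
  assumes "\<xi> \<in> borel_measurable borel"
  shows "op_series \<rho> L a \<xi> \<in> borel_measurable borel"
proof -
  interpret sigma_finite_measure "count_space L" by (rule sigma_finite_measure_count_space_countable[OF countable])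
  have "(\<lambda>s. \<integral>x. a x * \<rho> x \<xi> s \<partial>count_space L) \<in> borel_measurable M"
    by (rule borel_measurable_lebesgue_integral[OF measurable_pair[OF assms]])
  then show ?thesis by (simp add: op_series_eq_integral[abs_def] borel)
qed

text \<open>Cauchy-Schwarz with |a| split as sqrt |a| times sqrt |a| bounds the squared sum by
  \<open>total\<close> times the sum of |a| |\<rho> \<xi>|^2. Integrated term by term, where each
  shift preserves the norm, the latter sum gives the second factor \<open>total\<close>.\<close>

lemma nn_integral_square_le:
  assumes \<xi>: "\<xi> \<in> borel_measurable borel"
  shows "(\<integral>\<^sup>+s. (\<integral>\<^sup>+x. ennreal (cmod (a x * \<rho> x \<xi> s)) \<partial>count_space L)\<^sup>2 \<partial>M) \<le> total\<^sup>2 * L2_nn M \<xi>"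
proof -
  let ?b = "\<lambda>x. ennreal (cmod (a x))" and ?n = "\<lambda>x s. ennreal ((cmod (\<rho> x \<xi> s))\<^sup>2)"
  let ?G = "\<lambda>s. \<integral>\<^sup>+x. ennreal (cmod (a x * \<rho> x \<xi> s)) \<partial>count_space L"
  have sq: "ennreal (sqrt y) * ennreal (sqrt y) = ennreal y" if "y \<ge> 0" for y :: real
    using that by (simp add: ennreal_mult[symmetric])
  have "(?G s)\<^sup>2
      \<le> total * (\<integral>\<^sup>+x. ?b x * ?n x s \<partial>count_space L)" for s
  proof -
    let ?f = "\<lambda>x. ennreal (sqrt (cmod (a x)))"
    have "?G s
        = (\<integral>\<^sup>+x. ?f x * (?f x * ennreal (cmod (\<rho> x \<xi> s))) \<partial>count_space L)"
      by (intro nn_integral_cong) (simp add: mult.assoc[symmetric] sq norm_mult ennreal_mult)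
    then have "(?G s)\<^sup>2
        \<le> (\<integral>\<^sup>+x. (?f x)\<^sup>2 \<partial>count_space L) * (\<integral>\<^sup>+x. (?f x * ennreal (cmod (\<rho> x \<xi> s)))\<^sup>2 \<partial>count_space L)"
      using Cauchy_Schwarz_nn_integral[of ?f "count_space L" "\<lambda>x. ?f x * ennreal (cmod (\<rho> x \<xi> s))"] by simp
    also have "(\<integral>\<^sup>+x. (?f x)\<^sup>2 \<partial>count_space L) = total"
      unfolding total_def by (intro nn_integral_cong) (simp add: power2_eq_square sq)
    also have "(\<integral>\<^sup>+x. (?f x * ennreal (cmod (\<rho> x \<xi> s)))\<^sup>2 \<partial>count_space L)
        = (\<integral>\<^sup>+x. ?b x * ?n x s \<partial>count_space L)"
    proof (intro nn_integral_cong)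
      fix x
      have "(?f x * ennreal (cmod (\<rho> x \<xi> s)))\<^sup>2 = (?f x * ?f x) * (ennreal (cmod (\<rho> x \<xi> s)) * ennreal (cmod (\<rho> x \<xi> s)))"
        by (simp only: power2_eq_square mult_ac)
      then show "(?f x * ennreal (cmod (\<rho> x \<xi> s)))\<^sup>2 = ?b x * ?n x s"
        by (simp add: sq power2_eq_square ennreal_mult)
    qed
    finally show ?thesis .
  qed
  then have "(\<integral>\<^sup>+s. (?G s)\<^sup>2 \<partial>M)
      \<le> (\<integral>\<^sup>+s. total * (\<integral>\<^sup>+x. ?b x * ?n x s \<partial>count_space L) \<partial>M)"
    by (rule nn_integral_mono)
  also have "\<dots> = (\<integral>\<^sup>+s. (\<integral>\<^sup>+x. total * (?b x * ?n x s) \<partial>count_space L) \<partial>M)"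
    by (intro nn_integral_cong nn_integral_cmult[symmetric]) simp
  also have "\<dots> = (\<integral>\<^sup>+x. (\<integral>\<^sup>+s. total * (?b x * ?n x s) \<partial>M) \<partial>count_space L)"
  proof (rule nn_integral_count_space_nn_integral[OF countable])
    fix x assume "x \<in> L"
    then have [measurable]: "\<rho> x \<xi> \<in> borel_measurable M" unfolding borel by (rule measurable_term[OF \<xi>])
    show "(\<lambda>s. total * (?b x * ?n x s)) \<in> borel_measurable M" by measurable
  qed
  also have "\<dots> = (\<integral>\<^sup>+x. total * L2_nn M \<xi> * ?b x \<partial>count_space L)"
  proof (intro nn_integral_cong)
    fix x assume "x \<in> space (count_space L)"
    then have x: "x \<in> L" by simp
    then have [measurable]: "\<rho> x \<xi> \<in> borel_measurable M" unfolding borel by (rule measurable_term[OF \<xi>])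
    have "(\<integral>\<^sup>+s. total * (?b x * ?n x s) \<partial>M) = total * ?b x * (\<integral>\<^sup>+s. ?n x s \<partial>M)"
      unfolding mult.assoc[symmetric] by (rule nn_integral_cmult) measurable
    also have "(\<integral>\<^sup>+s. ?n x s \<partial>M) = L2_nn M \<xi>"
      unfolding L2_nn_def by (rule unimodular_shift_nn_integral[OF haar shift[OF x] \<xi>, of "\<lambda>r. ennreal (r\<^sup>2)"]) measurable
    finally show "(\<integral>\<^sup>+s. total * (?b x * ?n x s) \<partial>M) = total * L2_nn M \<xi> * ?b x"
      by (simp add: mult_ac)
  qed
  also have "\<dots> = total * L2_nn M \<xi> * total"
    unfolding total_def by (intro nn_integral_cmult) simp
  finally show ?thesis by (simp add: power2_eq_square mult_ac)
qed

lemma L2_measurable: "\<xi> \<in> L2_space M \<Longrightarrow> \<xi> \<in> borel_measurable borel"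
  by (simp add: L2_space_iff borel)

text \<open>The squared sum of the moduli has finite integral, so it is finite almost
  everywhere.\<close>

lemma op_series_L2_integrable:
  assumes "\<xi> \<in> L2_space M"
  shows "AE s in M. integrable (count_space L) (\<lambda>x. a x * \<rho> x \<xi> s)"
proof -
  interpret sigma_finite_measure "count_space L" by (rule sigma_finite_measure_count_space_countable[OF countable])
  note \<xi> = L2_measurable[OF assms]
  let ?G = "\<lambda>s. \<integral>\<^sup>+x. ennreal (cmod (a x * \<rho> x \<xi> s)) \<partial>count_space L"
  have "(\<lambda>(s, x). ennreal (cmod (a x * \<rho> x \<xi> s))) \<in> borel_measurable (M \<Otimes>\<^sub>M count_space L)"
    using measurable_pair[OF \<xi>] unfolding case_prod_unfold by measurable
  then have [measurable]: "?G \<in> borel_measurable M"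
    by (intro borel_measurable_nn_integral) (simp add: case_prod_unfold)
  have "(\<integral>\<^sup>+s. (?G s)\<^sup>2 \<partial>M) \<noteq> \<infinity>"
    using nn_integral_square_le[OF \<xi>] total_finite assms
    by (auto simp: L2_space_iff ennreal_mult_less_top power_less_top_ennreal top_unique ennreal_mult_eq_top_iff power_eq_top_ennreal)
  then have "AE s in M. (?G s)\<^sup>2 \<noteq> \<infinity>" by (intro nn_integral_PInf_AE) auto
  then show ?thesis
  proof eventually_elim
    case (elim s)
    then have "?G s \<noteq> \<infinity>" by (auto simp: power_eq_top_ennreal)
    then show ?case by (intro integrableI_bounded) (auto simp: less_top[symmetric])
  qed
qed

lemma op_series_L2_nn_le:
  assumes \<xi>: "\<xi> \<in> borel_measurable borel"
  shows "L2_nn M (op_series \<rho> L a \<xi>) \<le> total\<^sup>2 * L2_nn M \<xi>"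
proof -
  have "L2_nn M (op_series \<rho> L a \<xi>) \<le> (\<integral>\<^sup>+s. (\<integral>\<^sup>+x. ennreal (cmod (a x * \<rho> x \<xi> s)) \<partial>count_space L)\<^sup>2 \<partial>M)"
    unfolding L2_nn_def
  proof (rule nn_integral_mono)
    fix s
    let ?G = "\<integral>\<^sup>+x. ennreal (cmod (a x * \<rho> x \<xi> s)) \<partial>count_space L"
    \<comment> \<open>At a point of divergence the left side is 0.\<close>
    have "ennreal (cmod (op_series \<rho> L a \<xi> s)) \<le> ?G"
      unfolding op_series_eq_integral
      by (cases "integrable (count_space L) (\<lambda>x. a x * \<rho> x \<xi> s)")
        (auto simp: integral_norm_bound_ennreal not_integrable_integral_eq)
    then have "ennreal (cmod (op_series \<rho> L a \<xi> s)) * ennreal (cmod (op_series \<rho> L a \<xi> s)) \<le> ?G * ?G"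
      by (intro mult_mono) auto
    then show "ennreal ((cmod (op_series \<rho> L a \<xi> s))\<^sup>2) \<le> ?G\<^sup>2"
      by (simp add: power2_eq_square ennreal_mult)
  qed
  also note nn_integral_square_le[OF \<xi>]
  finally show ?thesis .
qed

lemma op_series_L2:
  assumes "\<xi> \<in> L2_space M"
  shows "op_series \<rho> L a \<xi> \<in> L2_space M"
proof -
  have "total\<^sup>2 * L2_nn M \<xi> < \<infinity>"
    using total_finite assms by (simp add: L2_space_iff ennreal_mult_less_top power_less_top_ennreal)
  then have "L2_nn M (op_series \<rho> L a \<xi>) < \<infinity>"
    using op_series_L2_nn_le[OF L2_measurable[OF assms]] by (rule le_less_trans[rotated])
  then show ?thesis using op_series_measurable[OF L2_measurable[OF assms]] by (simp add: L2_space_iff borel)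
qed

lemma op_series_lipschitz: "L2_lipschitz M (op_series \<rho> L a)"
proof -
  let ?T = "op_series \<rho> L a"
  have "L2_nn M (\<lambda>s. ?T \<xi> s - ?T \<eta> s) \<le> total\<^sup>2 * L2_nn M (\<lambda>s. \<xi> s - \<eta> s)"
    if \<xi>: "\<xi> \<in> L2_space M" and \<eta>: "\<eta> \<in> L2_space M" for \<xi> \<eta>
  proof -
    \<comment> \<open>The two series can be subtracted term by term only where both converge
      absolutely.\<close>
    have "AE s in M. ?T \<xi> s - ?T \<eta> s = ?T (\<lambda>s. \<xi> s - \<eta> s) s"
      using op_series_L2_integrable[OF \<xi>] op_series_L2_integrable[OF \<eta>]
    proof eventually_elim
      case (elim s)
      have "?T \<xi> s - ?T \<eta> s = (\<integral>x. a x * \<rho> x \<xi> s - a x * \<rho> x \<eta> s \<partial>count_space L)"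
        unfolding op_series_eq_integral using elim by simp
      also have "\<dots> = ?T (\<lambda>s. \<xi> s - \<eta> s) s"
        unfolding op_series_eq_integral
      proof (intro Bochner_Integration.integral_cong refl)
        fix x assume "x \<in> space (count_space L)"
        then have "\<rho> x (\<lambda>s. \<xi> s - \<eta> s) s = \<rho> x \<xi> s - \<rho> x \<eta> s"
          using unimodular_shift_linear[OF shift, of x "- 1" \<eta> \<xi> s] by simp
        then show "a x * \<rho> x \<xi> s - a x * \<rho> x \<eta> s = a x * \<rho> x (\<lambda>s. \<xi> s - \<eta> s) s"
          by (simp add: right_diff_distrib)
      qed
      finally show ?case .
    qed
    then have "L2_nn M (\<lambda>s. ?T \<xi> s - ?T \<eta> s) = L2_nn M (?T (\<lambda>s. \<xi> s - \<eta> s))" by (rule L2_nn_cong_AE)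
    also have "\<dots> \<le> total\<^sup>2 * L2_nn M (\<lambda>s. \<xi> s - \<eta> s)"
      by (rule op_series_L2_nn_le[OF L2_measurable[OF L2_space_diff[OF \<xi> \<eta>]]])
    finally show ?thesis .
  qed
  moreover have "total\<^sup>2 < \<infinity>" using total_finite by (simp add: power_less_top_ennreal)
  ultimately show ?thesis using op_series_L2 unfolding L2_lipschitz_def by blast
qed

end

section \<open>Operator series and the Fourier transform\<close>

lemma fourier_cong_AE:
  assumes "haar_measure \<mu>" "f \<in> borel_measurable borel" "g \<in> borel_measurable borel" "AE s in \<mu>. f s = g s"
  shows "fourier \<mu> f = fourier \<mu> g"
proof
  fix \<gamma>
  have [measurable]: "f \<in> borel_measurable \<mu>" "g \<in> borel_measurable \<mu>" "character \<gamma> \<in> borel_measurable \<mu>"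
    using assms character_measurable by (simp_all add: haar_borel_measurable)
  show "fourier \<mu> f \<gamma> = fourier \<mu> g \<gamma>"
    unfolding fourier_def using assms(4) by (intro integral_cong_AE) auto
qed

lemma L1_measurable: "haar_measure \<mu> \<Longrightarrow> f \<in> L1_space \<mu> \<Longrightarrow> f \<in> borel_measurable borel"
  by (metis L1_space_def borel_measurable_integrable haar_borel_measurable mem_Collect_eq)

text \<open>Modulation by \<gamma> becomes translation by \<gamma>, and translation by t becomes a
  phase. The phase is taken at \<delta> - \<gamma> because in \<open>tf_shift\<close> the
  translation acts before the modulation.\<close>

lemma fourier_tf_shift:
  assumes "haar_measure \<mu>" "f \<in> L1_space \<mu>"
  shows "fourier \<mu> (tf_shift x f) = dual_tf_shift x (fourier \<mu> f)"
proof
  fix \<delta>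
  obtain \<gamma> t where x: "x = (\<gamma>, t)" by (cases x)
  have "fourier \<mu> (tf_shift x f) \<delta> = fourier \<mu> (\<lambda>s. f (s + - t)) (\<delta> - \<gamma>)"
    by (simp add: fourier_def x tf_shift_def character_minus_dual mult_ac)
  also have "\<dots> = character (\<delta> - \<gamma>) (- t) * fourier \<mu> f (\<delta> - \<gamma>)"
    by (rule fourier_translate[OF assms(1) L1_measurable[OF assms]])
  finally show "fourier \<mu> (tf_shift x f) \<delta> = dual_tf_shift x (fourier \<mu> f) \<delta>"
    by (simp add: x dual_tf_shift_def character_minus)
qed

lemma fourier_tf_shift_adj:
  assumes "haar_measure \<mu>" "f \<in> L1_space \<mu>"
  shows "fourier \<mu> (tf_shift_adj x f) = dual_tf_shift_adj x (fourier \<mu> f)"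
proof
  fix \<delta>
  obtain \<gamma> t where x: "x = (\<gamma>, t)" by (cases x)
  let ?h = "\<lambda>s. cnj (character \<gamma> s) * f s"
  have [measurable]: "f \<in> borel_measurable borel" "character \<gamma> \<in> borel_measurable borel"
    using L1_measurable[OF assms] character_measurable by auto
  have "fourier \<mu> (tf_shift_adj x f) \<delta> = fourier \<mu> (\<lambda>s. ?h (s + t)) \<delta>"
    by (simp add: x tf_shift_adj_def)
  also have "\<dots> = character \<delta> t * fourier \<mu> ?h \<delta>"
    by (rule fourier_translate[OF assms(1)]) measurable
  also have "fourier \<mu> ?h \<delta> = fourier \<mu> f (\<delta> + \<gamma>)"
    by (simp add: fourier_def character_plus_dual mult_ac)
  finally show "fourier \<mu> (tf_shift_adj x f) \<delta> = dual_tf_shift_adj x (fourier \<mu> f) \<delta>"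
    by (simp add: x dual_tf_shift_adj_def)
qed

lemma unimodular_shift_L1_L2:
  assumes haar: "haar_measure \<mu>" and T: "unimodular_shift T" and f: "f \<in> L1_space \<mu> \<inter> L2_space \<mu>"
  shows "T f \<in> L1_space \<mu> \<inter> L2_space \<mu>"
proof -
  have m: "f \<in> borel_measurable borel" using f L1_measurable[OF haar] by blast
  have "(\<integral>\<^sup>+s. ennreal (cmod (T f s)) \<partial>\<mu>) = (\<integral>\<^sup>+s. ennreal (cmod (f s)) \<partial>\<mu>)"
    by (rule unimodular_shift_nn_integral[OF haar T m]) measurable
  moreover have "L2_nn \<mu> (T f) = L2_nn \<mu> f"
    unfolding L2_nn_def by (rule unimodular_shift_nn_integral[OF haar T m, of "\<lambda>r. ennreal (r\<^sup>2)"]) measurable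
  ultimately show ?thesis
    using f unimodular_shift_measurable[OF T m]
    by (simp add: L1_space_def L2_space_iff integrable_iff_bounded haar_borel_measurable[OF haar])
qed

text \<open>\<open>plancherel\<close> speaks of norms, so inner products are recovered from the
  norms of f + c g, with c running through the fourth roots of unity.\<close>

lemma L2_inner_polarization:
  assumes f: "f \<in> L2_space M" and g: "g \<in> L2_space M"
  shows "4 * L2_inner M f g = of_real (\<integral>s. (cmod (1 * g s + f s))\<^sup>2 \<partial>M) - of_real (\<integral>s. (cmod (- 1 * g s + f s))\<^sup>2 \<partial>M)
    + \<i> * of_real (\<integral>s. (cmod (\<i> * g s + f s))\<^sup>2 \<partial>M) - \<i> * of_real (\<integral>s. (cmod (- \<i> * g s + f s))\<^sup>2 \<partial>M)"
proof -
  have i: "integrable M (\<lambda>s. (cmod (c * g s + f s))\<^sup>2)" for c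
    using L2_space_lincomb[OF g f, of c] by (simp add: L2_space_def)
  have pt: "4 * (z * cnj w) = of_real ((cmod (1 * w + z))\<^sup>2) - of_real ((cmod (- 1 * w + z))\<^sup>2)
      + \<i> * of_real ((cmod (\<i> * w + z))\<^sup>2) - \<i> * of_real ((cmod (- \<i> * w + z))\<^sup>2)" for z w
    unfolding complex_norm_square by (simp add: algebra_simps)
  have "4 * L2_inner M f g = (\<integral>s. 4 * (f s * cnj (g s)) \<partial>M)" by (simp add: L2_inner_def)
  also have "\<dots> = (\<integral>s. of_real ((cmod (1 * g s + f s))\<^sup>2) - of_real ((cmod (- 1 * g s + f s))\<^sup>2)
      + \<i> * of_real ((cmod (\<i> * g s + f s))\<^sup>2) - \<i> * of_real ((cmod (- \<i> * g s + f s))\<^sup>2) \<partial>M)"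
    unfolding pt ..
  also have "\<dots> = of_real (\<integral>s. (cmod (1 * g s + f s))\<^sup>2 \<partial>M) - of_real (\<integral>s. (cmod (- 1 * g s + f s))\<^sup>2 \<partial>M)
    + \<i> * of_real (\<integral>s. (cmod (\<i> * g s + f s))\<^sup>2 \<partial>M) - \<i> * of_real (\<integral>s. (cmod (- \<i> * g s + f s))\<^sup>2 \<partial>M)"
  proof -
    have j: "integrable M (\<lambda>s. complex_of_real ((cmod (c * g s + f s))\<^sup>2))" for c
      by (rule integrable_of_real[OF i])
    show ?thesis
      by (simp only: Bochner_Integration.integral_diff Bochner_Integration.integral_add j
          Bochner_Integration.integrable_diff Bochner_Integration.integrable_add integrable_mult_right
          integral_mult_right_zero integral_complex_of_real)
  qed
  finally show ?thesis .
qed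

lemma fourier_inner:
  assumes haar: "haar_measure \<mu>" and pl: "plancherel \<mu> \<nu>"
    and f: "f \<in> L1_space \<mu> \<inter> L2_space \<mu>" and g: "g \<in> L1_space \<mu> \<inter> L2_space \<mu>"
  shows "L2_inner \<nu> (fourier \<mu> f) (fourier \<mu> g) = L2_inner \<mu> f g"
proof -
  have eq: "(\<integral>\<gamma>. (cmod (c * fourier \<mu> g \<gamma> + fourier \<mu> f \<gamma>))\<^sup>2 \<partial>\<nu>) = (\<integral>s. (cmod (c * g s + f s))\<^sup>2 \<partial>\<mu>)" for c
  proof -
    have i: "integrable \<mu> f" "integrable \<mu> g" using f g by (auto simp: L1_space_def)
    have "(\<lambda>s. c * g s + f s) \<in> L1_space \<mu> \<inter> L2_space \<mu>"
      using f g L2_space_lincomb by (auto simp: L1_space_def)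
    then have "(\<integral>\<gamma>. (cmod (fourier \<mu> (\<lambda>s. c * g s + f s) \<gamma>))\<^sup>2 \<partial>\<nu>) = (\<integral>s. (cmod (c * g s + f s))\<^sup>2 \<partial>\<mu>)"
      using pl unfolding plancherel_def by blast
    moreover have "fourier \<mu> (\<lambda>s. c * g s + f s) \<gamma> = c * fourier \<mu> g \<gamma> + fourier \<mu> f \<gamma>" for \<gamma>
      by (simp add: fourier_add[OF haar] fourier_scale i)
    ultimately show ?thesis by simp
  qed
  have "4 * L2_inner \<nu> (fourier \<mu> f) (fourier \<mu> g) = 4 * L2_inner \<mu> f g"
    using L2_inner_polarization[OF fourier_L2[OF pl f] fourier_L2[OF pl g]]
      L2_inner_polarization[of f \<mu> g] f g by (simp only: eq IntD2)
  then show ?thesis by simp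
qed

lemma L2_inner_commute: "L2_inner M f g = cnj (L2_inner M g f)"
  using Bochner_Integration.integral_cnj[of M "\<lambda>s. g s * cnj (f s)"] unfolding L2_inner_def by (simp add: mult.commute del: Bochner_Integration.integral_cnj)

text \<open>The cocycle is a bicharacter, so the defining condition is multiplicative in x.\<close>

lemma adjoint_lattice_diff:
  assumes "x \<in> adjoint_lattice \<Lambda>" "y \<in> adjoint_lattice \<Lambda>"
  shows "x - y \<in> adjoint_lattice \<Lambda>"
proof -
  have "cocycle (x - y) z * cnj (cocycle z (x - y)) = 1" if "z \<in> \<Lambda>" for z
  proof -
    obtain \<gamma> t \<gamma>' t' \<delta> r where *: "x = (\<gamma>, t)" "y = (\<gamma>', t')" "z = (\<delta>, r)" by (metis surj_pair)
    have 1: "cnj (character \<delta> t) * character \<gamma> r = 1" "cnj (character \<delta> t') * character \<gamma>' r = 1"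
      using assms that by (auto simp: adjoint_lattice_def cocycle_def *)
    have "cnj (character \<delta> (t - t')) * character (\<gamma> - \<gamma>') r
        = (cnj (character \<delta> t) * character \<gamma> r) * cnj (cnj (character \<delta> t') * character \<gamma>' r)"
      by (simp add: character_diff character_minus_dual mult_ac)
    then show ?thesis unfolding 1 by (simp add: cocycle_def *)
  qed
  then show ?thesis by (simp add: adjoint_lattice_def)
qed

lemma lattice_locally_finite:
  assumes "is_lattice \<Lambda>"
  obtains U where "open U" "0 \<in> U" "finite (\<Lambda> \<inter> U)"
proof -
  have "0 isolated_in \<Lambda>" using assms by (auto simp: is_lattice_def discrete_def)
  then obtain U where "open U" "U \<inter> \<Lambda> = {0}" by (auto simp: isolated_in_def)
  then show ?thesis by (intro that[of U]) (auto simp: Int_commute)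
qed

lemma finite_large_terms:
  fixes f :: "'a \<Rightarrow> real"
  assumes "f summable_on L" "\<And>x. x \<in> L \<Longrightarrow> 0 \<le> f x" "\<epsilon> > 0"
  shows "finite {x\<in>L. \<epsilon> \<le> f x}"
proof (rule ccontr)
  assume inf: "infinite {x\<in>L. \<epsilon> \<le> f x}"
  obtain n :: nat where n: "infsum f L < real n * \<epsilon>" using reals_Archimedean3[OF assms(3)] by blast
  obtain F where F: "finite F" "card F = n" "F \<subseteq> {x\<in>L. \<epsilon> \<le> f x}"
    using infinite_arbitrarily_large[OF inf] by blast
  have "real n * \<epsilon> \<le> sum f F" using F sum_bounded_below[of F \<epsilon> f] by auto
  also have "\<dots> \<le> infsum f L" by (rule finite_sum_le_infsum[OF assms(1) F(1)]) (use F assms in auto)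
  finally show False using n by simp
qed

context haar_coordinates
begin

text \<open>The exhausting compact sets have finite Haar measure; Fubini for operator series needs
  this.\<close>

lemma sigma_finite: "sigma_finite_measure \<mu>"
proof
  obtain K :: "nat \<Rightarrow> 'g set" where K: "\<And>n. compact (K n)" "\<And>s. \<exists>N. \<forall>n\<ge>N. s \<in> K n"
    by (rule compact_exhaustion) (rule that)
  have "s \<in> (\<Union>n. K n)" for s using K(2)[of s] by auto
  moreover have "K n \<in> sets borel" for n by (rule borel_closed[OF compact_imp_closed[OF K(1)]])
  moreover have "emeasure \<mu> (K n) \<noteq> \<infinity>" for n using haar K(1)[of n] by (auto simp: haar_measure_def)
  ultimately show "\<exists>A. countable A \<and> A \<subseteq> sets \<mu> \<and> \<Union> A = space \<mu> \<and> (\<forall>a\<in>A. emeasure \<mu> a \<noteq> \<infinity>)"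
    by (intro exI[of _ "range K"]) auto
qed

text \<open>Fubini on the product of Haar measure with counting measure: the double integral of the
  moduli is \<open>total\<close> times the L1 norm of \<xi>, and the transform is then applied to
  each term.\<close>

lemma fourier_op_series:
  assumes "shift_series \<mu> \<rho> L a" and \<xi>: "\<xi> \<in> L1_space \<mu>"
    and fou: "\<And>x. x \<in> L \<Longrightarrow> fourier \<mu> (\<rho> x \<xi>) = \<rho>' x (fourier \<mu> \<xi>)"
  shows "op_series \<rho> L a \<xi> \<in> L1_space \<mu>"
    and "fourier \<mu> (op_series \<rho> L a \<xi>) = op_series \<rho>' L a (fourier \<mu> \<xi>)"
proof -
  interpret shift_series \<mu> \<rho> L a by fact
  interpret C: sigma_finite_measure "count_space L" by (rule sigma_finite_measure_count_space_countable[OF countable])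
  interpret P: pair_sigma_finite \<mu> "count_space L"
    by (simp add: pair_sigma_finite_def sigma_finite C.sigma_finite_measure_axioms)
  have m: "\<xi> \<in> borel_measurable borel" by (rule L1_measurable[OF haar \<xi>])
  let ?f = "\<lambda>\<gamma> (s, x). a x * \<rho> x \<xi> s * cnj (character \<gamma> s)"
  have int: "integrable (\<mu> \<Otimes>\<^sub>M count_space L) (?f \<gamma>)" for \<gamma>
  proof (rule integrableI_bounded)
    have [measurable]: "character \<gamma> \<in> borel_measurable \<mu>" unfolding borel by (rule character_measurable)
    have [measurable]: "(\<lambda>z. a (snd z) * \<rho> (snd z) \<xi> (fst z)) \<in> borel_measurable (\<mu> \<Otimes>\<^sub>M count_space L)"
      using measurable_pair[OF m] by (simp add: case_prod_unfold)
    show meas: "?f \<gamma> \<in> borel_measurable (\<mu> \<Otimes>\<^sub>M count_space L)"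
      unfolding case_prod_unfold by measurable
    have "(\<integral>\<^sup>+z. ennreal (norm (?f \<gamma> z)) \<partial>(\<mu> \<Otimes>\<^sub>M count_space L))
        = (\<integral>\<^sup>+s. \<integral>\<^sup>+x. ennreal (norm (?f \<gamma> (s, x))) \<partial>count_space L \<partial>\<mu>)"
      by (rule C.nn_integral_fst[symmetric]) (use meas in measurable)
    also have "\<dots> = (\<integral>\<^sup>+s. \<integral>\<^sup>+x. ennreal (cmod (a x)) * ennreal (cmod (\<rho> x \<xi> s)) \<partial>count_space L \<partial>\<mu>)"
      by (simp add: norm_mult ennreal_mult)
    also have "\<dots> = (\<integral>\<^sup>+x. \<integral>\<^sup>+s. ennreal (cmod (a x)) * ennreal (cmod (\<rho> x \<xi> s)) \<partial>\<mu> \<partial>count_space L)"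
    proof (rule nn_integral_count_space_nn_integral[OF countable])
      fix x assume "x \<in> L"
      then have [measurable]: "\<rho> x \<xi> \<in> borel_measurable \<mu>" unfolding borel by (rule measurable_term[OF m])
      show "(\<lambda>s. ennreal (cmod (a x)) * ennreal (cmod (\<rho> x \<xi> s))) \<in> borel_measurable \<mu>" by measurable
    qed
    also have "\<dots> = (\<integral>\<^sup>+x. ennreal (cmod (a x)) * (\<integral>\<^sup>+s. ennreal (cmod (\<xi> s)) \<partial>\<mu>) \<partial>count_space L)"
    proof (intro nn_integral_cong)
      fix x assume "x \<in> space (count_space L)"
      then have x: "x \<in> L" by simp
      then have [measurable]: "\<rho> x \<xi> \<in> borel_measurable \<mu>" unfolding borel by (rule measurable_term[OF m])
      have "(\<integral>\<^sup>+s. ennreal (cmod (\<rho> x \<xi> s)) \<partial>\<mu>) = (\<integral>\<^sup>+s. ennreal (cmod (\<xi> s)) \<partial>\<mu>)"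
        by (rule unimodular_shift_nn_integral[OF haar shift[OF x] m]) measurable
      then show "(\<integral>\<^sup>+s. ennreal (cmod (a x)) * ennreal (cmod (\<rho> x \<xi> s)) \<partial>\<mu>)
          = ennreal (cmod (a x)) * (\<integral>\<^sup>+s. ennreal (cmod (\<xi> s)) \<partial>\<mu>)"
        by (subst nn_integral_cmult) auto
    qed
    also have "\<dots> = total * (\<integral>\<^sup>+s. ennreal (cmod (\<xi> s)) \<partial>\<mu>)"
      unfolding total_def by (rule nn_integral_multc) simp
    also have "\<dots> < \<infinity>"
      using total_finite \<xi> by (simp add: L1_space_def integrable_iff_bounded ennreal_mult_less_top)
    finally show "(\<integral>\<^sup>+z. ennreal (norm (?f \<gamma> z)) \<partial>(\<mu> \<Otimes>\<^sub>M count_space L)) < \<infinity>" .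
  qed
  \<comment> \<open>The trivial character reduces the integrand to the terms of the series.\<close>
  show "op_series \<rho> L a \<xi> \<in> L1_space \<mu>"
    using P.integrable_fst'[OF int[of 0]] by (simp add: L1_space_def op_series_eq_integral[abs_def])
  show "fourier \<mu> (op_series \<rho> L a \<xi>) = op_series \<rho>' L a (fourier \<mu> \<xi>)"
  proof
    fix \<gamma>
    have "fourier \<mu> (op_series \<rho> L a \<xi>) \<gamma> = (\<integral>s. (\<integral>x. a x * \<rho> x \<xi> s * cnj (character \<gamma> s) \<partial>count_space L) \<partial>\<mu>)"
      by (simp add: fourier_def op_series_eq_integral)
    also have "\<dots> = (\<integral>x. (\<integral>s. a x * \<rho> x \<xi> s * cnj (character \<gamma> s) \<partial>\<mu>) \<partial>count_space L)"
      by (rule P.Fubini_integral[symmetric]) (rule int)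
    also have "\<dots> = (\<integral>x. a x * \<rho>' x (fourier \<mu> \<xi>) \<gamma> \<partial>count_space L)"
    proof (intro Bochner_Integration.integral_cong refl)
      fix x assume "x \<in> space (count_space L)"
      then have "fourier \<mu> (\<rho> x \<xi>) \<gamma> = \<rho>' x (fourier \<mu> \<xi>) \<gamma>" using fou by simp
      then show "(\<integral>s. a x * \<rho> x \<xi> s * cnj (character \<gamma> s) \<partial>\<mu>) = a x * \<rho>' x (fourier \<mu> \<xi>) \<gamma>"
        by (simp add: fourier_def mult.assoc)
    qed
    finally show "fourier \<mu> (op_series \<rho> L a \<xi>) \<gamma> = op_series \<rho>' L a (fourier \<mu> \<xi>) \<gamma>"
      unfolding op_series_eq_integral .
  qed
qed

text \<open>The integral bounds the change of a coefficient when t moves away from 0. The factor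
  \<psi> s stays in the integrand because, \<psi> being bounded, it supplies the integrable
  majorant.\<close>

lemma translation_continuous:
  assumes \<psi>: "\<psi> \<in> schwartz"
  shows "((\<lambda>t. \<integral>s. cmod (\<psi> s * cnj (\<psi> (s - t) - \<psi> s)) \<partial>\<mu>) \<longlongrightarrow> 0) (at (0::'g))"
  unfolding tendsto_at_iff_sequentially comp_def
proof (intro allI impI)
  fix t :: "nat \<Rightarrow> 'g" assume t: "t \<longlonglongrightarrow> 0"
  obtain B where B: "\<And>s. cmod (\<psi> s) \<le> B" using schwartz_bound[OF \<psi>] by blast
  have [measurable]: "\<psi> \<in> borel_measurable \<mu>" "(\<lambda>s. \<psi> (s - r)) \<in> borel_measurable \<mu>" for r
    using schwartz_measurable[OF \<psi>] measurable_diff_right by simp_all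
  have "(\<lambda>n. \<integral>s. cmod (\<psi> s * cnj (\<psi> (s - t n) - \<psi> s)) \<partial>\<mu>) \<longlonglongrightarrow> (\<integral>s. cmod (\<psi> s * cnj (\<psi> s - \<psi> s)) \<partial>\<mu>)"
  proof (rule integral_dominated_convergence[where w = "\<lambda>s. 2 * B * cmod (\<psi> s)"])
    show "integrable \<mu> (\<lambda>s. 2 * B * cmod (\<psi> s))"
      by (intro integrable_mult_right integrable_norm schwartz_integrable \<psi>)
    show "AE s in \<mu>. (\<lambda>n. cmod (\<psi> s * cnj (\<psi> (s - t n) - \<psi> s))) \<longlonglongrightarrow> cmod (\<psi> s * cnj (\<psi> s - \<psi> s))"
    proof (rule AE_I2)
      fix s
      have "(\<lambda>n. s - t n) \<longlonglongrightarrow> s - 0" by (intro tendsto_intros t)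
      then have "(\<lambda>n. \<psi> (s - t n)) \<longlonglongrightarrow> \<psi> s"
        using continuous_on_tendsto_compose[OF schwartz_continuous[OF \<psi>]] by simp
      then show "(\<lambda>n. cmod (\<psi> s * cnj (\<psi> (s - t n) - \<psi> s))) \<longlonglongrightarrow> cmod (\<psi> s * cnj (\<psi> s - \<psi> s))"
        by (intro tendsto_intros)
    qed
    show "AE s in \<mu>. norm (cmod (\<psi> s * cnj (\<psi> (s - t n) - \<psi> s))) \<le> 2 * B * cmod (\<psi> s)" for n
    proof (rule AE_I2)
      fix s
      have "cmod (\<psi> (s - t n) - \<psi> s) \<le> B + B"
        by (rule order_trans[OF norm_triangle_ineq4]) (intro add_mono B)
      then have "cmod (\<psi> s) * cmod (\<psi> (s - t n) - \<psi> s) \<le> cmod (\<psi> s) * (B + B)" by (intro mult_left_mono) auto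
      then show "norm (cmod (\<psi> s * cnj (\<psi> (s - t n) - \<psi> s))) \<le> 2 * B * cmod (\<psi> s)"
        by (simp only: norm_mult complex_mod_cnj real_norm_def abs_mult abs_norm_cancel) (simp add: mult_ac)
    qed
  qed measurable
  then show "(\<lambda>n. \<integral>s. cmod (\<psi> s * cnj (\<psi> (s - t n) - \<psi> s)) \<partial>\<mu>) \<longlonglongrightarrow> 0" by simp
qed

text \<open>\<alpha> is a third of the modulus at the origin: continuity in the frequency keeps the
  modulus above 2 \<alpha> at t = 0, and moving t slightly costs at most \<alpha>.\<close>

lemma coefficient_bounded_below:
  assumes \<psi>: "\<psi> \<in> schwartz" and nz: "L2_inner \<mu> \<psi> (tf_shift 0 \<psi>) \<noteq> 0"
  obtains A B \<alpha> where "open A" "0 \<in> A" "open B" "0 \<in> B" "\<alpha> > 0"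
    "\<And>\<gamma> t. \<gamma> \<in> A \<Longrightarrow> t \<in> B \<Longrightarrow> \<alpha> \<le> cmod (L2_inner \<mu> \<psi> (tf_shift (\<gamma>, t) \<psi>))"
proof -
  let ?h = "\<lambda>t s. \<psi> s * cnj (\<psi> (s - t))"
  let ?m = "\<lambda>t. \<integral>s. cmod (\<psi> s * cnj (\<psi> (s - t) - \<psi> s)) \<partial>\<mu>"
  have a: "L2_inner \<mu> \<psi> (tf_shift (\<gamma>, t) \<psi>) = fourier \<mu> (?h t) \<gamma>" for \<gamma> t by (simp add: coefficient_eq_fourier)
  define \<alpha> where "\<alpha> = cmod (fourier \<mu> (?h 0) 0) / 3"
  have \<alpha>: "\<alpha> > 0" using nz a[of 0 0] by (simp add: \<alpha>_def zero_prod_def)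
  have "continuous_on UNIV (fourier \<mu> (?h 0))" by (rule continuous_fourier[OF coefficient_integrable[OF \<psi> \<psi>]])
  then have "open ((\<lambda>\<gamma>. cmod (fourier \<mu> (?h 0) \<gamma>)) -` {2 * \<alpha> <..})"
    by (intro open_vimage continuous_intros) auto
  moreover have "0 \<in> (\<lambda>\<gamma>. cmod (fourier \<mu> (?h 0) \<gamma>)) -` {2 * \<alpha> <..}" using \<alpha> by (simp add: \<alpha>_def)
  moreover have "\<forall>\<^sub>F t in at (0::'g). ?m t < \<alpha>" by (rule order_tendstoD(2)[OF translation_continuous[OF \<psi>] \<alpha>])
  then obtain B where B: "open B" "0 \<in> B" "\<And>t. t \<in> B \<Longrightarrow> t \<noteq> 0 \<Longrightarrow> ?m t < \<alpha>"
    unfolding eventually_at_topological by auto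
  moreover have "\<alpha> \<le> cmod (L2_inner \<mu> \<psi> (tf_shift (\<gamma>, t) \<psi>))"
    if "\<gamma> \<in> (\<lambda>\<gamma>. cmod (fourier \<mu> (?h 0) \<gamma>)) -` {2 * \<alpha> <..}" "t \<in> B" for \<gamma> t
  proof -
    have i: "integrable \<mu> (\<lambda>s. ?h t s - ?h 0 s)"
      by (intro Bochner_Integration.integrable_diff coefficient_integrable \<psi>)
    have "fourier \<mu> (?h t) \<gamma> - fourier \<mu> (?h 0) \<gamma> = fourier \<mu> (\<lambda>s. ?h t s - ?h 0 s) \<gamma>"
      unfolding fourier_def left_diff_distrib
      by (rule Bochner_Integration.integral_diff[symmetric]) (intro integrable_mult_character haar coefficient_integrable \<psi>)+
    also have "cmod \<dots> \<le> (\<integral>s. cmod (?h t s - ?h 0 s) \<partial>\<mu>)" by (rule fourier_bound[OF haar i])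
    also have "\<dots> = ?m t" by (simp add: algebra_simps)
    \<comment> \<open>At t = 0 the integrand vanishes; the limit controls t \<noteq> 0.\<close>
    also have "\<dots> \<le> \<alpha>" using B(3)[OF that(2)] \<alpha> by (cases "t = 0") auto
    finally have "cmod (fourier \<mu> (?h t) \<gamma> - fourier \<mu> (?h 0) \<gamma>) \<le> \<alpha>" .
    moreover have "cmod (fourier \<mu> (?h 0) \<gamma>) > 2 * \<alpha>" using that(1) by simp
    ultimately show ?thesis unfolding a
      using norm_triangle_ineq2[of "fourier \<mu> (?h 0) \<gamma>" "fourier \<mu> (?h t) \<gamma>"] by (simp add: norm_minus_commute)
  qed
  ultimately show ?thesis using \<alpha> that by blast
qed

text \<open>
  The frame identity applied to a positive function forces the defining series to converge, so its
  coefficients, which are bounded below near 0, can live on only finitely many lattice points there.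
\<close>

lemma tight_frame_locally_finite:
  assumes \<psi>: "\<psi> \<in> schwartz"
    and frame: "op_eq \<mu> (right_product \<mu> tf_shift tf_shift_adj c L \<psi> \<psi>) (\<lambda>\<xi>. \<xi>)"
  obtains U where "open U" "0 \<in> U" "finite (L \<inter> U)"
proof -
  let ?a = "\<lambda>x. L2_inner \<mu> (tf_shift x \<psi>) \<psi>"
  \<comment> \<open>The test function is in L2, continuous and nowhere zero, so its values near s0
    are bounded below.\<close>
  let ?w = "\<lambda>s. complex_of_real (weight qs s)"
  have "?w \<in> L2_space \<mu>"
    by (rule weight_dominated(2)[of _ 1]) (auto simp: abs_of_pos weight_pos)
  then have ae: "AE s in \<mu>. complex_of_real (1 / c) * op_series tf_shift_adj L ?a ?w s = ?w s"
    using frame by (auto simp: op_eq_def right_product_def)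
  \<comment> \<open>An identity almost everywhere holds at some point because Haar measure is not
    zero.\<close>
  obtain s0 where s0: "complex_of_real (1 / c) * op_series tf_shift_adj L ?a ?w s0 = ?w s0"
  proof (rule ccontr)
    assume "\<not> thesis"
    then have "complex_of_real (1 / c) * op_series tf_shift_adj L ?a ?w s \<noteq> ?w s" for s using that by blast
    then have "AE s in \<mu>. False" using ae by simp
    then show False using haar by (simp add: AE_iff_null null_sets_def haar_measure_def)
  qed
  have "?w s0 \<noteq> 0" using weight_pos[of qs s0] by simp
  then have ser: "op_series tf_shift_adj L ?a ?w s0 \<noteq> 0" using s0 by auto
  \<comment> \<open>A divergent \<open>infsum\<close> has value 0, whereas the series is nonzero at
    s0. For complex terms convergence of the unordered sum is absolute.\<close>
  then have "(\<lambda>x. ?a x * tf_shift_adj x ?w s0) summable_on L"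
    unfolding op_series_def using infsum_not_exists by blast
  then have sum: "(\<lambda>x. cmod (?a x * tf_shift_adj x ?w s0)) summable_on L"
    by (simp only: summable_on_iff_abs_summable_on_complex)
  have norm_a: "cmod (?a x) = cmod (L2_inner \<mu> \<psi> (tf_shift x \<psi>))" for x
    by (subst L2_inner_commute) simp
  \<comment> \<open>Otherwise \<psi> vanishes almost everywhere, so all coefficients are 0 and the
    series is too.\<close>
  have "L2_inner \<mu> \<psi> (tf_shift 0 \<psi>) \<noteq> 0"
  proof
    assume 0: "L2_inner \<mu> \<psi> (tf_shift 0 \<psi>) = 0"
    have \<psi>2: "\<psi> \<in> L2_space \<mu>" by (rule schwartz_L2[OF \<psi>])
    have "L2_inner \<mu> \<psi> (tf_shift 0 \<psi>) = (\<integral>s. complex_of_real ((cmod (\<psi> s))\<^sup>2) \<partial>\<mu>)"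
      by (simp only: L2_inner_def tf_shift_def zero_prod_def prod.case character_zero_dual mult_1_left diff_zero complex_norm_square)
    also have "\<dots> = complex_of_real (\<integral>s. (cmod (\<psi> s))\<^sup>2 \<partial>\<mu>)" by (rule integral_complex_of_real)
    finally have "L2_nn \<mu> \<psi> = 0" using 0 by (simp add: L2_nn_eq_integral[OF \<psi>2])
    then have ae: "AE s in \<mu>. \<psi> s = 0" using \<psi>2 by (intro L2_nn_eq_0) (auto simp: L2_space_iff)
    have "?a x = 0" for x
      unfolding L2_inner_def by (rule integral_eq_zero_AE) (use ae in eventually_elim, simp)
    then show False using ser by (simp add: op_series_def)
  qed
  then obtain A B \<alpha> where AB: "open A" "0 \<in> A" "open B" "0 \<in> B" "\<alpha> > 0"
    and \<alpha>: "\<And>\<gamma> t. \<gamma> \<in> A \<Longrightarrow> t \<in> B \<Longrightarrow> \<alpha> \<le> cmod (L2_inner \<mu> \<psi> (tf_shift (\<gamma>, t) \<psi>))"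
    by (rule coefficient_bounded_below[OF \<psi>]) (rule that)
  \<comment> \<open>The adjoint shift evaluates the weight at s0 + t, so B is cut down to those t at
    which more than half of the value at s0 remains.\<close>
  let ?B = "B \<inter> (\<lambda>t. weight qs (s0 + t)) -` {weight qs s0 / 2 <..}"
  let ?\<epsilon> = "\<alpha> * (weight qs s0 / 2)"
  have "open ((\<lambda>t. weight qs (s0 + t)) -` {weight qs s0 / 2 <..})"
    by (rule open_vimage) (auto intro!: continuous_on_compose2[OF continuous_weight] continuous_intros)
  then have "open (A \<times> ?B)" using AB by (intro open_Times open_Int)
  moreover have "0 \<in> A \<times> ?B" using AB weight_pos[of qs s0] by (simp add: zero_prod_def)
  moreover have "finite (L \<inter> (A \<times> ?B))"
  proof (rule finite_subset)
    show "L \<inter> (A \<times> ?B) \<subseteq> {x\<in>L. ?\<epsilon> \<le> cmod (?a x * tf_shift_adj x ?w s0)}"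
    proof
      fix x assume x: "x \<in> L \<inter> (A \<times> ?B)"
      obtain \<gamma> t where gt: "x = (\<gamma>, t)" by (cases x)
      have "\<alpha> \<le> cmod (?a x)" unfolding norm_a gt using x gt by (intro \<alpha>) auto
      moreover have "weight qs s0 / 2 \<le> cmod (tf_shift_adj x ?w s0)"
        using x gt weight_pos[of qs "s0 + t"] by (simp add: tf_shift_adj_def norm_mult abs_of_pos)
      ultimately have "?\<epsilon> \<le> cmod (?a x * tf_shift_adj x ?w s0)"
        unfolding norm_mult using weight_pos[of qs s0] AB by (intro mult_mono) auto
      then show "x \<in> {x\<in>L. ?\<epsilon> \<le> cmod (?a x * tf_shift_adj x ?w s0)}" using x by blast
    qed
    show "finite {x\<in>L. ?\<epsilon> \<le> cmod (?a x * tf_shift_adj x ?w s0)}"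
      by (rule finite_large_terms[OF sum]) (use AB weight_pos[of qs s0] in auto)
  qed
  ultimately show ?thesis by (rule that)
qed

end

section \<open>Transport of the frame identity and of the duality equation\<close>

lemma compatible_connection_schwartz:
  "compatible_connection M \<rho> \<rho>' c \<Lambda> \<Lambda>' d d' D \<Longrightarrow> f \<in> schwartz \<Longrightarrow> D f \<in> schwartz"
  by (simp add: compatible_connection_def Let_def)

lemma compatible_connection_left_product:
  "compatible_connection M \<rho> \<rho>' c \<Lambda> \<Lambda>' d d' D \<Longrightarrow> f \<in> schwartz \<Longrightarrow> g \<in> schwartz \<Longrightarrow>
    op_eq M (d (left_product M \<rho> \<Lambda> f g))
      (\<lambda>\<zeta> s. left_product M \<rho> \<Lambda> (D f) g \<zeta> s + left_product M \<rho> \<Lambda> f (D g) \<zeta> s)"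
  by (simp add: compatible_connection_def Let_def)

context haar_coordinates
begin

lemma schwartz_L1_L2: "f \<in> schwartz \<Longrightarrow> f \<in> L1_space \<mu> \<inter> L2_space \<mu>"
  using schwartz_L1 schwartz_L2 by blast

lemma dual_coefficient:
  assumes pl: "plancherel \<mu> \<nu>" and f: "f \<in> schwartz" and g: "g \<in> schwartz"
  shows "L2_inner \<nu> (fourier \<mu> f) (dual_tf_shift x (fourier \<mu> g)) = L2_inner \<mu> f (tf_shift x g)"
  unfolding fourier_tf_shift[OF haar schwartz_L1[OF g], symmetric]
  by (rule fourier_inner[OF haar pl schwartz_L1_L2[OF f]
        unimodular_shift_L1_L2[OF haar unimodular_shift_tf_shift schwartz_L1_L2[OF g]]])

text \<open>L is only a subgroup here. Its local finiteness comes from \<open>frame\<close>, and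
  with it the countability and summability that make both frame operators shift series with the same
  coefficients.\<close>

lemma tight_frame_fourier:
  assumes pl: "plancherel \<mu> \<nu>" and haar': "haar_measure \<nu>" and \<psi>: "\<psi> \<in> schwartz"
    and diff: "\<And>x y. x \<in> L \<Longrightarrow> y \<in> L \<Longrightarrow> x - y \<in> L"
    and frame: "op_eq \<mu> (right_product \<mu> tf_shift tf_shift_adj c L \<psi> \<psi>) (\<lambda>\<xi>. \<xi>)"
  shows "op_eq \<nu> (right_product \<nu> dual_tf_shift dual_tf_shift_adj c L (fourier \<mu> \<psi>) (fourier \<mu> \<psi>)) (\<lambda>\<xi>. \<xi>)"
proof -
  obtain U where U: "open U" "0 \<in> U" "finite (L \<inter> U)"
    by (rule tight_frame_locally_finite[OF \<psi> frame]) (rule that)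
  let ?a = "\<lambda>x. L2_inner \<mu> (tf_shift x \<psi>) \<psi>"
  have a: "L2_inner \<nu> (dual_tf_shift x (fourier \<mu> \<psi>)) (fourier \<mu> \<psi>) = ?a x" for x
    using dual_coefficient[OF pl \<psi> \<psi>, of x] L2_inner_commute by metis
  have "cmod (?a x) = cmod (L2_inner \<mu> \<psi> (tf_shift x \<psi>))" for x
    by (subst L2_inner_commute) simp
  then have sum: "(\<lambda>x. cmod (?a x)) summable_on L"
    using coefficient_summable_on_subgroup[OF \<psi> \<psi> diff U] by (simp only:)
  have countable: "countable L" by (rule countable_subgroup[OF diff U])
  have S: "shift_series \<mu> tf_shift_adj L ?a" and S': "shift_series \<nu> dual_tf_shift_adj L ?a"
    by (intro shift_series.intro haar haar' countable sum unimodular_shift_tf_shift_adj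
        unimodular_shift_dual_tf_shift_adj)+
  \<comment> \<open>The summand 0 presents the scalar multiple as a linear combination, to which
    \<open>L2_lipschitz_lincomb\<close> applies.\<close>
  have "op_eq \<nu> (\<lambda>\<xi> s. of_real (1 / c) * op_series dual_tf_shift_adj L ?a \<xi> s + 0) (\<lambda>\<xi>. \<xi>)"
  proof (rule L2_lipschitz_eqI[OF pl])
    show "L2_lipschitz \<nu> (\<lambda>\<xi> s. of_real (1 / c) * op_series dual_tf_shift_adj L ?a \<xi> s + 0)"
      by (rule L2_lipschitz_lincomb[OF shift_series.op_series_lipschitz[OF S'] L2_lipschitz_zero])
    show "L2_lipschitz \<nu> (\<lambda>\<xi>. \<xi>)" by (rule L2_lipschitz_id)
    fix f assume f: "f \<in> L1_space \<mu> \<inter> L2_space \<mu>"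
    then have f1: "f \<in> L1_space \<mu>" and f2: "f \<in> L2_space \<mu>" by auto
    note ser = fourier_op_series[where \<rho> = tf_shift_adj and \<rho>' = dual_tf_shift_adj, OF S f1 fourier_tf_shift_adj[OF haar f1]]
    have m: "f \<in> borel_measurable borel" "op_series tf_shift_adj L ?a f \<in> borel_measurable borel"
      using L1_measurable[OF haar] f1 ser(1) by blast+
    have "fourier \<mu> (\<lambda>s. of_real (1 / c) * op_series tf_shift_adj L ?a f s) = fourier \<mu> f"
    proof (rule fourier_cong_AE[OF haar _ m(1)])
      show "(\<lambda>s. of_real (1 / c) * op_series tf_shift_adj L ?a f s) \<in> borel_measurable borel"
        using m(2) by measurable
      show "AE s in \<mu>. of_real (1 / c) * op_series tf_shift_adj L ?a f s = f s"
        using frame f2 by (simp add: op_eq_def right_product_def)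
    qed
    then show "AE s in \<nu>. of_real (1 / c) * op_series dual_tf_shift_adj L ?a (fourier \<mu> f) s + 0 = fourier \<mu> f s"
      unfolding ser(2)[symmetric] fourier_scale[symmetric] by simp
  qed
  then show ?thesis by (simp add: right_product_def a)
qed

lemma left_product_shift_series:
  assumes f: "f \<in> schwartz" and g: "g \<in> schwartz" and "is_lattice \<Lambda>"
  shows "shift_series \<mu> tf_shift \<Lambda> (\<lambda>x. L2_inner \<mu> f (tf_shift x g))"
proof -
  have diff: "x - y \<in> \<Lambda>" if "x \<in> \<Lambda>" "y \<in> \<Lambda>" for x y using assms(3) that by (simp add: is_lattice_def)
  obtain U where U: "open U" "0 \<in> U" "finite (\<Lambda> \<inter> U)" by (rule lattice_locally_finite[OF assms(3)]) (rule that)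
  show ?thesis
    by (intro shift_series.intro haar countable_subgroup[OF diff U] unimodular_shift_tf_shift
        coefficient_summable_on_subgroup[OF f g diff U])
qed

lemma left_product_L1_L2:
  assumes "f \<in> schwartz" "g \<in> schwartz" "is_lattice \<Lambda>" and \<xi>: "\<xi> \<in> L1_space \<mu> \<inter> L2_space \<mu>"
  shows "left_product \<mu> tf_shift \<Lambda> f g \<xi> \<in> L1_space \<mu> \<inter> L2_space \<mu>"
proof -
  have \<xi>1: "\<xi> \<in> L1_space \<mu>" and \<xi>2: "\<xi> \<in> L2_space \<mu>" using \<xi> by auto
  note S = left_product_shift_series[OF assms(1-3)]
  show ?thesis unfolding left_product_def
    using fourier_op_series(1)[where \<rho> = tf_shift and \<rho>' = dual_tf_shift, OF S \<xi>1 fourier_tf_shift[OF haar \<xi>1]] shift_series.op_series_L2[OF S \<xi>2] by blast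
qed

lemma fourier_left_product:
  assumes pl: "plancherel \<mu> \<nu>" and "f \<in> schwartz" "g \<in> schwartz" "is_lattice \<Lambda>" and \<xi>: "\<xi> \<in> L1_space \<mu>"
  shows "left_product \<nu> dual_tf_shift \<Lambda> (fourier \<mu> f) (fourier \<mu> g) (fourier \<mu> \<xi>)
    = fourier \<mu> (left_product \<mu> tf_shift \<Lambda> f g \<xi>)"
  unfolding left_product_def dual_coefficient[OF assms(1-3)]
  by (rule fourier_op_series(2)[where \<rho> = tf_shift and \<rho>' = dual_tf_shift, OF left_product_shift_series[OF assms(2-4)] \<xi> fourier_tf_shift[OF haar \<xi>], symmetric])

text \<open>The dual operator has the coefficients of the original one, so their summability is
  inherited.\<close>

lemma dual_left_product_lipschitz:
  assumes pl: "plancherel \<mu> \<nu>" and haar': "haar_measure \<nu>" and f: "f \<in> schwartz" and g: "g \<in> schwartz"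
    and "is_lattice \<Lambda>"
  shows "L2_lipschitz \<nu> (left_product \<nu> dual_tf_shift \<Lambda> (fourier \<mu> f) (fourier \<mu> g))"
proof -
  interpret S: shift_series \<mu> tf_shift \<Lambda> "\<lambda>x. L2_inner \<mu> f (tf_shift x g)"
    by (rule left_product_shift_series[OF f g assms(5)])
  have "shift_series \<nu> dual_tf_shift \<Lambda> (\<lambda>x. L2_inner \<mu> f (tf_shift x g))"
    by (intro shift_series.intro haar' S.countable S.summable unimodular_shift_dual_tf_shift)
  from shift_series.op_series_lipschitz[OF this] show ?thesis
    unfolding left_product_def dual_coefficient[OF pl f g] .
qed

text \<open>
  The Fourier transform exchanges the two covariant derivatives, so it carries
  \<open>\<partial>\<^sub>1 + \<i> \<partial>\<^sub>2\<close> of the first projection to \<open>\<i>\<close> times \<open>\<partial>\<^sub>1 - \<i> \<partial>\<^sub>2\<close> of the second one.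
\<close>

lemma anti_self_dual_fourier:
  assumes pl: "plancherel \<mu> \<nu>" and haar': "haar_measure \<nu>" and lat: "is_lattice \<Lambda>"
    and c1: "compatible_connection \<mu> tf_shift tf_shift_adj c \<Lambda> \<Lambda>' d1 d1' nabla1"
    and c2: "compatible_connection \<mu> tf_shift tf_shift_adj c \<Lambda> \<Lambda>' d2 d2' nabla2"
    and h1: "compatible_connection \<nu> dual_tf_shift dual_tf_shift_adj c \<Lambda> \<Lambda>' e1 e1' nabla1_hat"
    and h2: "compatible_connection \<nu> dual_tf_shift dual_tf_shift_adj c \<Lambda> \<Lambda>' e2 e2' nabla2_hat"
    and F1: "\<And>\<xi>. \<xi> \<in> schwartz \<Longrightarrow> fourier \<mu> (nabla1 \<xi>) = nabla2_hat (fourier \<mu> \<xi>)"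
    and F2: "\<And>\<xi>. \<xi> \<in> schwartz \<Longrightarrow> fourier \<mu> (nabla2 \<xi>) = nabla1_hat (fourier \<mu> \<xi>)"
    and \<psi>: "\<psi> \<in> schwartz" and sd: "self_dual \<mu> d1 d2 (left_product \<mu> tf_shift \<Lambda> \<psi> \<psi>)"
  shows "anti_self_dual \<nu> e1 e2 (left_product \<nu> dual_tf_shift \<Lambda> (fourier \<mu> \<psi>) (fourier \<mu> \<psi>))"
proof -
  let ?lp = "left_product \<mu> tf_shift \<Lambda>" and ?lq = "left_product \<nu> dual_tf_shift \<Lambda>"
  let ?P = "?lp \<psi> \<psi>" and ?F = "fourier \<mu>"
  let ?Q = "?lq (?F \<psi>) (?F \<psi>)"
  note \<psi>' = fourier_schwartz[OF \<psi>]
  have n: "nabla1 \<psi> \<in> schwartz" "nabla2 \<psi> \<in> schwartz"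
    using c1 c2 \<psi> by (auto intro: compatible_connection_schwartz)
  \<comment> \<open>A f and B f are the Leibniz terms for the derivative of the two projections when
    f is a covariant derivative of \<psi>; f is a function on the group in both, and B transforms
    it. The factor 1 matches \<open>L2_lipschitz_lincomb\<close>.\<close>
  define A where "A f \<zeta> = (\<lambda>s. 1 * ?lp f \<psi> \<zeta> s + ?lp \<psi> f \<zeta> s)" for f \<zeta>
  define B where "B f \<zeta> = (\<lambda>s. 1 * ?lq (?F f) (?F \<psi>) \<zeta> s + ?lq (?F \<psi>) (?F f) \<zeta> s)" for f \<zeta>
  have d: "op_eq \<mu> (d1 ?P) (A (nabla1 \<psi>))" "op_eq \<mu> (d2 ?P) (A (nabla2 \<psi>))"
    unfolding A_def mult_1_left
    by (rule compatible_connection_left_product[OF c1 \<psi> \<psi>], rule compatible_connection_left_product[OF c2 \<psi> \<psi>])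
  have "op_eq \<nu> (e1 ?Q) (\<lambda>\<zeta> s. ?lq (nabla1_hat (?F \<psi>)) (?F \<psi>) \<zeta> s + ?lq (?F \<psi>) (nabla1_hat (?F \<psi>)) \<zeta> s)"
    "op_eq \<nu> (e2 ?Q) (\<lambda>\<zeta> s. ?lq (nabla2_hat (?F \<psi>)) (?F \<psi>) \<zeta> s + ?lq (?F \<psi>) (nabla2_hat (?F \<psi>)) \<zeta> s)"
    by (rule compatible_connection_left_product[OF h1 \<psi>' \<psi>'], rule compatible_connection_left_product[OF h2 \<psi>' \<psi>'])
  \<comment> \<open>The exchange of indices enters here: e1 belongs to \<open>nabla1_hat\<close>,
    whose value at the transform of \<psi> is the transform of \<open>nabla2 \<psi>\<close>.\<close>
  then have e: "op_eq \<nu> (e1 ?Q) (B (nabla2 \<psi>))" "op_eq \<nu> (e2 ?Q) (B (nabla1 \<psi>))"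
    unfolding F1[OF \<psi>, symmetric] F2[OF \<psi>, symmetric] B_def mult_1_left .
  have lipQ: "L2_lipschitz \<nu> ?Q" by (rule dual_left_product_lipschitz[OF pl haar' \<psi> \<psi> lat])
  have lipB: "L2_lipschitz \<nu> (B f)" if "f \<in> schwartz" for f
    unfolding B_def by (intro L2_lipschitz_lincomb dual_left_product_lipschitz pl haar' \<psi> lat that)
  have AF: "A f \<zeta> \<in> L1_space \<mu>" "B f (?F \<zeta>) = ?F (A f \<zeta>)"
    if f: "f \<in> schwartz" and \<zeta>: "\<zeta> \<in> L1_space \<mu> \<inter> L2_space \<mu>" for f \<zeta>
  proof -
    have i: "integrable \<mu> (?lp f \<psi> \<zeta>)" "integrable \<mu> (?lp \<psi> f \<zeta>)"
      using left_product_L1_L2[OF f \<psi> lat \<zeta>] left_product_L1_L2[OF \<psi> f lat \<zeta>] by (auto simp: L1_space_def)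
    then show "A f \<zeta> \<in> L1_space \<mu>" by (simp add: A_def L1_space_def)
    have \<zeta>1: "\<zeta> \<in> L1_space \<mu>" using \<zeta> by blast
    show "B f (?F \<zeta>) = ?F (A f \<zeta>)"
      by (rule ext) (simp add: A_def B_def fourier_add[OF haar i] fourier_left_product[OF pl f \<psi> lat \<zeta>1]
          fourier_left_product[OF pl \<psi> f lat \<zeta>1])
  qed
  \<comment> \<open>With the Leibniz terms in place of the derivatives, e1 - i e2 becomes B (nabla2
    \<psi>) - i B (nabla1 \<psi>), which is - i times B (nabla1 \<psi>) + i B (nabla2 \<psi>), the
    counterpart of d1 + i d2.\<close>
  have "op_eq \<nu> (\<lambda>\<eta> s. - \<i> * B (nabla1 \<psi>) (?Q \<eta>) s + B (nabla2 \<psi>) (?Q \<eta>) s) (\<lambda>\<eta> s. 0)"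
  proof (rule L2_lipschitz_eqI[OF pl])
    show "L2_lipschitz \<nu> (\<lambda>\<eta> s. - \<i> * B (nabla1 \<psi>) (?Q \<eta>) s + B (nabla2 \<psi>) (?Q \<eta>) s)"
      by (intro L2_lipschitz_lincomb L2_lipschitz_comp[OF lipB lipQ] n)
    show "L2_lipschitz \<nu> (\<lambda>\<eta> s. 0)" by (rule L2_lipschitz_zero)
    fix f assume f: "f \<in> L1_space \<mu> \<inter> L2_space \<mu>"
    then have f1: "f \<in> L1_space \<mu>" and f2: "f \<in> L2_space \<mu>" by auto
    let ?g = "?P f"
    have g: "?g \<in> L1_space \<mu> \<inter> L2_space \<mu>" by (rule left_product_L1_L2[OF \<psi> \<psi> lat f])
    then have g2: "?g \<in> L2_space \<mu>" by blast
    have Q: "?Q (?F f) = ?F ?g" by (rule fourier_left_product[OF pl \<psi> \<psi> lat f1])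
    have "AE s in \<mu>. d1 ?P ?g s + \<i> * d2 ?P ?g s = 0"
      using sd f2 by (simp add: self_dual_def del_bar_def op_eq_def)
    moreover have "AE s in \<mu>. d1 ?P ?g s = A (nabla1 \<psi>) ?g s" "AE s in \<mu>. d2 ?P ?g s = A (nabla2 \<psi>) ?g s"
      using d g2 by (auto simp: op_eq_def)
    ultimately have ae: "AE s in \<mu>. \<i> * A (nabla2 \<psi>) ?g s + A (nabla1 \<psi>) ?g s = 0"
      by eventually_elim (simp add: add.commute)
    have i: "integrable \<mu> (A (nabla1 \<psi>) ?g)" "integrable \<mu> (\<lambda>s. \<i> * A (nabla2 \<psi>) ?g s)"
      using AF(1)[OF n(1) g] AF(1)[OF n(2) g] by (auto simp: L1_space_def)
    have "?F (\<lambda>s. \<i> * A (nabla2 \<psi>) ?g s + A (nabla1 \<psi>) ?g s) = ?F (\<lambda>s. 0)"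
    proof (rule fourier_cong_AE[OF haar _ _ ae])
      show "(\<lambda>s. \<i> * A (nabla2 \<psi>) ?g s + A (nabla1 \<psi>) ?g s) \<in> borel_measurable borel"
        by (rule L1_measurable[OF haar]) (use i in \<open>simp add: L1_space_def\<close>)
    qed simp
    then have "\<i> * ?F (A (nabla2 \<psi>) ?g) \<delta> + ?F (A (nabla1 \<psi>) ?g) \<delta> = 0" for \<delta>
      using fourier_add[OF haar i(2,1), of \<delta>] by (simp add: fourier_scale fourier_def[of _ "\<lambda>s. 0"])
    then have "- \<i> * (\<i> * ?F (A (nabla2 \<psi>) ?g) \<delta> + ?F (A (nabla1 \<psi>) ?g) \<delta>) = 0" for \<delta> by simp
    then have "- \<i> * ?F (A (nabla1 \<psi>) ?g) \<delta> + ?F (A (nabla2 \<psi>) ?g) \<delta> = 0" for \<delta>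
      by (simp add: algebra_simps)
    then show "AE s in \<nu>. - \<i> * B (nabla1 \<psi>) (?Q (?F f)) s + B (nabla2 \<psi>) (?Q (?F f)) s = 0"
      unfolding Q AF(2)[OF n(1) g] AF(2)[OF n(2) g] by simp
  qed
  then have main: "AE s in \<nu>. - \<i> * B (nabla1 \<psi>) (?Q \<eta>) s + B (nabla2 \<psi>) (?Q \<eta>) s = 0"
    if "\<eta> \<in> L2_space \<nu>" for \<eta> using that by (simp add: op_eq_def)
  show ?thesis
    unfolding anti_self_dual_def op_eq_def del_def
  proof
    fix \<eta> assume \<eta>: "\<eta> \<in> L2_space \<nu>"
    have "?Q \<eta> \<in> L2_space \<nu>" by (rule L2_lipschitz_space[OF lipQ \<eta>])
    then have "AE s in \<nu>. e1 ?Q (?Q \<eta>) s = B (nabla2 \<psi>) (?Q \<eta>) s" "AE s in \<nu>. e2 ?Q (?Q \<eta>) s = B (nabla1 \<psi>) (?Q \<eta>) s"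
      using e by (auto simp: op_eq_def)
    with main[OF \<eta>] show "AE s in \<nu>. e1 ?Q (?Q \<eta>) s - \<i> * e2 ?Q (?Q \<eta>) s = 0"
      by eventually_elim simp
  qed
qed

end

theorem theorem3p4:
  fixes \<mu> :: "'g::{topological_ab_group_add,t2_space,second_countable_topology} measure"
    and \<nu> :: "'g dual_group measure"
    and \<Lambda> \<Lambda>' :: "('g dual_group \<times> 'g) set"
    and c :: real
    and d1 d2 d1' d2' :: "'g oper \<Rightarrow> 'g oper"
    and e1 e2 e1' e2' :: "'g dual_group oper \<Rightarrow> 'g dual_group oper"
    and nabla1 nabla2 :: "('g \<Rightarrow> complex) \<Rightarrow> 'g \<Rightarrow> complex"
    and nabla1_hat nabla2_hat :: "('g dual_group \<Rightarrow> complex) \<Rightarrow> 'g dual_group \<Rightarrow> complex"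
    and \<psi> :: "'g \<Rightarrow> complex"
  assumes "\<Lambda>' = adjoint_lattice \<Lambda>" and "c = covolume (\<nu> \<Otimes>\<^sub>M \<mu>) \<Lambda>"
    and "locally compact (UNIV :: 'g set)" and "elementary_group TYPE('g)"
    and "haar_measure \<mu>" and "haar_measure \<nu>" and "plancherel \<mu> \<nu>"
    and "is_lattice \<Lambda>"
    and "compatible_connection \<mu> tf_shift tf_shift_adj c \<Lambda> \<Lambda>' d1 d1' nabla1"
    and "compatible_connection \<mu> tf_shift tf_shift_adj c \<Lambda> \<Lambda>' d2 d2' nabla2"
    and "compatible_connection \<nu> dual_tf_shift dual_tf_shift_adj c \<Lambda> \<Lambda>' e1 e1' nabla1_hat"
    and "compatible_connection \<nu> dual_tf_shift dual_tf_shift_adj c \<Lambda> \<Lambda>' e2 e2' nabla2_hat"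
    and "\<And>\<xi>. \<xi> \<in> schwartz \<Longrightarrow> fourier \<mu> (nabla1 \<xi>) = nabla2_hat (fourier \<mu> \<xi>)"
    and "\<And>\<xi>. \<xi> \<in> schwartz \<Longrightarrow> fourier \<mu> (nabla2 \<xi>) = nabla1_hat (fourier \<mu> \<xi>)"
    and "\<psi> \<in> schwartz"
    and "op_eq \<mu> (right_product \<mu> tf_shift tf_shift_adj c \<Lambda>' \<psi> \<psi>) (\<lambda>\<xi>. \<xi>)"
    and "self_dual \<mu> d1 d2 (left_product \<mu> tf_shift \<Lambda> \<psi> \<psi>)"
  shows "fourier \<mu> \<psi> \<in> schwartz \<and>
    op_eq \<nu> (right_product \<nu> dual_tf_shift dual_tf_shift_adj c \<Lambda>' (fourier \<mu> \<psi>) (fourier \<mu> \<psi>)) (\<lambda>\<xi>. \<xi>) \<and>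
    anti_self_dual \<nu> e1 e2 (left_product \<nu> dual_tf_shift \<Lambda> (fourier \<mu> \<psi>) (fourier \<mu> \<psi>))"
proof -
  obtain qs Ys where "haar_coordinates \<mu> qs Ys"
    by (rule haar_coordinates_exist[OF assms(4,5)]) (rule that)
  then interpret haar_coordinates \<mu> qs Ys .
  have diff: "x - y \<in> \<Lambda>'" if "x \<in> \<Lambda>'" "y \<in> \<Lambda>'" for x y
    using adjoint_lattice_diff that unfolding assms(1) .
  show ?thesis
    using fourier_schwartz[OF assms(15)] tight_frame_fourier[OF assms(7,6,15) diff assms(16)]
      anti_self_dual_fourier[OF assms(7,6,8-15,17)] by blast
qed

end
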